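(* Let $m\ge1$, let $f_0,\dots,f_m\in\mathbb{C}[z_1,\dots,z_n]/I$, let $a_0=0$ and let $a_1,\dots,a_m$ be positive numbers. Put $F:=\prod_{0\le j\le m}f_j$ and $\varphi:=\log\big(\sum_{1\le j\le m}|f_j|^{\frac1{a_j}}\big)$, regarded as functions on $X$ near $o$. If $\bigcap_{1\le j\le m}\{f_j=0\}=\{o\}$ (as subsets of $X$), then there exists a valuation $\nu$ on $\mathbb{C}[z_1,\dots,z_n]/I$ such that $\nu(f_j)=a_j$ for every $0\le j\le m$ if and only if $\sigma(\log|F|,\varphi)=\sum_{1\le j\le m}a_j$.
   Context: $I$ is a prime ideal in $\mathbb{C}[z_1,\dots,z_n]$, $X:=V(I)\subset\mathbb{C}^n$ is the affine variety defined by $I$, the origin $o$ lies in $X$, and $(X,o)$ is irreducible as a germ of an analytic set. A valuation on $R=\mathbb{C}[z_1,\dots,z_n]/I$ is a nonconstant map $\nu:R\setminus\{0\}\to\mathbb{R}_{\ge0}$ with $\nu(fg)=\nu(f)+\nu(g)$, $\nu(f+g)\ge\min\{\nu(f),\nu(g)\}$ (when $f+g\ne0$), and $\nu(c)=0$ for every nonzero constant $c$; by convention $\nu(0)=+\infty$. Relative type at $o$: for functions $\psi,\varphi$ on $X$ near $o$, $\sigma(\psi,\varphi)=\sup\{c\ge0:\psi\le c\varphi+O(1)\text{ on }U\setminus X_{\mathrm{sing}}\text{ for some open neighborhood }U\text{ of }o\text{ in }X\}\in[0,+\infty]$ (with $\log0=-\infty$). *)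

theory Defs
  imports
    "HOL-Analysis.Analysis"
    "HOL-Library.Poly_Mapping"
    "HOL-Algebra.Algebraic_Closure_Type"
    "HOL-Algebra.QuotRing"
begin

section \<open>Polynomials and coordinate rings\<close>

text \<open>The variables of the polynomial ring are indexed by the finite type \<open>'n\<close>, and a monomial
  is its exponent vector.\<close>

type_synonym 'n cpoly = "('n \<Rightarrow>\<^sub>0 nat) \<Rightarrow>\<^sub>0 complex"

abbreviation cpoly_ring :: "'n cpoly ring" where
  "cpoly_ring \<equiv> ring_of_type_algebra"

definition cpoly_const :: "complex \<Rightarrow> 'n cpoly" where
  "cpoly_const c = Poly_Mapping.single 0 c"

definition cpoly_eval :: "'n::finite cpoly \<Rightarrow> complex ^ 'n \<Rightarrow> complex" where
  "cpoly_eval p x =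
     (\<Sum>e\<in>Poly_Mapping.keys p. Poly_Mapping.lookup p e * (\<Prod>i\<in>UNIV. x $ i ^ Poly_Mapping.lookup e i))"

definition affine_variety :: "'n::finite cpoly set \<Rightarrow> (complex ^ 'n) set" where
  "affine_variety I = {x. \<forall>p\<in>I. cpoly_eval p x = 0}"

abbreviation coord_ring :: "'n cpoly set \<Rightarrow> 'n cpoly set ring" where
  "coord_ring I \<equiv> cpoly_ring Quot I"

text \<open>Elements of the coordinate ring are cosets. The value of a coset at a point of the variety
  is that of any representative, see \<open>coset_eval_eq\<close> below; elsewhere it has no meaning.\<close>

definition coset_eval :: "'n::finite cpoly set \<Rightarrow> complex ^ 'n \<Rightarrow> complex" where
  "coset_eval f x = cpoly_eval (SOME p. p \<in> f) x"

lemma cpoly_eval_add: "cpoly_eval (p + q) x = cpoly_eval p x + cpoly_eval q x"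
proof -
  let ?K = "Poly_Mapping.keys p \<union> Poly_Mapping.keys q"
  have *: "cpoly_eval r x =
      (\<Sum>e\<in>?K. Poly_Mapping.lookup r e * (\<Prod>i\<in>UNIV. x $ i ^ Poly_Mapping.lookup e i))"
    if "Poly_Mapping.keys r \<subseteq> ?K" for r
    unfolding cpoly_eval_def using that
    by (intro sum.mono_neutral_left) (auto simp: in_keys_iff)
  show ?thesis
    by (simp add: * Poly_Mapping.keys_add lookup_add ring_distribs sum.distrib)
qed

lemma coset_eval_eq:
  assumes "f \<in> carrier (coord_ring I)" "p \<in> f" "x \<in> affine_variety I"
  shows "coset_eval f x = cpoly_eval p x"
proof -
  from assms(1) obtain q where f: "f = {h + q | h. h \<in> I}"
    by (auto simp: FactRing_def A_RCOSETS_def' ring_of_type_algebra_def a_r_coset_def')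
  have "cpoly_eval r x = cpoly_eval q x" if "r \<in> f" for r
    using that assms(3) by (auto simp: f cpoly_eval_add affine_variety_def)
  moreover have "(SOME p. p \<in> f) \<in> f"
    using assms(2) by (rule someI)
  ultimately show ?thesis
    using assms(2) by (simp add: coset_eval_def)
qed

section \<open>Valuations\<close>

text \<open>The first condition says that \<open>\<nu>\<close> is real-valued on nonzero elements and infinite at
  zero. With it the ultrametric inequality holds trivially when one of the elements vanishes.\<close>

definition is_valuation :: "'n cpoly set \<Rightarrow> ('n cpoly set \<Rightarrow> ennreal) \<Rightarrow> bool" where
  "is_valuation I \<nu> \<longleftrightarrow>
     (let R = coord_ring I; R' = carrier R - {\<zero>\<^bsub>R\<^esub>} in
       (\<forall>f\<in>carrier R. \<nu> f = \<infinity> \<longleftrightarrow> f = \<zero>\<^bsub>R\<^esub>) \<and>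
       (\<forall>f\<in>R'. \<forall>g\<in>R'. \<nu> (f \<otimes>\<^bsub>R\<^esub> g) = \<nu> f + \<nu> g) \<and>
       (\<forall>f\<in>R'. \<forall>g\<in>R'. f \<oplus>\<^bsub>R\<^esub> g \<noteq> \<zero>\<^bsub>R\<^esub> \<longrightarrow> min (\<nu> f) (\<nu> g) \<le> \<nu> (f \<oplus>\<^bsub>R\<^esub> g)) \<and>
       (\<forall>c. c \<noteq> 0 \<longrightarrow> \<nu> (I +>\<^bsub>cpoly_ring\<^esub> cpoly_const c) = 0) \<and>
       (\<exists>f\<in>R'. \<exists>g\<in>R'. \<nu> f \<noteq> \<nu> g))"

section \<open>Analytic germs and singular points\<close>

definition holomorphic_fun :: "(complex ^ 'n \<Rightarrow> complex) \<Rightarrow> (complex ^ 'n) set \<Rightarrow> bool" where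
  "holomorphic_fun f U \<longleftrightarrow>
     (\<forall>x\<in>U. \<exists>D. (f has_derivative D) (at x) \<and> (\<forall>c v. D (c *s v) = c * D v))"

definition holomorphic_map :: "(complex ^ 'n \<Rightarrow> complex ^ 'm) \<Rightarrow> (complex ^ 'n) set \<Rightarrow> bool" where
  "holomorphic_map \<Phi> U \<longleftrightarrow> (\<forall>i. holomorphic_fun (\<lambda>x. \<Phi> x $ i) U)"

definition analytic_subset :: "(complex ^ 'n) set \<Rightarrow> (complex ^ 'n) set \<Rightarrow> bool" where
  "analytic_subset A U \<longleftrightarrow> A \<subseteq> U \<and>
     (\<forall>x\<in>U. \<exists>W G. open W \<and> x \<in> W \<and> W \<subseteq> U \<and> finite G \<and>
        (\<forall>g\<in>G. holomorphic_fun g W) \<and> A \<inter> W = {y\<in>W. \<forall>g\<in>G. g y = 0})"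

definition irreducible_germ_at :: "(complex ^ 'n) set \<Rightarrow> complex ^ 'n \<Rightarrow> bool" where
  "irreducible_germ_at S p \<longleftrightarrow> p \<in> S \<and>
     (\<forall>U A B. open U \<and> p \<in> U \<and> analytic_subset A U \<and> analytic_subset B U \<and> S \<inter> U = A \<union> B \<longrightarrow>
        (\<exists>V. open V \<and> p \<in> V \<and> (A \<inter> V = S \<inter> V \<or> B \<inter> V = S \<inter> V)))"

text \<open>A point is regular if, in suitable local holomorphic coordinates of the ambient space, the
  set is a complex linear subspace, i.e. if the set is a complex submanifold near the point.\<close>

definition regular_point :: "(complex ^ 'n) set \<Rightarrow> complex ^ 'n \<Rightarrow> bool" where
  "regular_point S x \<longleftrightarrow> x \<in> S \<and>
     (\<exists>U V (\<Phi> :: complex ^ 'n \<Rightarrow> complex ^ 'n) \<Psi> L. open U \<and> x \<in> U \<and> open V \<and>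
        holomorphic_map \<Phi> U \<and> holomorphic_map \<Psi> V \<and> \<Phi> ` U = V \<and> \<Psi> ` V = U \<and>
        (\<forall>y\<in>U. \<Psi> (\<Phi> y) = y) \<and> vec.subspace L \<and> \<Phi> ` (S \<inter> U) = L \<inter> V)"

definition sing_locus :: "(complex ^ 'n) set \<Rightarrow> (complex ^ 'n) set" where
  "sing_locus S = {x\<in>S. \<not> regular_point S x}"

section \<open>Relative type\<close>

text \<open>The logarithm of a nonnegative real number, with value \<open>-\<infinity>\<close> at zero.\<close>

definition elog :: "real \<Rightarrow> ereal" where
  "elog t = (if t = 0 then -\<infinity> else ereal (ln t))"

text \<open>The supremum is taken in \<open>[0,\<infinity>]\<close>; in particular it is \<open>0\<close> if no \<open>c\<close> is admissible.\<close>

definition relative_type ::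
    "(complex ^ 'n) set \<Rightarrow> (complex ^ 'n \<Rightarrow> ereal) \<Rightarrow> (complex ^ 'n \<Rightarrow> ereal) \<Rightarrow> ennreal" where
  "relative_type S \<psi> \<phi> = Sup {ennreal c | c. c \<ge> 0 \<and>
     (\<exists>U C. openin (top_of_set S) U \<and> 0 \<in> U \<and>
        (\<forall>x\<in>U - sing_locus S. \<psi> x \<le> ereal c * \<phi> x + ereal C))}"

end

theory Submission
  imports Defs "HOL-Library.Function_Algebras" "HOL-Complex_Analysis.Complex_Analysis"
begin

text \<open>
  Write \<open>S\<close> for the sum of the \<open>a j\<close> and \<open>\<Phi>\<close> for the sum of the \<open>\<bar>f j\<bar> powr (1 / a j)\<close>, so
  that \<open>\<phi> = log \<Phi>\<close>. Since \<open>\<bar>f j\<bar> \<le> \<Phi> powr (a j)\<close> and \<open>f 0\<close> is bounded near the origin,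
  \<open>\<bar>F\<bar> \<le> C \<Phi> powr S\<close> there, and the relative type is at least \<open>S\<close>. It equals \<open>S\<close> if and only if no
  \<open>c > S\<close> satisfies \<open>\<bar>F\<bar> \<le> C \<Phi> powr c\<close> near the origin.

  \<^bold>\<open>A valuation forces equality.\<close> Suppose that such a bound holds for some \<open>c > S\<close>. It holds at
  singular points as well, because regular points are dense. Choose natural numbers \<open>n\<close> and \<open>p j\<close>
  with \<open>p j \<le> n c / a j\<close> and \<open>p j a j > n S\<close>. Then \<open>\<bar>F ^ n\<bar>\<close> is at most a constant times the
  largest \<open>\<bar>f j ^ p j\<bar>\<close> near the origin, although the valuation of every \<open>f j ^ p j\<close> exceeds that
  of \<open>F ^ n\<close>. This is impossible: in the ring generated over the coordinate ring by the quotients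
  \<open>f j ^ p j / F ^ n\<close>, the elements of positive valuation form a proper ideal, which has a zero by
  the Nullstellensatz. All the quotients vanish at this zero, so it lies over a common zero of the
  \<open>f j\<close>, i.e. over the origin. Nearby points with \<open>F \<noteq> 0\<close> violate the bound
  (\<open>points_from_valuation_quotients\<close>, \<open>points_from_valuation\<close>).

  \<^bold>\<open>Equality yields a valuation.\<close> If no \<open>c > S\<close> works, there are points \<open>x\<close> arbitrarily close to the
  origin with \<open>\<bar>F\<bar> \<ge> \<Phi> powr (S + \<epsilon>)\<close>. With \<open>l = - ln \<Phi>(x)\<close>, the map that sends \<open>g\<close> to
  \<open>- ln \<bar>g(x)\<bar> / l\<close> is additive on products, ultrametric up to \<open>ln 2 / l\<close>, and nonnegative up to
  \<open>O(1) / l\<close>. At \<open>f j\<close> its value is at least \<open>a j\<close>, up to a small error for \<open>j = 0\<close>, while the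
  sum of these values is at most \<open>S + \<epsilon>\<close>. A limit of such maps is therefore a valuation with
  the values \<open>a j\<close>, provided that it is finite on nonzero elements (\<open>approximate_valuation\<close>,
  \<open>valuation_limit\<close>).

  \<^bold>\<open>General position.\<close> Finiteness is the main difficulty: the given points may lie on, or extremely
  close to, the zero set of some \<open>g\<close>. They are first moved by a distance of the order of a large
  power of \<open>\<Phi>\<close>, which hardly affects the \<open>f j\<close> but makes \<open>\<bar>g\<bar>\<close> at least a power of \<open>\<Phi>\<close> whose
  exponent depends on \<open>g\<close> only (\<open>move_to_general_position\<close>). For this the variety is projected to
  an affine space by Noether normalization. In affine space such a motion is a matter of polynomials
  on a line; it lifts to the variety because the projection is open with a Hoelder estimate
  (\<open>open_projection\<close>). The lift rests on minimal polynomials of elements of the coordinate ring,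
  whose coefficients are polynomials because polynomial rings are integrally closed
  (\<open>min_poly_exists\<close>).
\<close>

(* These names would otherwise denote polynomials over carrier-based rings. *)
hide_const (open) Polynomials.degree Polynomials.lead_coeff up_ring.coeff up_ring.monom module.smult

section \<open>Polynomial functions\<close>

text \<open>Polynomials are represented by the functions that they induce. Substitution is then composition,
  and polynomials in the variables \<open>{..<n}\<close> have the same type for all \<open>n\<close>, so that induction on
  the number of variables is possible.\<close>

inductive_set polyfun :: "'v set \<Rightarrow> (('v \<Rightarrow> complex) \<Rightarrow> complex) set" for V where
  const: "(\<lambda>_. c) \<in> polyfun V"
| var: "i \<in> V \<Longrightarrow> (\<lambda>x. x i) \<in> polyfun V"
| add: "p \<in> polyfun V \<Longrightarrow> q \<in> polyfun V \<Longrightarrow> p + q \<in> polyfun V"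
| mult: "p \<in> polyfun V \<Longrightarrow> q \<in> polyfun V \<Longrightarrow> p * q \<in> polyfun V"

lemma polyfun_0 [simp]: "0 \<in> polyfun V"
  using polyfun.const[of 0 V] by (simp add: zero_fun_def)

lemma polyfun_1 [simp]: "1 \<in> polyfun V"
  using polyfun.const[of 1 V] by (simp add: one_fun_def)

lemma polyfun_uminus: "p \<in> polyfun V \<Longrightarrow> - p \<in> polyfun V"
proof -
  assume "p \<in> polyfun V"
  then have "(\<lambda>_. -1) * p \<in> polyfun V" by (intro polyfun.mult polyfun.const)
  moreover have "(\<lambda>_. -1) * p = - p" by (auto simp: fun_eq_iff)
  ultimately show ?thesis by simp
qed

lemma polyfun_diff: "p \<in> polyfun V \<Longrightarrow> q \<in> polyfun V \<Longrightarrow> p - q \<in> polyfun V"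
  using polyfun.add[of p V "- q"] polyfun_uminus[of q V] by simp

lemma polyfun_sum: "(\<And>i. i \<in> S \<Longrightarrow> p i \<in> polyfun V) \<Longrightarrow> sum p S \<in> polyfun V"
  by (induction S rule: infinite_finite_induct) (auto intro: polyfun.add)

lemma polyfun_prod: "(\<And>i. i \<in> S \<Longrightarrow> p i \<in> polyfun V) \<Longrightarrow> prod p S \<in> polyfun V"
  by (induction S rule: infinite_finite_induct) (auto intro: polyfun.mult)

lemma polyfun_power: "p \<in> polyfun V \<Longrightarrow> p ^ k \<in> polyfun V"
  by (induction k) (auto intro: polyfun.mult)

lemma power_fun_apply [simp]: "(p ^ k) x = (p x ^ k :: 'b::comm_ring_1)"
  by (induction k) auto

lemma sum_fun_apply: "(sum p S) x = (\<Sum>i\<in>S. p i x :: 'b::comm_ring_1)"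
  by (induction S rule: infinite_finite_induct) auto

lemma prod_fun_apply: "(prod p S) x = (\<Prod>i\<in>S. p i x :: 'b::comm_ring_1)"
  by (induction S rule: infinite_finite_induct) auto

lemmas polyfun_intros = polyfun.intros polyfun_uminus polyfun_diff polyfun_sum polyfun_prod
  polyfun_power

lemma polyfun_compose:
  assumes "p \<in> polyfun V" "\<And>i. i \<in> V \<Longrightarrow> y i \<in> polyfun W"
  shows "(\<lambda>x. p (\<lambda>i. y i x)) \<in> polyfun W"
  using assms(1)
proof induction
  case (var i)
  then show ?case using assms(2)[of i] by simp
next
  case (add p q)
  have "(\<lambda>x. (p + q) (\<lambda>i. y i x)) = (\<lambda>x. p (\<lambda>i. y i x)) + (\<lambda>x. q (\<lambda>i. y i x))"
    by (auto simp: fun_eq_iff)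
  then show ?case using add by (auto intro: polyfun.add)
next
  case (mult p q)
  have "(\<lambda>x. (p * q) (\<lambda>i. y i x)) = (\<lambda>x. p (\<lambda>i. y i x)) * (\<lambda>x. q (\<lambda>i. y i x))"
    by (auto simp: fun_eq_iff)
  then show ?case using mult by (auto intro: polyfun.mult)
qed (auto intro: polyfun.const)

lemma polyfun_cong:
  assumes "p \<in> polyfun V" "\<And>i. i \<in> V \<Longrightarrow> x i = x' i"
  shows "p x = p x'"
  using assms(1) by induction (auto simp: assms(2))

lemma polyfun_mono: "V \<subseteq> W \<Longrightarrow> p \<in> polyfun V \<Longrightarrow> p \<in> polyfun W"
  using polyfun_compose[of p V "\<lambda>i x. x i" W] by (auto intro: polyfun.var)

lemma polyfun_bounded:
  assumes "p \<in> polyfun V"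
  shows "\<exists>C>0. \<forall>x. (\<forall>i\<in>V. cmod (x i) \<le> B) \<longrightarrow> cmod (p x) \<le> C"
  using assms
proof induction
  case (const c)
  then show ?case by (intro exI[of _ "cmod c + 1"]) (auto intro: add_nonneg_pos)
next
  case (var i)
  then show ?case by (intro exI[of _ "\<bar>B\<bar> + 1"]) fastforce
next
  case (add p q)
  then obtain C D where "C > 0" "D > 0"
    "\<And>x. (\<forall>i\<in>V. cmod (x i) \<le> B) \<Longrightarrow> cmod (p x) \<le> C"
    "\<And>x. (\<forall>i\<in>V. cmod (x i) \<le> B) \<Longrightarrow> cmod (q x) \<le> D" by blast
  then show ?case
    by (intro exI[of _ "C + D"]) (simp add: norm_triangle_le add_mono)
next
  case (mult p q)
  then obtain C D where "C > 0" "D > 0"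
    "\<And>x. (\<forall>i\<in>V. cmod (x i) \<le> B) \<Longrightarrow> cmod (p x) \<le> C"
    "\<And>x. (\<forall>i\<in>V. cmod (x i) \<le> B) \<Longrightarrow> cmod (q x) \<le> D" by blast
  then show ?case
    by (intro exI[of _ "C * D"]) (auto simp: norm_mult intro!: mult_mono)
qed

lemma polyfun_lipschitz:
  assumes "p \<in> polyfun V"
  shows "\<exists>L>0. \<forall>x x' e. e \<ge> 0 \<longrightarrow>
    (\<forall>i\<in>V. cmod (x i) \<le> B \<and> cmod (x' i) \<le> B \<and> cmod (x i - x' i) \<le> e) \<longrightarrow> cmod (p x - p x') \<le> L * e"
  using assms
proof induction
  case (const c)
  then show ?case by (intro exI[of _ 1]) auto
next
  case (var i)
  then show ?case by (intro exI[of _ 1]) auto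
next
  case (add p q)
  then obtain C D where CD: "C > 0" "D > 0"
    "\<And>x x' e. e \<ge> 0 \<Longrightarrow> (\<forall>i\<in>V. cmod (x i) \<le> B \<and> cmod (x' i) \<le> B \<and> cmod (x i - x' i) \<le> e) \<Longrightarrow> cmod (p x - p x') \<le> C * e"
    "\<And>x x' e. e \<ge> 0 \<Longrightarrow> (\<forall>i\<in>V. cmod (x i) \<le> B \<and> cmod (x' i) \<le> B \<and> cmod (x i - x' i) \<le> e) \<Longrightarrow> cmod (q x - q x') \<le> D * e"
    by blast
  have "cmod ((p + q) x - (p + q) x') \<le> (C + D) * e"
    if "e \<ge> 0" "\<forall>i\<in>V. cmod (x i) \<le> B \<and> cmod (x' i) \<le> B \<and> cmod (x i - x' i) \<le> e" for x x' e
    using norm_triangle_ineq[of "p x - p x'" "q x - q x'"] CD(3)[OF that] CD(4)[OF that]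
    by (simp add: algebra_simps)
  then show ?case using CD(1,2) by (intro exI[of _ "C + D"]) auto
next
  case (mult p q)
  then obtain C D where CD: "C > 0" "D > 0"
    "\<And>x x' e. e \<ge> 0 \<Longrightarrow> (\<forall>i\<in>V. cmod (x i) \<le> B \<and> cmod (x' i) \<le> B \<and> cmod (x i - x' i) \<le> e) \<Longrightarrow> cmod (p x - p x') \<le> C * e"
    "\<And>x x' e. e \<ge> 0 \<Longrightarrow> (\<forall>i\<in>V. cmod (x i) \<le> B \<and> cmod (x' i) \<le> B \<and> cmod (x i - x' i) \<le> e) \<Longrightarrow> cmod (q x - q x') \<le> D * e"
    by blast
  obtain P Q where PQ: "P > 0" "Q > 0"
    "\<And>x. (\<forall>i\<in>V. cmod (x i) \<le> B) \<Longrightarrow> cmod (p x) \<le> P"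
    "\<And>x. (\<forall>i\<in>V. cmod (x i) \<le> B) \<Longrightarrow> cmod (q x) \<le> Q"
    using polyfun_bounded[OF mult.hyps(1), of B] polyfun_bounded[OF mult.hyps(2), of B] by blast
  have "cmod ((p * q) x - (p * q) x') \<le> (P * D + Q * C) * e"
    if "e \<ge> 0" and *: "\<forall>i\<in>V. cmod (x i) \<le> B \<and> cmod (x' i) \<le> B \<and> cmod (x i - x' i) \<le> e" for x x' e
  proof -
    have "(p * q) x - (p * q) x' = p x * (q x - q x') + (p x - p x') * q x'"
      by (simp add: algebra_simps)
    also have "cmod \<dots> \<le> cmod (p x) * cmod (q x - q x') + cmod (p x - p x') * cmod (q x')"
      by (metis norm_mult norm_triangle_ineq)
    also have "\<dots> \<le> P * (D * e) + (C * e) * Q"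
      using CD PQ that CD(3)[OF that] CD(4)[OF that] by (intro add_mono mult_mono) auto
    finally show ?thesis by (simp add: algebra_simps)
  qed
  then show ?case using CD(1,2) PQ(1,2)
    by (intro exI[of _ "P * D + Q * C"]) (auto intro: add_pos_pos)
qed

lemma polyfun_line:
  assumes "p \<in> polyfun V"
  shows "\<exists>P. \<forall>s. p (\<lambda>i. a i + s * b i) = poly P s"
  using assms
proof induction
  case (const c)
  then show ?case by (intro exI[of _ "[:c:]"]) auto
next
  case (var i)
  then show ?case by (intro exI[of _ "[:a i, b i:]"]) auto
next
  case (add p q)
  then obtain P Q where "\<forall>s. p (\<lambda>i. a i + s * b i) = poly P s"
    "\<forall>s. q (\<lambda>i. a i + s * b i) = poly Q s" by blast
  then show ?case by (intro exI[of _ "P + Q"]) simp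
next
  case (mult p q)
  then obtain P Q where "\<forall>s. p (\<lambda>i. a i + s * b i) = poly P s"
    "\<forall>s. q (\<lambda>i. a i + s * b i) = poly Q s" by blast
  then show ?case by (intro exI[of _ "P * Q"]) simp
qed

text \<open>Join a point where the polynomials treated so far do not vanish to one where the next polynomial
  does not vanish. On this line all of them are nonzero polynomials in one variable.\<close>

lemma polyfun_common_nonzero:
  assumes "finite Q" "\<And>p. p \<in> Q \<Longrightarrow> p \<in> polyfun V \<and> p \<noteq> 0"
  shows "\<exists>v. \<forall>p\<in>Q. p v \<noteq> 0"
  using assms
proof (induction Q rule: finite_induct)
  case (insert p Q)
  obtain a where a: "\<forall>q\<in>Q. q a \<noteq> 0" using insert by blast
  obtain b where b: "p b \<noteq> 0" using insert.prems[of p] by (auto simp: fun_eq_iff)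
  define L where "L = (\<lambda>s. \<lambda>i. a i + s * (b i - a i))"
  have "\<exists>P. \<forall>s. q (L s) = poly P s" if "q \<in> insert p Q" for q
    unfolding L_def using polyfun_line[of q V a "\<lambda>i. b i - a i"] insert.prems[OF that] by auto
  then obtain P where P: "\<And>q s. q \<in> insert p Q \<Longrightarrow> q (L s) = poly (P q) s" by metis
  have L0: "L 0 = a" and L1: "L 1 = b" by (auto simp: L_def)
  have "P q \<noteq> 0" if "q \<in> insert p Q" for q
    using P[OF that, of 0] P[OF that, of 1] L0 L1 a b that by (cases "q = p") auto
  then have "(\<Prod>q\<in>insert p Q. P q) \<noteq> 0"
    using insert.hyps by (subst prod_zero_iff) auto
  then obtain s where "poly (\<Prod>q\<in>insert p Q. P q) s \<noteq> 0"
    using poly_all_0_iff_0 by blast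
  then have "\<forall>q\<in>insert p Q. q (L s) \<noteq> 0"
    using insert.hyps P by (auto simp: poly_prod)
  then show ?case by blast
qed auto

text \<open>The zero function is homogeneous of every degree, so that homogeneous parts can be added degree
  by degree.\<close>

inductive homog :: "'v set \<Rightarrow> nat \<Rightarrow> (('v \<Rightarrow> complex) \<Rightarrow> complex) \<Rightarrow> bool" for V where
  zero: "homog V k 0"
| const: "homog V 0 (\<lambda>_. c)"
| var: "i \<in> V \<Longrightarrow> homog V 1 (\<lambda>x. x i)"
| add: "homog V k p \<Longrightarrow> homog V k q \<Longrightarrow> homog V k (p + q)"
| mult: "homog V k p \<Longrightarrow> homog V l q \<Longrightarrow> homog V (k + l) (p * q)"

lemma homog_sum: "(\<And>i. i \<in> S \<Longrightarrow> homog V k (p i)) \<Longrightarrow> homog V k (sum p S)"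
  by (induction S rule: infinite_finite_induct) (auto intro: homog.intros)

lemma homog_polyfun: "homog V k h \<Longrightarrow> h \<in> polyfun V"
  by (induction rule: homog.induct) (assumption | rule polyfun_0 polyfun.intros)+

lemma coeff_mult_degree_le:
  fixes P Q :: "complex poly"
  assumes "degree P \<le> k" "degree Q \<le> l"
  shows "coeff (P * Q) (k + l) = coeff P k * coeff Q l"
proof -
  have "coeff (P * Q) (k + l) = (\<Sum>i\<le>k + l. coeff P i * coeff Q (k + l - i))"
    by (simp add: coeff_mult)
  also have "\<dots> = (\<Sum>i\<in>{k}. coeff P i * coeff Q (k + l - i))"
  proof (rule sum.mono_neutral_right)
    show "\<forall>i\<in>{..k + l} - {k}. coeff P i * coeff Q (k + l - i) = 0"
    proof
      fix i assume "i \<in> {..k + l} - {k}"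
      then consider "i > k" | "k + l - i > l" by fastforce
      then show "coeff P i * coeff Q (k + l - i) = 0"
        using assms by cases (auto simp: coeff_eq_0)
    qed
  qed auto
  finally show ?thesis by simp
qed

lemma homog_line:
  "homog V k h \<Longrightarrow>
    \<exists>P. (\<forall>s. h (\<lambda>i. a i + s * v i) = poly P s) \<and> degree P \<le> k \<and> coeff P k = h v"
proof (induction rule: homog.induct)
  case (zero k)
  then show ?case by (intro exI[of _ 0]) auto
next
  case (const c)
  then show ?case by (intro exI[of _ "[:c:]"]) auto
next
  case (var i)
  then show ?case by (intro exI[of _ "[:a i, v i:]"]) auto
next
  case (add k p q)
  then obtain P Q where "\<forall>s. p (\<lambda>i. a i + s * v i) = poly P s" "degree P \<le> k" "coeff P k = p v"
    "\<forall>s. q (\<lambda>i. a i + s * v i) = poly Q s" "degree Q \<le> k" "coeff Q k = q v" by blast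
  then show ?case by (intro exI[of _ "P + Q"]) (auto intro: degree_add_le)
next
  case (mult k p l q)
  then obtain P Q where "\<forall>s. p (\<lambda>i. a i + s * v i) = poly P s" "degree P \<le> k" "coeff P k = p v"
    "\<forall>s. q (\<lambda>i. a i + s * v i) = poly Q s" "degree Q \<le> l" "coeff Q l = q v" by blast
  then show ?case
    by (intro exI[of _ "P * Q"])
      (simp add: coeff_mult_degree_le order.trans[OF degree_mult_le add_mono])
qed

lemma polyfun_homog_decomp:
  assumes "p \<in> polyfun V"
  shows "\<exists>D h. (\<forall>k. homog V k (h k)) \<and> (\<forall>k>D. h k = 0) \<and> p = (\<Sum>k\<le>D. h k)"
  using assms
proof induction
  case (const c)
  define h :: "nat \<Rightarrow> ('a \<Rightarrow> complex) \<Rightarrow> complex" where "h = (\<lambda>k. if k = 0 then (\<lambda>_. c) else 0)"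
  have "homog V k (h k)" for k
    unfolding h_def using homog.const[of V c] homog.zero[of V k] by simp
  moreover have "h k = 0" if "k > 0" for k using that by (simp add: h_def)
  moreover have "(\<lambda>_. c) = (\<Sum>k\<le>0. h k)" by (simp add: h_def fun_eq_iff)
  ultimately show ?case by blast
next
  case (var i)
  define h :: "nat \<Rightarrow> ('a \<Rightarrow> complex) \<Rightarrow> complex" where "h = (\<lambda>k. if k = 1 then (\<lambda>x. x i) else 0)"
  have "homog V k (h k)" for k
    unfolding h_def using homog.var[OF var] homog.zero[of V k] by simp
  moreover have "h k = 0" if "k > 1" for k using that by (simp add: h_def)
  moreover have "(\<lambda>x. x i) = (\<Sum>k\<le>1. h k)" by (simp add: h_def fun_eq_iff)
  ultimately show ?case by blast
next
  case (add p q)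
  then obtain D h E g where *: "\<forall>k. homog V k (h k)" "\<forall>k>D. h k = 0" "p = (\<Sum>k\<le>D. h k)"
    "\<forall>k. homog V k (g k)" "\<forall>k>E. g k = 0" "q = (\<Sum>k\<le>E. g k)" by blast
  have "p = (\<Sum>k\<le>max D E. h k)" unfolding *(3) using *(2) by (intro sum.mono_neutral_left) auto
  moreover have "q = (\<Sum>k\<le>max D E. g k)" unfolding *(6) using *(5) by (intro sum.mono_neutral_left) auto
  ultimately have "p + q = (\<Sum>k\<le>max D E. (h + g) k)" by (simp add: sum.distrib)
  moreover have "homog V k ((h + g) k)" for k
    using homog.add[of V k "h k" "g k"] * by simp
  moreover have "\<forall>k>max D E. (h + g) k = 0" using * by simp
  ultimately show ?case by blast
next
  case (mult p q)
  then obtain D h E g where *: "\<forall>k. homog V k (h k)" "\<forall>k>D. h k = 0" "p = (\<Sum>k\<le>D. h k)"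
    "\<forall>k. homog V k (g k)" "\<forall>k>E. g k = 0" "q = (\<Sum>k\<le>E. g k)" by blast
  define f where "f = (\<lambda>n. \<Sum>(i,j)\<in>{(i,j). i \<le> D \<and> j \<le> E \<and> i + j = n}. h i * g j)"
  have fin: "finite {(i,j). i \<le> D \<and> j \<le> E \<and> i + j = n}" for n
    by (rule finite_subset[of _ "{..D} \<times> {..E}"]) auto
  have "p * q = (\<Sum>(i,j)\<in>{..D} \<times> {..E}. h i * g j)"
    unfolding * by (simp add: sum_product sum.cartesian_product)
  also have "\<dots> = (\<Sum>n\<le>D+E. \<Sum>(i,j)\<in>{x \<in> {..D} \<times> {..E}. fst x + snd x = n}. h i * g j)"
    by (rule sum.group[symmetric]) auto
  also have "\<dots> = (\<Sum>n\<le>D+E. f n)"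
    unfolding f_def by (intro sum.cong refl) (auto intro!: sum.cong)
  finally have "p * q = (\<Sum>n\<le>D+E. f n)" .
  moreover have "homog V n (f n)" for n
    unfolding f_def using * by (intro homog_sum) (auto intro: homog.mult)
  moreover have "f n = 0" if "n > D + E" for n
  proof -
    have "{(i,j). i \<le> D \<and> j \<le> E \<and> i + j = n} = {}" using that by auto
    then show ?thesis by (simp only: f_def sum.empty)
  qed
  ultimately show ?case by blast
qed

text \<open>The coefficient of the highest power of \<open>s\<close> in \<open>p (a + s v)\<close> is the top homogeneous part \<open>h\<close> at \<open>v\<close>
  and does not depend on \<open>a\<close>. This makes \<open>p\<close> monic after a change of coordinates, and bounds it from
  below uniformly on parallel lines.\<close>

lemma polyfun_top_form:
  assumes "p \<in> polyfun V" "p \<noteq> 0"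
  shows "\<exists>D h. h \<in> polyfun V \<and> h \<noteq> 0 \<and> (\<forall>s v. h (\<lambda>i. s * v i) = s ^ D * h v) \<and>
    (\<forall>a v. \<exists>P. (\<forall>s. p (\<lambda>i. a i + s * v i) = poly P s) \<and> degree P \<le> D \<and> coeff P D = h v)"
proof -
  obtain D0 h where h: "\<And>k. homog V k (h k)" "\<And>k. k > D0 \<Longrightarrow> h k = 0" "p = (\<Sum>k\<le>D0. h k)"
    using polyfun_homog_decomp[OF assms(1)] by blast
  have "\<exists>k\<le>D0. h k \<noteq> 0" using assms(2) h(3) by (metis atMost_iff sum.neutral)
  then have ne: "{k. k \<le> D0 \<and> h k \<noteq> 0} \<noteq> {}" by blast
  define D where "D = Max {k. k \<le> D0 \<and> h k \<noteq> 0}"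
  have fin: "finite {k. k \<le> D0 \<and> h k \<noteq> 0}" by auto
  have D: "D \<le> D0" "h D \<noteq> 0" using Max_in[OF fin ne] unfolding D_def by auto
  have Dmax: "h k = 0" if "k > D" for k
    using Max_ge[OF fin, of k] that h(2)[of k] unfolding D_def by fastforce
  have p: "p = (\<Sum>k\<le>D. h k)" unfolding h(3) using D Dmax by (intro sum.mono_neutral_right) auto
  have hom: "homog V k g \<Longrightarrow> g (\<lambda>i. s * v i) = s ^ k * g v" for k g s v
    by (induction rule: homog.induct) (auto simp: algebra_simps power_add)
  have "\<exists>P. (\<forall>s. p (\<lambda>i. a i + s * v i) = poly P s) \<and> degree P \<le> D \<and> coeff P D = h D v" for a v
  proof -
    have "\<forall>k. \<exists>P. (\<forall>s. h k (\<lambda>i. a i + s * v i) = poly P s) \<and> degree P \<le> k \<and> coeff P k = h k v"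
      using homog_line[OF h(1)] by blast
    then obtain P where P: "\<And>k s. h k (\<lambda>i. a i + s * v i) = poly (P k) s" "\<And>k. degree (P k) \<le> k"
      "\<And>k. coeff (P k) k = h k v" by metis
    have "coeff (\<Sum>k\<le>D. P k) D = (\<Sum>k\<le>D. coeff (P k) D)" by (simp add: coeff_sum)
    also have "\<dots> = (\<Sum>k\<in>{D}. coeff (P k) D)"
    proof (intro sum.mono_neutral_right ballI)
      fix k assume "k \<in> {..D} - {D}"
      then show "poly.coeff (P k) D = 0" using P(2)[of k] by (intro coeff_eq_0) auto
    qed auto
    finally have "coeff (\<Sum>k\<le>D. P k) D = h D v" using P(3) by simp
    moreover have "degree (\<Sum>k\<le>D. P k) \<le> D"
    proof (intro degree_sum_le)
      fix k assume "k \<in> {..D}"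
      then show "degree (P k) \<le> D" using P(2)[of k] by simp
    qed simp
    moreover have "p (\<lambda>i. a i + s * v i) = poly (\<Sum>k\<le>D. P k) s" for s
      unfolding p using P(1) by (simp add: sum_fun_apply poly_sum)
    ultimately show ?thesis by blast
  qed
  then show ?thesis using D(2) homog_polyfun[OF h(1)[of D]] hom[OF h(1)[of D]] by blast
qed

section \<open>Polynomials in one variable over polynomial functions\<close>

text \<open>The coefficients are functions, so the argument \<open>\<tau>\<close> is inserted as a constant function, and the
  result is evaluated at \<open>\<eta>\<close>.\<close>

definition pev :: "(('v \<Rightarrow> complex) \<Rightarrow> complex) poly \<Rightarrow> ('v \<Rightarrow> complex) \<Rightarrow> complex \<Rightarrow> complex" where
  "pev P \<eta> \<tau> = poly P (\<lambda>_. \<tau>) \<eta>"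

lemma pev_simps [simp]:
  "pev 0 \<eta> \<tau> = 0" "pev 1 \<eta> \<tau> = 1" "pev (P + Q) \<eta> \<tau> = pev P \<eta> \<tau> + pev Q \<eta> \<tau>"
  "pev (P - Q) \<eta> \<tau> = pev P \<eta> \<tau> - pev Q \<eta> \<tau>" "pev (- P) \<eta> \<tau> = - pev P \<eta> \<tau>"
  "pev (P * Q) \<eta> \<tau> = pev P \<eta> \<tau> * pev Q \<eta> \<tau>" "pev (smult b P) \<eta> \<tau> = b \<eta> * pev P \<eta> \<tau>"
  "pev (Polynomial.monom b k) \<eta> \<tau> = b \<eta> * \<tau> ^ k" "pev (pCons b P) \<eta> \<tau> = b \<eta> + \<tau> * pev P \<eta> \<tau>"
  by (auto simp: pev_def poly_monom)

definition polyfun_poly :: "'v set \<Rightarrow> (('v \<Rightarrow> complex) \<Rightarrow> complex) poly set" where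
  "polyfun_poly V = {P. \<forall>i. poly.coeff P i \<in> polyfun V}"

lemma polyfun_polyI: "(\<And>i. poly.coeff P i \<in> polyfun V) \<Longrightarrow> P \<in> polyfun_poly V"
  and polyfun_polyD: "P \<in> polyfun_poly V \<Longrightarrow> poly.coeff P i \<in> polyfun V"
  by (auto simp: polyfun_poly_def)

lemma polyfun_poly_intros:
  "0 \<in> polyfun_poly V" "1 \<in> polyfun_poly V"
  "P \<in> polyfun_poly V \<Longrightarrow> Q \<in> polyfun_poly V \<Longrightarrow> P + Q \<in> polyfun_poly V"
  "P \<in> polyfun_poly V \<Longrightarrow> Q \<in> polyfun_poly V \<Longrightarrow> P - Q \<in> polyfun_poly V"
  "P \<in> polyfun_poly V \<Longrightarrow> Q \<in> polyfun_poly V \<Longrightarrow> P * Q \<in> polyfun_poly V"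
  "P \<in> polyfun_poly V \<Longrightarrow> - P \<in> polyfun_poly V"
  "b \<in> polyfun V \<Longrightarrow> P \<in> polyfun_poly V \<Longrightarrow> smult b P \<in> polyfun_poly V"
  "b \<in> polyfun V \<Longrightarrow> Polynomial.monom b k \<in> polyfun_poly V"
  by (auto simp: polyfun_poly_def coeff_mult coeff_1 intro!: polyfun_intros)

lemma pev_altdef: "pev P \<eta> \<tau> = (\<Sum>i\<le>degree P. poly.coeff P i \<eta> * \<tau> ^ i)"
  unfolding pev_def by (simp add: poly_altdef sum_fun_apply)

lemma pev_polyfun:
  assumes "P \<in> polyfun_poly V" "\<And>i. i \<in> V \<Longrightarrow> y i \<in> polyfun W" "g \<in> polyfun W"
  shows "(\<lambda>x. pev P (\<lambda>i. y i x) (g x)) \<in> polyfun W"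
proof -
  have "(\<lambda>x. pev P (\<lambda>i. y i x) (g x))
      = (\<Sum>k\<le>degree P. (\<lambda>x. poly.coeff P k (\<lambda>i. y i x)) * g ^ k)"
    by (auto simp: fun_eq_iff pev_altdef sum_fun_apply)
  also have "\<dots> \<in> polyfun W"
  proof (rule polyfun_sum)
    fix k
    have "(\<lambda>x. poly.coeff P k (\<lambda>i. y i x)) \<in> polyfun W"
      by (rule polyfun_compose[OF polyfun_polyD[OF assms(1)] assms(2)])
    then show "(\<lambda>x. poly.coeff P k (\<lambda>i. y i x)) * g ^ k \<in> polyfun W"
      by (rule polyfun.mult[OF _ polyfun_power[OF assms(3)]])
  qed
  finally show ?thesis .
qed

definition slice :: "(('v \<Rightarrow> complex) \<Rightarrow> complex) poly \<Rightarrow> ('v \<Rightarrow> complex) \<Rightarrow> complex poly" where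
  "slice P \<eta> = map_poly (\<lambda>c. c \<eta>) P"

lemma coeff_slice [simp]: "poly.coeff (slice P \<eta>) i = poly.coeff P i \<eta>"
  by (simp add: slice_def coeff_map_poly)

lemma degree_slice_le: "degree (slice P \<eta>) \<le> degree P"
  by (rule degree_le) (auto simp: coeff_eq_0)

lemma poly_slice [simp]: "poly (slice P \<eta>) \<tau> = pev P \<eta> \<tau>"
proof -
  have "poly (slice P \<eta>) \<tau> = (\<Sum>i\<le>degree P. poly.coeff (slice P \<eta>) i * \<tau> ^ i)"
    by (subst poly_altdef, rule sum.mono_neutral_left)
       (use degree_slice_le[of P \<eta>] in \<open>auto simp: coeff_eq_0 simp del: coeff_slice\<close>)
  then show ?thesis by (simp add: pev_altdef)
qed

lemma slice_mult: "slice (P * Q) \<eta> = slice P \<eta> * slice Q \<eta>"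
  by (subst poly_eq_poly_eq_iff[symmetric]) (auto simp: fun_eq_iff)

lemma polyfun_Suc_poly:
  assumes "p \<in> polyfun {..<Suc n}"
  shows "\<exists>P\<in>polyfun_poly {..<n}. \<forall>x. p x = pev P x (x n)"
  using assms
proof induction
  case (const c)
  show ?case by (intro bexI[of _ "Polynomial.monom (\<lambda>_. c) 0"]) (auto intro!: polyfun_poly_intros polyfun_intros)
next
  case (var i)
  show ?case
  proof (cases "i = n")
    case True
    then show ?thesis by (intro bexI[of _ "Polynomial.monom 1 1"]) (auto intro!: polyfun_poly_intros)
  next
    case False
    then show ?thesis using var
      by (intro bexI[of _ "Polynomial.monom (\<lambda>x. x i) 0"]) (auto intro!: polyfun_poly_intros polyfun.var)
  qed
next
  case (add p q)
  then obtain P Q where "P\<in>polyfun_poly {..<n}" "\<forall>x. p x = pev P x (x n)"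
    "Q\<in>polyfun_poly {..<n}" "\<forall>x. q x = pev Q x (x n)" by blast
  then show ?case by (intro bexI[of _ "P + Q"]) (auto intro: polyfun_poly_intros)
next
  case (mult p q)
  then obtain P Q where "P\<in>polyfun_poly {..<n}" "\<forall>x. p x = pev P x (x n)"
    "Q\<in>polyfun_poly {..<n}" "\<forall>x. q x = pev Q x (x n)" by blast
  then show ?case by (intro bexI[of _ "P * Q"]) (auto intro: polyfun_poly_intros)
qed

text \<open>The coefficients do not form a field: instead of dividing by the leading coefficient of \<open>q\<close>, one
  multiplies the dividend by it.\<close>

lemma pseudo_division:
  assumes "q \<in> polyfun_poly V" "q \<noteq> 0" "P \<in> polyfun_poly V"
  shows "\<exists>k s r. s \<in> polyfun_poly V \<and> r \<in> polyfun_poly V \<and>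
    smult (lead_coeff q ^ k) P = q * s + r \<and> (r = 0 \<or> degree r < degree q)"
  using assms(3)
proof (induction "degree P" arbitrary: P rule: less_induct)
  case (less P)
  let ?b = "lead_coeff q"
  have b: "?b \<in> polyfun V" using assms(1) by (simp add: polyfun_polyD)
  show ?case
  proof (cases "P = 0 \<or> degree P < degree q")
    case True
    then show ?thesis using less.prems
      by (intro exI[of _ 0] exI[of _ P]) (auto intro: polyfun_poly_intros)
  next
    case False
    define t where "t = Polynomial.monom (lead_coeff P) (degree P - degree q)"
    define P' where "P' = smult ?b P - q * t"
    have t: "t \<in> polyfun_poly V" unfolding t_def using less.prems
      by (intro polyfun_poly_intros) (simp add: polyfun_polyD)
    have P': "P' \<in> polyfun_poly V" unfolding P'_def using t b less.prems assms
      by (intro polyfun_poly_intros)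
    have qt: "poly.coeff (q * t) i = lead_coeff P * poly.coeff q (i - (degree P - degree q))"
      if "i \<ge> degree P" for i
      using that by (subst mult.commute) (simp add: t_def coeff_monom_mult)
    have co: "poly.coeff P' i = 0" if "i \<ge> degree P" for i
    proof (cases "i = degree P")
      case True
      then have "i - (degree P - degree q) = degree q" using False by simp
      then show ?thesis using qt[OF that] True unfolding P'_def
        by (simp add: mult.commute)
    next
      case False2: False
      then have "i - (degree P - degree q) > degree q" "i > degree P" using that False by linarith+
      then show ?thesis using qt[OF that] unfolding P'_def by (simp add: coeff_eq_0)
    qed
    show ?thesis
    proof (cases "P' = 0 \<or> degree P' < degree P")
      case True
      have "\<exists>k s r. s \<in> polyfun_poly V \<and> r \<in> polyfun_poly V \<and>
        smult (?b ^ k) P' = q * s + r \<and> (r = 0 \<or> degree r < degree q)"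
      proof (cases "P' = 0")
        case True
        then show ?thesis by (intro exI[of _ 0]) (auto intro: polyfun_poly_intros)
      next
        case False
        then show ?thesis using less.hyps[of P'] True P' by blast
      qed
      then obtain k s r where ksr: "s \<in> polyfun_poly V" "r \<in> polyfun_poly V"
        "smult (?b ^ k) P' = q * s + r" "r = 0 \<or> degree r < degree q" by blast
      have "smult (?b ^ Suc k) P = smult (?b ^ k) (P' + q * t)"
        by (simp add: P'_def mult.commute)
      also have "\<dots> = q * (s + smult (?b ^ k) t) + r"
        using ksr(3) by (simp add: smult_add_right algebra_simps)
      finally show ?thesis using ksr t b
        by (intro exI[of _ "Suc k"] exI[of _ "s + smult (?b ^ k) t"] exI[of _ r])
           (auto intro!: polyfun_poly_intros polyfun_power)
    next
      case F: False
      then show ?thesis using co[of "degree P'"] by (auto simp: not_less)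
    qed
  qed
qed

lemma monic_division:
  assumes "q \<in> polyfun_poly V" "lead_coeff q = 1" "P \<in> polyfun_poly V"
  shows "\<exists>s r. s \<in> polyfun_poly V \<and> r \<in> polyfun_poly V \<and>
    P = q * s + r \<and> (r = 0 \<or> degree r < degree q)"
proof -
  have "q \<noteq> 0" using assms(2) by force
  from pseudo_division[OF assms(1) this assms(3)] show ?thesis using assms(2) by simp
qed

section \<open>Integral closedness of polynomial rings\<close>

lemma pev_cong:
  assumes "P \<in> polyfun_poly V" "\<And>i. i \<in> V \<Longrightarrow> \<eta> i = \<eta>' i"
  shows "pev P \<eta> \<tau> = pev P \<eta>' \<tau>"
proof -
  have "poly.coeff P i \<eta> = poly.coeff P i \<eta>'" for i
    by (rule polyfun_cong[OF polyfun_polyD[OF assms(1)] assms(2)])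
  then show ?thesis by (simp add: pev_altdef)
qed

text \<open>If \<open>v n = 1\<close>, then changing the last coordinate of \<open>x\<close> moves \<open>shear n v x\<close> in the direction \<open>v\<close>.\<close>

definition shear :: "nat \<Rightarrow> (nat \<Rightarrow> complex) \<Rightarrow> (nat \<Rightarrow> complex) \<Rightarrow> nat \<Rightarrow> complex" where
  "shear n v x = (\<lambda>i. if i < n then x i + v i * x n else x i)"

lemma shear_polyfun: "i < Suc n \<Longrightarrow> (\<lambda>x. shear n v x i) \<in> polyfun {..<Suc n}"
proof -
  assume "i < Suc n"
  have "(\<lambda>x. x i + v i * x n) = (\<lambda>x. x i) + (\<lambda>_. v i) * (\<lambda>x. x n)"
    by (auto simp: fun_eq_iff)
  also have "\<dots> \<in> polyfun {..<Suc n}" using \<open>i < Suc n\<close>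
    by (intro polyfun.intros) auto
  finally show ?thesis using polyfun.var[of i "{..<Suc n}"] \<open>i < Suc n\<close>
    by (cases "i < n") (auto simp: shear_def)
qed

lemma shear_inverse: "shear n v (shear n (- v) x) = x"
  by (auto simp: shear_def fun_eq_iff)

lemma polyfun_shear:
  assumes "p \<in> polyfun {..<Suc n}"
  shows "(\<lambda>x. p (shear n v x)) \<in> polyfun {..<Suc n}"
  using polyfun_compose[OF assms, of "\<lambda>i x. shear n v x i"] shear_polyfun by simp

text \<open>In a direction \<open>v\<close> where the top form of \<open>p\<close> does not vanish, the leading coefficient of \<open>p\<close> is the
  constant \<open>\<alpha>\<close>. The shear makes this direction the last coordinate axis.\<close>

lemma monic_after_shear:
  assumes "p \<in> polyfun {..<Suc n}" "p \<noteq> 0"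
  shows "\<exists>v \<alpha> P. \<alpha> \<noteq> 0 \<and> P \<in> polyfun_poly {..<n} \<and> lead_coeff P = 1 \<and>
    (\<forall>x. p (shear n v x) = \<alpha> * pev P x (x n))"
proof -
  obtain D h where h: "h \<in> polyfun {..<Suc n}" "h \<noteq> 0" "\<And>s v. h (\<lambda>i. s * v i) = s ^ D * h v"
    "\<And>a v. \<exists>P. (\<forall>s. p (\<lambda>i. a i + s * v i) = poly P s) \<and> degree P \<le> D \<and> poly.coeff P D = h v"
    using polyfun_top_form[OF assms] by blast
  have "(\<lambda>x::nat \<Rightarrow> complex. x n) \<noteq> 0" by (auto simp: fun_eq_iff)
  then obtain u where u: "h u \<noteq> 0" "u n \<noteq> 0"
  proof -
    have "\<exists>v. \<forall>p\<in>{h, \<lambda>x. x n}. p v \<noteq> 0"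
    proof (rule polyfun_common_nonzero[of _ "{..<Suc n}"])
      fix p assume "p \<in> {h, \<lambda>x. x n}"
      then consider "p = h" | "p = (\<lambda>x. x n)" by blast
      then show "p \<in> polyfun {..<Suc n} \<and> p \<noteq> 0"
      proof cases
        case 2
        then show ?thesis using \<open>(\<lambda>x. x n) \<noteq> 0\<close> polyfun.var[of n "{..<Suc n}"] by simp
      qed (use h(1,2) in auto)
    qed simp
    then obtain w where "h w \<noteq> 0" "w n \<noteq> 0" by auto
    then show ?thesis by (rule that)
  qed
  define v where "v = (\<lambda>i. (1 / u n) * u i)"
  have vn: "v n = 1" using u by (simp add: v_def)
  define \<alpha> where "\<alpha> = h v"
  have \<alpha>: "\<alpha> \<noteq> 0" using h(3)[of "1 / u n" u] u by (simp add: \<alpha>_def v_def)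
  obtain P0 where P0: "P0 \<in> polyfun_poly {..<n}" "\<And>x. p (shear n v x) = pev P0 x (x n)"
    using polyfun_Suc_poly[OF polyfun_shear[OF assms(1)]] by blast
  have coeffs: "poly.coeff P0 i \<eta> = (if i = D then \<alpha> else 0)" if "i \<ge> D" for i \<eta>
  proof -
    obtain Q where Q: "\<And>s. p (\<lambda>i. (\<eta>(n := 0)) i + s * v i) = poly Q s" "degree Q \<le> D"
      "poly.coeff Q D = \<alpha>" using h(4)[of "\<eta>(n := 0)" v] unfolding \<alpha>_def by blast
    have "poly (slice P0 \<eta>) s = poly Q s" for s
    proof -
      have "poly (slice P0 \<eta>) s = pev P0 (\<eta>(n := s)) s"
        using pev_cong[OF P0(1), of \<eta> "\<eta>(n := s)"] by simp
      also have "\<dots> = p (shear n v (\<eta>(n := s)))" using P0(2)[of "\<eta>(n := s)"] by simp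
      also have "\<dots> = p (\<lambda>i. (\<eta>(n := 0)) i + s * v i)"
        by (rule polyfun_cong[OF assms(1)]) (use vn in \<open>auto simp: shear_def less_Suc_eq\<close>)
      finally show ?thesis using Q(1) by simp
    qed
    then have "slice P0 \<eta> = Q" by (subst poly_eq_poly_eq_iff[symmetric]) auto
    then have "poly.coeff P0 i \<eta> = poly.coeff Q i" by (metis coeff_slice)
    then show ?thesis using Q(2,3) that by (auto simp: coeff_eq_0)
  qed
  define P where "P = smult (\<lambda>_. 1 / \<alpha>) P0"
  have cP: "poly.coeff P i = (if i = D then 1 else 0)" if "i \<ge> D" for i
    using coeffs[OF that] \<alpha> by (auto simp: P_def fun_eq_iff)
  have cD: "poly.coeff P D = 1" using cP[of D] by simp
  then have "degree P = D" using cP by (intro antisym degree_le le_degree) simp_all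
  moreover note cD
  moreover have "P \<in> polyfun_poly {..<n}"
    unfolding P_def by (intro polyfun_poly_intros P0 polyfun.const)
  moreover have "p (shear n v x) = \<alpha> * pev P x (x n)" for x
    using P0(2)[of x] \<alpha> by (simp add: P_def)
  ultimately show ?thesis using \<alpha> by (intro exI[of _ v] exI[of _ \<alpha>] exI[of _ P]) auto
qed

text \<open>The bound extends by continuity to the roots of \<open>B\<close>, which are therefore roots of \<open>R\<close>. A common
  linear factor can be cancelled without affecting the bound.\<close>

lemma poly_dvd_of_bounded_quotient:
  fixes B R :: "complex poly"
  assumes "B \<noteq> 0" "\<And>\<rho>. \<exists>C. \<forall>t. cmod t \<le> \<rho> \<longrightarrow> poly B t \<noteq> 0 \<longrightarrow> cmod (poly R t) \<le> C * cmod (poly B t)"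
  shows "B dvd R"
proof -
  have lim: "cmod (poly S t0) \<le> C * cmod (poly T t0)"
    if "eventually (\<lambda>t. cmod (poly S t) \<le> C * cmod (poly T t)) (at t0)" for S T :: "complex poly" and C t0
  proof (rule tendsto_le[OF _ _ _ that])
    show "((\<lambda>t. C * cmod (poly T t)) \<longlongrightarrow> C * cmod (poly T t0)) (at t0)"
      by (intro tendsto_intros)
    show "((\<lambda>t. cmod (poly S t)) \<longlongrightarrow> cmod (poly S t0)) (at t0)"
      by (intro tendsto_intros)
  qed auto
  have "\<exists>C. \<forall>t. cmod t \<le> \<rho> \<longrightarrow> cmod (poly R t) \<le> C * cmod (poly B t)" for \<rho>
  proof -
    obtain C where C: "\<And>t. cmod t \<le> \<rho> + 1 \<Longrightarrow> poly B t \<noteq> 0 \<Longrightarrow> cmod (poly R t) \<le> C * cmod (poly B t)"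
      using assms(2)[of "\<rho> + 1"] by blast
    have "cmod (poly R t) \<le> C * cmod (poly B t)" if t: "cmod t \<le> \<rho>" for t
    proof (rule lim)
      have "eventually (\<lambda>s. s \<notin> {z. poly B z = 0}) (at t)"
      proof -
        have "finite ({z. poly B z = 0} - {t})" using poly_roots_finite[OF assms(1)] by simp
        from eventually_at_in_open[OF open_Compl[OF finite_imp_closed[OF this]], of t]
        have "eventually (\<lambda>s. s \<in> - ({z. poly B z = 0} - {t}) - {t}) (at t)" by simp
        then show ?thesis by (rule eventually_mono) auto
      qed
      moreover have "eventually (\<lambda>s. dist s t < 1) (at t)"
        by (auto simp: eventually_at intro: exI[of _ 1])
      ultimately show "eventually (\<lambda>t. cmod (poly R t) \<le> C * cmod (poly B t)) (at t)"
      proof eventually_elim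
        case (elim s)
        have "cmod s \<le> cmod t + cmod (s - t)" by (metis add_diff_cancel_left' add.commute diff_add_cancel norm_triangle_ineq)
        then show ?case using elim t by (intro C) (auto simp: dist_norm)
      qed
    qed
    then show ?thesis by blast
  qed
  then show ?thesis using assms(1)
  proof (induction "degree B" arbitrary: B R)
    case 0
    then obtain b where "B = [:b:]" "b \<noteq> 0" by (metis degree_eq_zeroE pCons_0_0)
    then show ?case by (simp add: is_unit_triv unit_imp_dvd)
  next
    case (Suc m)
    then obtain t0 where t0: "poly B t0 = 0"
      using Fundamental_Theorem_Algebra.fundamental_theorem_of_algebra[of B] constant_degree[of B] by auto
    obtain B' where B': "B = [:- t0, 1:] * B'" using t0 by (auto simp: poly_eq_0_iff_dvd)
    have "poly R t0 = 0" using Suc.prems(1)[of "cmod t0"] t0 by auto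
    then obtain R' where R': "R = [:- t0, 1:] * R'" by (auto simp: poly_eq_0_iff_dvd)
    have B'0: "B' \<noteq> 0" using Suc.prems B' by auto
    have "degree B = Suc (degree B')" unfolding B' using B'0 by (subst degree_mult_eq) auto
    then have "m = degree B'" using Suc.hyps(2) by simp
    moreover have "\<exists>C. \<forall>t. cmod t \<le> \<rho> \<longrightarrow> cmod (poly R' t) \<le> C * cmod (poly B' t)" for \<rho>
    proof -
      obtain C where C: "\<And>t. cmod t \<le> \<rho> + 1 \<Longrightarrow> cmod (poly R t) \<le> C * cmod (poly B t)"
        using Suc.prems(1)[of "\<rho> + 1"] by blast
      have ne: "cmod (poly R' t) \<le> C * cmod (poly B' t)" if "cmod t \<le> \<rho> + 1" "t \<noteq> t0" for t
      proof -
        have "poly R t = (t - t0) * poly R' t" "poly B t = (t - t0) * poly B' t"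
          by (simp_all add: B' R' algebra_simps)
        then have "cmod (t - t0) * cmod (poly R' t) \<le> cmod (t - t0) * (C * cmod (poly B' t))"
          using C[OF that(1)] by (simp add: norm_mult mult.left_commute)
        then show ?thesis using that(2) by simp
      qed
      have "cmod (poly R' t) \<le> C * cmod (poly B' t)" if "cmod t \<le> \<rho>" for t
      proof (cases "t = t0")
        case True
        show ?thesis unfolding True
        proof (rule lim)
          show "eventually (\<lambda>t. cmod (poly R' t) \<le> C * cmod (poly B' t)) (at t0)"
            unfolding eventually_at
          proof (intro exI[of _ 1] conjI ballI impI)
            fix s assume s: "s \<noteq> t0 \<and> dist s t0 < 1"
            have "cmod s \<le> cmod t0 + cmod (s - t0)" by (metis add_diff_cancel_left' add.commute diff_add_cancel norm_triangle_ineq)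
            then show "cmod (poly R' s) \<le> C * cmod (poly B' s)"
              using s that True by (intro ne) (auto simp: dist_norm)
          qed simp
        qed
      qed (use ne that in auto)
      then show ?thesis by blast
    qed
    ultimately have "B' dvd R'" using Suc.hyps(1) B'0 by blast
    then show ?case unfolding B' R' by (rule mult_dvd_mono[OF dvd_refl])
  qed
qed

text \<open>A quotient of polynomials that is bounded on bounded sets is a polynomial; this is the form in which
  the integral closedness of polynomial rings is needed. After a shear, \<open>b\<close> is monic in the last
  variable and division with remainder applies. On every line parallel to the last axis, \<open>b\<close> divides
  the remainder, whose degree is smaller. Hence the remainder vanishes.\<close>

lemma polyfun_dvd_of_bounded_quotient:
  fixes d :: nat
  assumes "b \<in> polyfun {..<d}" "b \<noteq> 0" "q \<in> polyfun {..<d}"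
    and bd: "\<And>B. \<exists>C. \<forall>\<eta>. (\<forall>i<d. cmod (\<eta> i) \<le> B) \<longrightarrow> b \<eta> \<noteq> 0 \<longrightarrow> cmod (q \<eta>) \<le> C * cmod (b \<eta>)"
  shows "\<exists>c\<in>polyfun {..<d}. q = b * c"
proof (cases d)
  case 0
  have const: "p \<eta> = p 0" if "p \<in> polyfun {..<d}" for p \<eta>
    by (rule polyfun_cong[OF that]) (simp add: 0)
  have b0: "b 0 \<noteq> 0"
  proof
    assume "b 0 = 0"
    then have "b x = 0" for x using const[OF assms(1), of x] by simp
    then show False using assms(2) by (auto simp: fun_eq_iff)
  qed
  have "q x = (b * (\<lambda>_. q 0 / b 0)) x" for x
    using const[OF assms(1), of x] const[OF assms(3), of x] b0 by simp
  then show ?thesis by (intro bexI[of _ "\<lambda>_. q 0 / b 0"] ext polyfun.const)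
next
  case (Suc n)
  obtain v \<alpha> P where P: "\<alpha> \<noteq> 0" "P \<in> polyfun_poly {..<n}" "lead_coeff P = 1"
    "\<And>x. b (shear n v x) = \<alpha> * pev P x (x n)"
    using monic_after_shear[of b n] assms(1,2) Suc by blast
  obtain Q where Q: "Q \<in> polyfun_poly {..<n}" "\<And>x. q (shear n v x) = pev Q x (x n)"
    using polyfun_Suc_poly[OF polyfun_shear[of q n v]] assms(3) Suc by blast
  obtain s r where sr: "s \<in> polyfun_poly {..<n}" "r \<in> polyfun_poly {..<n}" "Q = P * s + r"
    "r = 0 \<or> degree r < degree P" using monic_division[OF P(2,3) Q(1)] by blast
  have degP: "degree (slice P \<eta>) = degree P" "slice P \<eta> \<noteq> 0" for \<eta>
  proof -
    have "poly.coeff (slice P \<eta>) (degree P) = 1" using P(3) by simp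
    then show "slice P \<eta> \<noteq> 0" by (metis coeff_0 zero_neq_one)
    show "degree (slice P \<eta>) = degree P"
      using degree_slice_le[of P \<eta>] le_degree[of "slice P \<eta>" "degree P"] P(3)
      by (intro antisym) simp_all
  qed
  have "slice P \<eta> dvd slice Q \<eta>" for \<eta>
  proof (rule poly_dvd_of_bounded_quotient[OF degP(2)])
    fix \<rho>
    define B where "B = \<bar>\<rho>\<bar> + (\<Sum>i<n. cmod (\<eta> i) + cmod (v i) * \<bar>\<rho>\<bar>)"
    obtain C where C: "\<And>\<eta>. (\<forall>i<d. cmod (\<eta> i) \<le> B) \<Longrightarrow> b \<eta> \<noteq> 0 \<Longrightarrow> cmod (q \<eta>) \<le> C * cmod (b \<eta>)"
      using bd by blast
    have "cmod (poly (slice Q \<eta>) t) \<le> (C * cmod \<alpha>) * cmod (poly (slice P \<eta>) t)"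
      if t: "cmod t \<le> \<rho>" "poly (slice P \<eta>) t \<noteq> 0" for t
    proof -
      let ?x = "\<eta>(n := t)"
      have Pt: "pev P ?x t = pev P \<eta> t" and Qt: "pev Q ?x t = pev Q \<eta> t"
        by (rule pev_cong[OF P(2)], simp, rule pev_cong[OF Q(1)], simp)
      have bnd: "cmod (shear n v ?x i) \<le> B" if "i < d" for i
      proof (cases "i < n")
        case True
        have "cmod (shear n v ?x i) \<le> cmod (\<eta> i) + cmod (v i) * \<bar>\<rho>\<bar>"
          using True t by (auto simp: shear_def norm_mult intro!: order.trans[OF norm_triangle_ineq] mult_left_mono)
        also have "\<dots> \<le> (\<Sum>i<n. cmod (\<eta> i) + cmod (v i) * \<bar>\<rho>\<bar>)"
          using True by (intro member_le_sum) auto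
        finally show ?thesis by (simp add: B_def)
      next
        case False
        then have "i = n" using that Suc by auto
        then show ?thesis using t by (auto simp: shear_def B_def intro!: add_increasing2 sum_nonneg)
      qed
      have "b (shear n v ?x) \<noteq> 0" using P(1) P(4)[of ?x] Pt t(2) by simp
      from C[OF _ this] bnd show ?thesis
        using P(4)[of ?x] Q(2)[of ?x] Pt Qt by (simp add: norm_mult)
    qed
    then show "\<exists>C. \<forall>t. cmod t \<le> \<rho> \<longrightarrow> poly (slice P \<eta>) t \<noteq> 0 \<longrightarrow>
        cmod (poly (slice Q \<eta>) t) \<le> C * cmod (poly (slice P \<eta>) t)" by blast
  qed
  then have "slice P \<eta> dvd slice r \<eta>" for \<eta>
  proof -
    have "slice Q \<eta> = slice P \<eta> * slice s \<eta> + slice r \<eta>"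
      by (subst poly_eq_poly_eq_iff[symmetric]) (simp add: sr(3) fun_eq_iff)
    then show ?thesis using \<open>\<And>\<eta>. slice P \<eta> dvd slice Q \<eta>\<close>[of \<eta>]
      by (simp add: dvd_add_right_iff)
  qed
  then have "slice r \<eta> = 0" for \<eta>
    using sr(4) degP(1)[of \<eta>] degree_slice_le[of r \<eta>] dvd_imp_degree_le[of "slice P \<eta>" "slice r \<eta>"]
    by (cases "r = 0") (auto simp: slice_def)
  then have "pev r \<eta> \<tau> = 0" for \<eta> \<tau> by (metis poly_slice poly_0)
  then have Qx: "q (shear n v x) = (b (shear n v x) / \<alpha>) * pev s x (x n)" for x
    using Q(2)[of x] P(4)[of x] P(1) by (simp add: sr(3))
  define c where "c = (\<lambda>x. (1 / \<alpha>) * pev s (\<lambda>i. shear n (- v) x i) (x n))"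
  have "c = (\<lambda>_. 1 / \<alpha>) * (\<lambda>x. pev s (\<lambda>i. shear n (- v) x i) (x n))"
    by (auto simp: c_def fun_eq_iff)
  also have "\<dots> \<in> polyfun {..<Suc n}"
    by (intro polyfun.mult polyfun.const pev_polyfun[OF sr(1)] shear_polyfun polyfun.var) auto
  finally have "c \<in> polyfun {..<d}" using Suc by simp
  moreover have "q x = b x * c x" for x
    using Qx[of "shear n (- v) x"] by (simp add: shear_inverse c_def) (simp add: shear_def)
  ultimately show ?thesis by (intro bexI[of _ c]) (auto simp: fun_eq_iff)
qed

section \<open>Noether normalization\<close>

text \<open>From here on functions are mostly treated as elements of a ring. Identities between them are
  evaluated pointwise on request only.\<close>

lemmas pointwise = plus_fun_apply times_fun_apply zero_fun_apply one_fun_apply minus_apply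
  uminus_apply power_fun_apply

declare pointwise [simp del]

definition psubst :: "('i \<Rightarrow> ('v \<Rightarrow> complex) \<Rightarrow> complex) \<Rightarrow> (('i \<Rightarrow> complex) \<Rightarrow> complex) \<Rightarrow> ('v \<Rightarrow> complex) \<Rightarrow> complex" where
  "psubst y p = (\<lambda>x. p (\<lambda>i. y i x))"

definition pev_at :: "('i \<Rightarrow> ('v \<Rightarrow> complex) \<Rightarrow> complex) \<Rightarrow> (('v \<Rightarrow> complex) \<Rightarrow> complex)
    \<Rightarrow> (('i \<Rightarrow> complex) \<Rightarrow> complex) poly \<Rightarrow> ('v \<Rightarrow> complex) \<Rightarrow> complex" where
  "pev_at y g P = (\<lambda>x. pev P (\<lambda>i. y i x) (g x))"

lemma psubst_simps:
  "psubst y (p + q) = psubst y p + psubst y q" "psubst y (p - q) = psubst y p - psubst y q"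
  "psubst y (p * q) = psubst y p * psubst y q" "psubst y 0 = 0" "psubst y 1 = 1"
  "psubst y (- p) = - psubst y p"
  by (auto simp: psubst_def fun_eq_iff pointwise)

lemma pev_at_simps:
  "pev_at y g (P + Q) = pev_at y g P + pev_at y g Q" "pev_at y g (P - Q) = pev_at y g P - pev_at y g Q"
  "pev_at y g (P * Q) = pev_at y g P * pev_at y g Q" "pev_at y g 0 = 0" "pev_at y g 1 = 1"
  "pev_at y g (smult b P) = psubst y b * pev_at y g P" "pev_at y g (- P) = - pev_at y g P"
  "pev_at y g (Polynomial.monom b k) = psubst y b * g ^ k"
  by (auto simp: psubst_def pev_at_def fun_eq_iff pointwise)

lemma psubst_polyfun:
  "p \<in> polyfun V \<Longrightarrow> (\<And>i. i \<in> V \<Longrightarrow> y i \<in> polyfun W) \<Longrightarrow> psubst y p \<in> polyfun W"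
  unfolding psubst_def by (rule polyfun_compose)

lemma pev_at_polyfun:
  "P \<in> polyfun_poly V \<Longrightarrow> (\<And>i. i \<in> V \<Longrightarrow> y i \<in> polyfun W) \<Longrightarrow> g \<in> polyfun W \<Longrightarrow>
    pev_at y g P \<in> polyfun W"
  unfolding pev_at_def by (rule pev_polyfun)

lemma pev_at_altdef: "pev_at y g P = (\<Sum>i\<le>degree P. psubst y (poly.coeff P i) * g ^ i)"
  by (auto simp: fun_eq_iff pointwise pev_at_def pev_altdef psubst_def sum_fun_apply)

locale poly_ideal =
  fixes V :: "'v set" and J :: "(('v \<Rightarrow> complex) \<Rightarrow> complex) set"
  assumes J_sub: "J \<subseteq> polyfun V"
    and J_0: "0 \<in> J"
    and J_add: "p \<in> J \<Longrightarrow> q \<in> J \<Longrightarrow> p + q \<in> J"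
    and J_mult: "p \<in> polyfun V \<Longrightarrow> q \<in> J \<Longrightarrow> p * q \<in> J"
    and J_proper: "1 \<notin> J"
begin

lemma J_mult': "q \<in> J \<Longrightarrow> p \<in> polyfun V \<Longrightarrow> q * p \<in> J"
  using J_mult[of p q] by (simp add: mult.commute)

lemma J_uminus: "p \<in> J \<Longrightarrow> - p \<in> J"
  using J_mult[OF polyfun_uminus[OF polyfun_1], of p] by simp

lemma J_diff: "p \<in> J \<Longrightarrow> q \<in> J \<Longrightarrow> p - q \<in> J"
  using J_add[of p "- q"] J_uminus[of q] by simp

lemma const_notin_J: "c \<noteq> 0 \<Longrightarrow> (\<lambda>_. c) \<notin> J"
proof
  assume "c \<noteq> 0" "(\<lambda>_. c) \<in> J"
  then have "(\<lambda>_. 1 / c) * (\<lambda>_. c) \<in> J" by (intro J_mult polyfun.const)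
  moreover have "(\<lambda>_. 1 / c) * (\<lambda>_. c) = (1 :: ('v \<Rightarrow> complex) \<Rightarrow> complex)" using \<open>c \<noteq> 0\<close> by (auto simp: fun_eq_iff pointwise)
  ultimately show False using J_proper by simp
qed

text \<open>Generators of a module over \<open>A\<close> are considered modulo \<open>J\<close>, because relations in the coordinate ring
  are congruences modulo \<open>J\<close>.\<close>

inductive_set span_mod :: "(('v \<Rightarrow> complex) \<Rightarrow> complex) set \<Rightarrow> (('v \<Rightarrow> complex) \<Rightarrow> complex) set \<Rightarrow>
    (('v \<Rightarrow> complex) \<Rightarrow> complex) set" for A E where
  J: "p \<in> J \<Longrightarrow> p \<in> span_mod A E"
| gen: "a \<in> A \<Longrightarrow> e \<in> E \<Longrightarrow> a * e \<in> span_mod A E"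
| add: "p \<in> span_mod A E \<Longrightarrow> q \<in> span_mod A E \<Longrightarrow> p + q \<in> span_mod A E"

lemma span_mod_sum: "(\<And>i. i \<in> S \<Longrightarrow> p i \<in> span_mod A E) \<Longrightarrow> sum p S \<in> span_mod A E"
  by (induction S rule: infinite_finite_induct) (auto intro: span_mod.intros J_0)

lemma span_mod_mono: "p \<in> span_mod A E \<Longrightarrow> E \<subseteq> E' \<Longrightarrow> p \<in> span_mod A E'"
  by (induction rule: span_mod.induct) (auto intro: span_mod.intros)

lemma span_mod_mult:
  "p \<in> span_mod A E \<Longrightarrow> w \<in> polyfun V \<Longrightarrow> (\<And>e. e \<in> E \<Longrightarrow> e * w \<in> E') \<Longrightarrow> p * w \<in> span_mod A E'"
proof (induction rule: span_mod.induct)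
  case (J p)
  then show ?case by (intro span_mod.J J_mult')
next
  case (gen a e)
  then have "a * (e * w) \<in> span_mod A E'" by (intro span_mod.gen) auto
  then show ?case by (simp only: mult.assoc)
next
  case (add p q)
  then have "p * w + q * w \<in> span_mod A E'" by (intro span_mod.add) auto
  then show ?case by (simp only: distrib_right)
qed

lemma span_mod_combination:
  assumes "p \<in> span_mod A E" "finite E" "0 \<in> A" "\<And>a b. a \<in> A \<Longrightarrow> b \<in> A \<Longrightarrow> a + b \<in> A"
  shows "\<exists>b. (\<forall>e. b e \<in> A) \<and> p - (\<Sum>e\<in>E. b e * e) \<in> J"
  using assms(1)
proof (induction rule: span_mod.induct)
  case (J p)
  then show ?case using assms(3) by (intro exI[of _ "\<lambda>_. 0"]) simp
next
  case (gen a e)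
  have "(\<Sum>e'\<in>E. (if e' = e then a else 0) * e') = (\<Sum>e'\<in>E. if e' = e then a * e' else 0)"
    by (intro sum.cong) auto
  also have "\<dots> = a * e" using gen assms(2) by simp
  finally have "a * e - (\<Sum>e'\<in>E. (if e' = e then a else 0) * e') = 0" by simp
  then have "a * e - (\<Sum>e'\<in>E. (if e' = e then a else 0) * e') \<in> J" using J_0 by (simp only:)
  moreover have "\<forall>e'. (if e' = e then a else 0) \<in> A" using gen assms(3) by simp
  ultimately show ?case by (intro exI[of _ "\<lambda>e'. if e' = e then a else 0"] conjI)
next
  case (add p q)
  then obtain b c where b: "\<forall>e. b e \<in> A" "p - (\<Sum>e\<in>E. b e * e) \<in> J"
    and c: "\<forall>e. c e \<in> A" "q - (\<Sum>e\<in>E. c e * e) \<in> J" by blast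
  have "(p - (\<Sum>e\<in>E. b e * e)) + (q - (\<Sum>e\<in>E. c e * e)) \<in> J" using b(2) c(2) by (rule J_add)
  also have "(p - (\<Sum>e\<in>E. b e * e)) + (q - (\<Sum>e\<in>E. c e * e)) = (p + q) - (\<Sum>e\<in>E. (b + c) e * e)"
    by (simp add: sum.distrib distrib_right plus_fun_apply[of b c])
  finally have "(p + q) - (\<Sum>e\<in>E. (b + c) e * e) \<in> J" .
  moreover have "\<forall>e. (b + c) e \<in> A" using b(1) c(1) assms(4) by (simp add: plus_fun_apply)
  ultimately show ?case by blast
qed

definition alg :: "nat \<Rightarrow> (nat \<Rightarrow> ('v \<Rightarrow> complex) \<Rightarrow> complex) \<Rightarrow> (('v \<Rightarrow> complex) \<Rightarrow> complex) set" where
  "alg d y = psubst y ` polyfun {..<d}"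

text \<open>Unless the functions \<open>w i\<close> are algebraically independent modulo \<open>J\<close>, they satisfy a relation, which
  a shear makes monic in the last of them. The algebra that they generate is then a finite module over
  the algebra generated by one function less, and induction applies.\<close>

lemma noether_normalization_aux:
  assumes "\<And>i. i < n \<Longrightarrow> w i \<in> polyfun V"
  shows "\<exists>d y E. (\<forall>i<d. y i \<in> polyfun V) \<and> (\<forall>p\<in>polyfun {..<d}. psubst y p \<in> J \<longrightarrow> p = 0) \<and>
    finite E \<and> E \<subseteq> polyfun V \<and> alg n w \<subseteq> span_mod (alg d y) E"
  using assms
proof (induction n arbitrary: w)
  case 0
  have "p = 0" if p: "p \<in> polyfun {..<0::nat}" "psubst w p \<in> J" for p
  proof -
    have c: "p x = p 0" for x by (rule polyfun_cong[OF p(1)]) simp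
    have "psubst w p = (\<lambda>_. p 0)" unfolding psubst_def using c by (intro ext)
    then have "p 0 = 0" using p(2) const_notin_J by metis
    then show ?thesis using c by (intro ext) (simp add: pointwise)
  qed
  moreover have "alg 0 w \<subseteq> span_mod (alg 0 w) {1}"
    using span_mod.gen[of _ "alg 0 w" 1 "{1}"] by auto
  ultimately show ?case
    by (intro exI[where x = "0::nat"] exI[where x = w] exI[where x = "{1}"]) auto
next
  case (Suc n)
  show ?case
  proof (cases "\<forall>p\<in>polyfun {..<Suc n}. psubst w p \<in> J \<longrightarrow> p = 0")
    case True
    moreover have "alg (Suc n) w \<subseteq> span_mod (alg (Suc n) w) {1}"
      using span_mod.gen[of _ "alg (Suc n) w" 1 "{1}"] by auto
    ultimately show ?thesis using Suc.prems
      by (intro exI[of _ "Suc n"] exI[of _ w] exI[of _ "{1}"]) auto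
  next
    case False
    then obtain p where p: "p \<in> polyfun {..<Suc n}" "psubst w p \<in> J" "p \<noteq> 0" by blast
    obtain v \<alpha> P where P: "\<alpha> \<noteq> 0" "P \<in> polyfun_poly {..<n}" "lead_coeff P = 1"
      "\<And>x. p (shear n v x) = \<alpha> * pev P x (x n)"
      using monic_after_shear[OF p(1,3)] by blast
    define w' where "w' = (\<lambda>i. if i < n then w i - (\<lambda>_. v i) * w n else w i)"
    have w'V: "w' i \<in> polyfun V" if "i < Suc n" for i
      using Suc.prems that unfolding w'_def by (auto intro!: polyfun_diff polyfun.mult polyfun.const)
    have sh: "shear n v (\<lambda>i. w' i x) = (\<lambda>i. w i x)" for x
      by (auto simp: shear_def w'_def fun_eq_iff pointwise)
    have w'n: "w' n = w n" by (simp add: w'_def)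
    have rel: "pev_at w' (w n) P \<in> J"
    proof -
      have "(\<lambda>_. 1 / \<alpha>) * psubst w p = pev_at w' (w n) P"
        using P(1) P(4)[of "\<lambda>i. w' i _"] by (auto simp: fun_eq_iff pointwise psubst_def pev_at_def sh w'n)
      then show ?thesis using J_mult[OF polyfun.const p(2)] by metis
    qed
    obtain d y E where IH: "\<forall>i<d. y i \<in> polyfun V" "\<forall>p\<in>polyfun {..<d}. psubst y p \<in> J \<longrightarrow> p = 0"
      "finite E" "E \<subseteq> polyfun V" "alg n w' \<subseteq> span_mod (alg d y) E"
      using Suc.IH[of w'] w'V by auto
    define E' where "E' = (\<lambda>(e, i). e * w n ^ i) ` (E \<times> {..degree P})"
    have wn: "w n \<in> polyfun V" using Suc.prems by simp
    have "psubst w g \<in> span_mod (alg d y) E'" if g: "g \<in> polyfun {..<Suc n}" for g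
    proof -
      obtain G where G: "G \<in> polyfun_poly {..<n}" "\<And>x. g (shear n v x) = pev G x (x n)"
        using polyfun_Suc_poly[OF polyfun_shear[OF g]] by blast
      obtain s r where sr: "s \<in> polyfun_poly {..<n}" "r \<in> polyfun_poly {..<n}" "G = P * s + r"
        "r = 0 \<or> degree r < degree P" using monic_division[OF P(2,3) G(1)] by blast
      have "psubst w g = pev_at w' (w n) G"
        using G(2)[of "\<lambda>i. w' i _"] by (auto simp: fun_eq_iff pointwise psubst_def pev_at_def sh w'n)
      also have "\<dots> = pev_at w' (w n) s * pev_at w' (w n) P + pev_at w' (w n) r"
        by (simp add: sr(3) pev_at_simps mult.commute)
      also have "\<dots> \<in> span_mod (alg d y) E'"
      proof (rule span_mod.add)
        show "pev_at w' (w n) s * pev_at w' (w n) P \<in> span_mod (alg d y) E'"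
          using sr(1) w'V wn by (intro span_mod.J J_mult rel pev_at_polyfun) auto
        have "psubst w' (poly.coeff r i) * w n ^ i \<in> span_mod (alg d y) E'" if "i \<le> degree P" for i
        proof (rule span_mod_mult)
          show "psubst w' (poly.coeff r i) \<in> span_mod (alg d y) E"
            using IH(5) polyfun_polyD[OF sr(2)] by (auto simp: alg_def)
          show "w n ^ i \<in> polyfun V" using wn by (rule polyfun_power)
          show "e * w n ^ i \<in> E'" if "e \<in> E" for e using that \<open>i \<le> degree P\<close> by (auto simp: E'_def)
        qed
        moreover have "degree r \<le> degree P" using sr(4) by auto
        ultimately show "pev_at w' (w n) r \<in> span_mod (alg d y) E'"
          unfolding pev_at_altdef by (intro span_mod_sum) auto
      qed
      finally show ?thesis .
    qed
    moreover have "finite E'" using IH(3) by (simp add: E'_def)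
    moreover have "E' \<subseteq> polyfun V"
      using IH(4) wn unfolding E'_def by (auto intro!: polyfun.mult polyfun_power)
    ultimately show ?thesis using IH(1,2)
      by (intro exI[of _ d] exI[of _ y] exI[of _ E']) (auto simp: alg_def)
  qed
qed

text \<open>Gaussian elimination without division takes the place of determinants. One step removes the last
  unknown and forms \<open>2 \<times> 2\<close> minors. Whatever the predicates \<open>diag\<close> and \<open>off\<close> assert about entries on
  and off the diagonal after \<open>k\<close> steps only has to survive one such minor.\<close>

lemma elimination:
  fixes B :: "nat \<Rightarrow> nat \<Rightarrow> ('v \<Rightarrow> complex) \<Rightarrow> complex"
  assumes diag: "\<And>k a b c c'. diag k a \<Longrightarrow> diag k b \<Longrightarrow> off k c \<Longrightarrow> off k c' \<Longrightarrow> diag (Suc k) (a * b - c * c')"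
    and off: "\<And>k a b c c'. diag k a \<Longrightarrow> off k b \<Longrightarrow> off k c \<Longrightarrow> off k c' \<Longrightarrow> off (Suc k) (a * b - c * c')"
    and poly: "\<And>k a. diag k a \<or> off k a \<Longrightarrow> a \<in> polyfun V"
    and "\<And>i. i \<le> M \<Longrightarrow> diag k (B i i)"
    and "\<And>i j. i \<le> M \<Longrightarrow> j \<le> M \<Longrightarrow> i \<noteq> j \<Longrightarrow> off k (B i j)"
    and "\<And>i. i \<le> M \<Longrightarrow> (\<Sum>j\<le>M. B i j * e j) \<in> J"
  shows "\<exists>k s. diag k s \<and> s * e 0 \<in> J"
  using assms(4-)
proof (induction M arbitrary: B k)
  case 0
  then show ?case by auto
next
  case (Suc M)
  let ?D = "Suc M"
  define B' where "B' = (\<lambda>i j. B ?D ?D * B i j - B i ?D * B ?D j)"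
  show ?case
  proof (rule Suc.IH[of "Suc k" B'])
    show "diag (Suc k) (B' i i)" if "i \<le> M" for i
      unfolding B'_def using Suc.prems that by (intro diag) auto
    show "off (Suc k) (B' i j)" if "i \<le> M" "j \<le> M" "i \<noteq> j" for i j
      unfolding B'_def using Suc.prems that by (intro off) auto
    show "(\<Sum>j\<le>M. B' i j * e j) \<in> J" if "i \<le> M" for i
    proof -
      have "(\<Sum>j\<le>M. B' i j * e j) = (\<Sum>j\<le>?D. B' i j * e j)" by (simp add: B'_def algebra_simps)
      also have "\<dots> = B ?D ?D * (\<Sum>j\<le>?D. B i j * e j) - B i ?D * (\<Sum>j\<le>?D. B ?D j * e j)"
        unfolding B'_def sum_distrib_left sum_subtractf[symmetric]
        by (intro sum.cong refl) (simp only: algebra_simps)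
      also have "\<dots> \<in> J"
        using Suc.prems(3)[of i] Suc.prems(3)[of ?D] poly[of k "B ?D ?D"] poly[of k "B i ?D"]
          Suc.prems(1)[of ?D] Suc.prems(2)[of i ?D] that by (intro J_diff J_mult) simp_all
      finally show ?thesis .
    qed
  qed
qed

text \<open>This is the Cayley-Hamilton argument. Multiplication by \<open>g\<close> on the module generated by \<open>E\<close> has a
  matrix over the algebra generated by \<open>y\<close>, and \<open>g\<close> minus this matrix annihilates the vector of
  generators. After \<open>k\<close> elimination steps the diagonal entries are monic polynomials of degree
  \<open>2 ^ k\<close> in \<open>g\<close>, and the others have smaller degree. The last remaining entry annihilates the
  generator \<open>1\<close>.\<close>

lemma integral_relation:
  assumes g: "g \<in> polyfun V" and y: "\<And>i. i < d \<Longrightarrow> y i \<in> polyfun V"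
    and E: "finite E" "1 \<in> E" "E \<subseteq> polyfun V" "\<And>e. e \<in> E \<Longrightarrow> g * e \<in> span_mod (alg d y) E"
  shows "\<exists>P\<in>polyfun_poly {..<d}. lead_coeff P = 1 \<and> pev_at y g P \<in> J"
proof -
  define M where "M = card (E - {1})"
  obtain e0 where e0: "bij_betw e0 {..<M} (E - {1})"
    using E(1) unfolding M_def by (metis ex_bij_betw_nat_finite finite_Diff lessThan_atLeast0)
  define e where "e = (\<lambda>i. case i of 0 \<Rightarrow> 1 | Suc j \<Rightarrow> e0 j)"
  have img: "e ` {..M} = E"
  proof -
    have "{..M} = insert 0 (Suc ` {..<M})" by (metis lessThan_Suc_atMost lessThan_Suc_eq_insert_0)
    then have "e ` {..M} = insert 1 (e0 ` {..<M})" by (simp add: e_def image_image)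
    then show ?thesis using e0 E(2) by (auto simp: bij_betw_def)
  qed
  have inj: "inj_on e {..M}"
  proof (rule eq_card_imp_inj_on)
    show "card (e ` {..M}) = card {..M}"
      unfolding img using card.remove[OF E(1,2)] by (simp only: M_def card_atMost)
  qed simp
  have A: "0 \<in> alg d y"
    unfolding alg_def by (rule image_eqI[of _ _ 0]) (simp_all add: psubst_simps)
  have A': "a + b \<in> alg d y" if ab: "a \<in> alg d y" "b \<in> alg d y" for a b
  proof -
    obtain p q where "a = psubst y p" "p \<in> polyfun {..<d}" "b = psubst y q" "q \<in> polyfun {..<d}"
      using ab unfolding alg_def by blast
    then show ?thesis unfolding alg_def
      by (intro image_eqI[of _ _ "p + q"] polyfun.add) (simp_all add: psubst_simps)
  qed
  have "\<exists>a. (\<forall>j. a j \<in> polyfun {..<d}) \<and> g * e i - (\<Sum>j\<le>M. psubst y (a j) * e j) \<in> J" if i: "i \<le> M" for i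
  proof -
    have "g * e i \<in> span_mod (alg d y) E" using E(4) img i by blast
    from span_mod_combination[OF this E(1) A A'] obtain b where b: "\<And>e. b e \<in> alg d y"
      "g * e i - (\<Sum>e\<in>E. b e * e) \<in> J" by blast
    have "\<forall>e. \<exists>a\<in>polyfun {..<d}. b e = psubst y a" using b(1) by (auto simp: alg_def)
    then obtain a where a: "\<And>e. a e \<in> polyfun {..<d}" "\<And>e. b e = psubst y (a e)" by metis
    have eq: "(\<Sum>e\<in>E. b e * e) = (\<Sum>j\<le>M. psubst y (a (e j)) * e j)"
      unfolding img[symmetric] by (subst sum.reindex[OF inj]) (simp add: a(2))
    have "g * e i - (\<Sum>j\<le>M. psubst y (a (e j)) * e j) \<in> J"
      using b(2) by (simp only: eq)
    then show ?thesis using a(1) by (intro exI[of _ "\<lambda>j. a (e j)"] conjI allI)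
  qed
  then obtain a where a: "\<And>i j. i \<le> M \<Longrightarrow> a i j \<in> polyfun {..<d}"
    "\<And>i. i \<le> M \<Longrightarrow> g * e i - (\<Sum>j\<le>M. psubst y (a i j) * e j) \<in> J" by metis
  define diag where "diag = (\<lambda>k s. \<exists>P\<in>polyfun_poly {..<d}. degree P = 2 ^ k \<and> lead_coeff P = 1 \<and> s = pev_at y g P)"
  define off where "off = (\<lambda>k s. \<exists>P\<in>polyfun_poly {..<d}. degree P < 2 ^ k \<and> s = pev_at y g P)"
  define B where "B = (\<lambda>i j. (if i = j then g else 0) - psubst y (a i j))"
  have low: "degree (R * R') < 2 ^ Suc k" if "degree R < 2 ^ k" "degree R' \<le> 2 ^ k" for R R' :: "((nat \<Rightarrow> complex) \<Rightarrow> complex) poly" and k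
    using degree_mult_le[of R R'] that by simp
  have "\<exists>k s. diag k s \<and> s * e 0 \<in> J"
  proof (rule elimination[where diag = diag and off = off and k = 0 and B = B and M = M and e = e])
    fix k f b c c' assume "diag k f" "diag k b" "off k c" "off k c'"
    then obtain F B C C' where *: "F \<in> polyfun_poly {..<d}" "degree F = 2 ^ k" "lead_coeff F = 1" "f = pev_at y g F"
      "B \<in> polyfun_poly {..<d}" "degree B = 2 ^ k" "lead_coeff B = 1" "b = pev_at y g B"
      "C \<in> polyfun_poly {..<d}" "degree C < 2 ^ k" "c = pev_at y g C"
      "C' \<in> polyfun_poly {..<d}" "degree C' < 2 ^ k" "c' = pev_at y g C'" unfolding diag_def off_def by blast
    have l: "degree (C * C') < 2 ^ Suc k" using * by (intro low) auto
    have le: "degree (F * B - C * C') \<le> 2 ^ Suc k"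
      using degree_mult_le[of F B] * l by (intro degree_diff_le) auto
    have co: "poly.coeff (F * B - C * C') (2 ^ Suc k) = 1"
      using coeff_mult_degree_sum[of F B] * coeff_eq_0[OF l] by (simp add: mult_2)
    have "degree (F * B - C * C') = 2 ^ Suc k"
    proof (rule antisym[OF le])
      show "2 ^ Suc k \<le> degree (F * B - C * C')" by (rule le_degree) (simp only: co, simp)
    qed
    with co show "diag (Suc k) (f * b - c * c')" unfolding diag_def using *
      by (intro bexI[of _ "F * B - C * C'"]) (auto simp: pev_at_simps intro: polyfun_poly_intros)
  next
    fix k f b c c' assume "diag k f" "off k b" "off k c" "off k c'"
    then obtain F B C C' where *: "F \<in> polyfun_poly {..<d}" "degree F = 2 ^ k" "lead_coeff F = 1" "f = pev_at y g F"
      "B \<in> polyfun_poly {..<d}" "degree B < 2 ^ k" "b = pev_at y g B"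
      "C \<in> polyfun_poly {..<d}" "degree C < 2 ^ k" "c = pev_at y g C"
      "C' \<in> polyfun_poly {..<d}" "degree C' < 2 ^ k" "c' = pev_at y g C'" unfolding diag_def off_def by blast
    have l: "degree (C * C') < 2 ^ Suc k" using * by (intro low) auto
    have l': "degree (F * B) < 2 ^ Suc k" using * low[of B k F] by (simp add: mult.commute)
    have "degree (F * B - C * C') < 2 ^ Suc k" using l' l by (rule degree_diff_less)
    then show "off (Suc k) (f * b - c * c')" unfolding off_def using *
      by (intro bexI[of _ "F * B - C * C'"]) (auto simp: pev_at_simps intro: polyfun_poly_intros)
  next
    fix k s assume "diag k s \<or> off k s"
    then show "s \<in> polyfun V" unfolding diag_def off_def using y g by (auto intro!: pev_at_polyfun)
  next
    fix i assume i: "i \<le> M"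
    have "Polynomial.monom 1 1 - Polynomial.monom (a i i) 0 = [:- a i i, 1:]"
      by (simp add: monom_0 monom_Suc)
    then have "degree (Polynomial.monom 1 1 - Polynomial.monom (a i i) 0) = 1" by simp
    moreover have "poly.coeff (Polynomial.monom 1 1 - Polynomial.monom (a i i) 0) 1 = 1" by simp
    moreover have "B i i = pev_at y g (Polynomial.monom 1 1 - Polynomial.monom (a i i) 0)"
      unfolding pev_at_simps psubst_simps by (simp add: B_def)
    ultimately show "diag 0 (B i i)" unfolding diag_def using a(1)[OF i, of i]
      by (intro bexI[of _ "Polynomial.monom 1 1 - Polynomial.monom (a i i) 0"])
         (simp_all add: polyfun_poly_intros)
  next
    fix i j assume ij: "i \<le> M" "j \<le> M" "i \<noteq> j"
    have "B i j = pev_at y g (- Polynomial.monom (a i j) 0)"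
      unfolding pev_at_simps psubst_simps using ij by (simp add: B_def)
    then show "off 0 (B i j)" unfolding off_def using a(1)[OF ij(1), of j]
      by (intro bexI[of _ "- Polynomial.monom (a i j) 0"] polyfun_poly_intros)
         (simp_all add: monom_0)
  next
    fix i assume i: "i \<le> M"
    have "(\<Sum>j\<le>M. B i j * e j) = (\<Sum>j\<le>M. (if i = j then g else 0) * e j) - (\<Sum>j\<le>M. psubst y (a i j) * e j)"
      by (simp add: B_def left_diff_distrib sum_subtractf)
    also have "(\<Sum>j\<le>M. (if i = j then g else 0) * e j) = (\<Sum>j\<le>M. if i = j then g * e j else 0)"
      by (intro sum.cong) auto
    also have "\<dots> = g * e i" using i by simp
    finally show "(\<Sum>j\<le>M. B i j * e j) \<in> J" using a(2)[OF i] by simp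
  qed
  then show ?thesis unfolding diag_def by (auto simp: e_def)
qed

end

section \<open>Extending points along integral extensions\<close>

lemma slice_simps:
  "slice (P + Q) \<eta> = slice P \<eta> + slice Q \<eta>" "slice (P - Q) \<eta> = slice P \<eta> - slice Q \<eta>"
  "slice 0 \<eta> = 0" "slice 1 \<eta> = 1"
  by (subst poly_eq_poly_eq_iff[symmetric], simp add: fun_eq_iff)+

definition const_poly :: "complex poly \<Rightarrow> (('v \<Rightarrow> complex) \<Rightarrow> complex) poly" where
  "const_poly s = map_poly (\<lambda>c _. c) s"

lemma coeff_const_poly: "poly.coeff (const_poly s) i = (\<lambda>_. poly.coeff s i)"
  unfolding const_poly_def by (subst coeff_map_poly) (auto simp: zero_fun_def)

lemma const_poly: "const_poly s \<in> polyfun_poly V" "slice (const_poly s) \<eta> = s"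
  by (auto simp: polyfun_poly_def coeff_const_poly poly_eq_iff intro: polyfun.const)

lemma slice_monic:
  assumes "lead_coeff P = 1"
  shows "degree (slice P \<eta>) = degree P" "lead_coeff (slice P \<eta>) = 1" "slice P \<eta> \<noteq> 0"
proof -
  have c: "poly.coeff (slice P \<eta>) (degree P) = 1" using assms by (simp add: one_fun_apply)
  show d: "degree (slice P \<eta>) = degree P"
  proof (rule antisym[OF degree_slice_le])
    show "degree P \<le> degree (slice P \<eta>)" by (rule le_degree) (simp only: c, simp)
  qed
  show "lead_coeff (slice P \<eta>) = 1" unfolding d by (rule c)
  then show "slice P \<eta> \<noteq> 0" by force
qed

definition zeros :: "(('v \<Rightarrow> complex) \<Rightarrow> complex) set \<Rightarrow> ('v \<Rightarrow> complex) set" where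
  "zeros J = {x. \<forall>p\<in>J. p x = 0}"

lemma degree_0_monic: "lead_coeff P = 1 \<Longrightarrow> degree P = 0 \<Longrightarrow> P = 1"
  by (metis degree_eq_zeroE lead_coeff_pCons(2) one_pCons pCons_eq_iff coeff_pCons_0)

context poly_ideal
begin

text \<open>The point \<open>\<xi>\<close> satisfies all polynomial relations between the functions \<open>w\<close> on the variety, as every
  point in the closure of the image of \<open>w\<close> does.\<close>

definition consistent :: "nat \<Rightarrow> (nat \<Rightarrow> ('v \<Rightarrow> complex) \<Rightarrow> complex) \<Rightarrow> (nat \<Rightarrow> complex) \<Rightarrow> bool" where
  "consistent n w \<xi> \<longleftrightarrow> (\<forall>u\<in>polyfun {..<n}. psubst w u \<in> J \<longrightarrow> u \<xi> = 0)"

text \<open>This is the lying-over property, proved as in Nakayama's lemma. If a relation \<open>U\<close> of \<open>z\<close> became \<open>1\<close>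
  at \<open>\<xi>\<close>, then modulo \<open>J\<close> every power of \<open>z\<close> would be a combination of the powers of \<open>z\<close> below the degree of \<open>P\<close>,
  with coefficients that vanish at \<open>\<xi>\<close>. Elimination turns this linear system into a relation between
  the \<open>w i\<close> whose value at \<open>\<xi>\<close> is \<open>1\<close>, which contradicts consistency.\<close>

lemma consistent_no_unit:
  assumes w: "\<And>i. i < n \<Longrightarrow> w i \<in> polyfun V" and z: "z \<in> polyfun V"
    and con: "consistent n w \<xi>"
    and P: "P \<in> polyfun_poly {..<n}" "lead_coeff P = 1" "pev_at w z P \<in> J"
    and U: "U \<in> polyfun_poly {..<n}" "pev_at w z U \<in> J"
  shows "slice U \<xi> \<noteq> 1"
proof
  assume U1: "slice U \<xi> = 1"
  have "degree P \<noteq> 0"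
    using degree_0_monic[OF P(2)] P(3) J_proper by (metis pev_at_simps(5))
  then obtain M where M: "degree P = Suc M" by (metis not0_implies_Suc)
  have "\<exists>r\<in>polyfun_poly {..<n}. degree r \<le> M \<and> slice r \<xi> = 0 \<and> z ^ i - pev_at w z r \<in> J" for i
  proof -
    \<comment> \<open>at \<open>z\<close> this is congruent to \<open>z ^ i\<close> modulo \<open>J\<close>, while its coefficients vanish at \<open>\<xi>\<close>\<close>
    define W where "W = Polynomial.monom 1 i * (1 - U)"
    have "W \<in> polyfun_poly {..<n}" unfolding W_def using U by (intro polyfun_poly_intros polyfun_1)
    from monic_division[OF P(1,2) this] obtain s r where sr: "s \<in> polyfun_poly {..<n}"
      "r \<in> polyfun_poly {..<n}" "W = P * s + r" "r = 0 \<or> degree r < degree P" by blast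
    have "slice W \<xi> = 0" by (simp add: W_def slice_mult slice_simps U1)
    then have eq: "slice P \<xi> * slice s \<xi> = - slice r \<xi>"
      using sr(3) by (simp add: slice_mult slice_simps eq_neg_iff_add_eq_0)
    have "slice s \<xi> = 0"
    proof (rule ccontr)
      assume "slice s \<xi> \<noteq> 0"
      then have "degree (slice P \<xi> * slice s \<xi>) \<ge> degree P" "slice P \<xi> * slice s \<xi> \<noteq> 0"
        using slice_monic[OF P(2), of \<xi>] by (simp_all add: degree_mult_eq)
      then have "degree (slice r \<xi>) \<ge> degree P" "slice r \<xi> \<noteq> 0" unfolding eq by auto
      then show False using sr(4) degree_slice_le[of r \<xi>] by (auto simp: slice_simps)
    qed
    then have r0: "slice r \<xi> = 0" using eq by simp
    have "z ^ i - pev_at w z r = z ^ i * pev_at w z U + pev_at w z s * pev_at w z P"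
    proof -
      have "pev_at w z W = pev_at w z P * pev_at w z s + pev_at w z r"
        by (simp add: sr(3) pev_at_simps)
      moreover have "pev_at w z W = z ^ i - z ^ i * pev_at w z U"
        by (simp add: W_def pev_at_simps psubst_simps right_diff_distrib)
      ultimately show ?thesis by (simp add: algebra_simps)
    qed
    also have "\<dots> \<in> J" using U P z w sr(1)
      by (intro J_add J_mult polyfun_power pev_at_polyfun[of _ "{..<n}"]) auto
    finally show ?thesis using sr(2,4) r0 M by (intro bexI[of _ r]) auto
  qed
  then obtain r where r: "\<And>i. r i \<in> polyfun_poly {..<n}" "\<And>i. degree (r i) \<le> M"
    "\<And>i. slice (r i) \<xi> = 0" "\<And>i. z ^ i - pev_at w z (r i) \<in> J" by metis
  define good where "good = (\<lambda>c (k::nat) s. \<exists>u\<in>polyfun {..<n}. u \<xi> = c \<and> s = psubst w u)"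
  define B where "B = (\<lambda>i j. (if i = j then 1 else 0) - psubst w (poly.coeff (r i) j))"
  have coef0: "poly.coeff (r i) j \<xi> = 0" for i j using r(3)[of i] by (metis coeff_slice coeff_0)
  have "\<exists>k s. good 1 k s \<and> s * z ^ 0 \<in> J"
  proof (rule elimination[where diag = "good 1" and off = "good 0" and k = 0 and B = B and M = M and e = "\<lambda>i. z ^ i"])
    fix k f b c c' assume "good 1 k f" "good 1 k b" "good 0 k c" "good 0 k c'"
    then obtain F B C C' where "F \<in> polyfun {..<n}" "F \<xi> = 1" "f = psubst w F"
      "B \<in> polyfun {..<n}" "B \<xi> = 1" "b = psubst w B" "C \<in> polyfun {..<n}" "C \<xi> = 0" "c = psubst w C"
      "C' \<in> polyfun {..<n}" "C' \<xi> = 0" "c' = psubst w C'" unfolding good_def by blast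
    then show "good 1 (Suc k) (f * b - c * c')" unfolding good_def
      by (intro bexI[of _ "F * B - C * C'"] polyfun_diff polyfun.mult) (simp_all add: psubst_simps pointwise)
  next
    fix k f b c c' assume "good 1 k f" "good 0 k b" "good 0 k c" "good 0 k c'"
    then obtain F B C C' where "F \<in> polyfun {..<n}" "F \<xi> = 1" "f = psubst w F"
      "B \<in> polyfun {..<n}" "B \<xi> = 0" "b = psubst w B" "C \<in> polyfun {..<n}" "C \<xi> = 0" "c = psubst w C"
      "C' \<in> polyfun {..<n}" "C' \<xi> = 0" "c' = psubst w C'" unfolding good_def by blast
    then show "good 0 (Suc k) (f * b - c * c')" unfolding good_def
      by (intro bexI[of _ "F * B - C * C'"] polyfun_diff polyfun.mult) (simp_all add: psubst_simps pointwise)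
  next
    fix k s assume "good 1 k s \<or> good 0 k s"
    then show "s \<in> polyfun V" unfolding good_def using w by (auto intro!: psubst_polyfun)
  next
    fix i show "good 1 0 (B i i)" unfolding good_def B_def
      using polyfun_polyD[OF r(1)] coef0
      by (intro bexI[of _ "1 - poly.coeff (r i) i"] polyfun_diff polyfun_1) (simp_all add: psubst_simps pointwise)
  next
    fix i j :: nat assume "i \<noteq> j" then show "good 0 0 (B i j)" unfolding good_def B_def
      using polyfun_polyD[OF r(1)] coef0
      by (intro bexI[of _ "- poly.coeff (r i) j"] polyfun_uminus) (simp_all add: psubst_simps pointwise)
  next
    fix i assume i: "i \<le> M"
    have "(\<Sum>j\<le>M. B i j * z ^ j) = (\<Sum>j\<le>M. (if i = j then 1 else 0) * z ^ j)
        - (\<Sum>j\<le>M. psubst w (poly.coeff (r i) j) * z ^ j)"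
      by (simp add: B_def left_diff_distrib sum_subtractf)
    also have "(\<Sum>j\<le>M. (if i = j then 1 else 0) * z ^ j) = (\<Sum>j\<le>M. if i = j then z ^ j else 0)"
      by (intro sum.cong) auto
    also have "\<dots> = z ^ i" using i by simp
    also have "(\<Sum>j\<le>M. psubst w (poly.coeff (r i) j) * z ^ j) = pev_at w z (r i)"
      unfolding pev_at_altdef using r(2)[of i]
      by (intro sum.mono_neutral_right) (auto simp: coeff_eq_0 psubst_simps)
    finally show "(\<Sum>j\<le>M. B i j * z ^ j) \<in> J" using r(4) by simp
  qed
  then obtain u where "u \<in> polyfun {..<n}" "u \<xi> = 1" "psubst w u \<in> J" unfolding good_def by auto
  then show False using con unfolding consistent_def by auto
qed

text \<open>At \<open>\<xi>\<close> the relations of \<open>z\<close> over the \<open>w i\<close> become an ideal of polynomials in one variable. It does not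
  contain \<open>1\<close>, so its generator \<open>h\<close> has a root, which serves as the value of \<open>z\<close>.\<close>

lemma extend_point:
  assumes w: "\<And>i. i < n \<Longrightarrow> w i \<in> polyfun V" and z: "z \<in> polyfun V"
    and con: "consistent n w \<xi>"
    and P: "P \<in> polyfun_poly {..<n}" "lead_coeff P = 1" "pev_at w z P \<in> J"
  shows "\<exists>\<zeta>. consistent (Suc n) (w(n := z)) (\<xi>(n := \<zeta>))"
proof -
  define S where "S = {slice U \<xi> | U. U \<in> polyfun_poly {..<n} \<and> pev_at w z U \<in> J}"
  have SI: "slice U \<xi> \<in> S" if "U \<in> polyfun_poly {..<n}" "pev_at w z U \<in> J" for U
    using that by (auto simp: S_def)
  have Sdiff: "a - h * s \<in> S" if "a \<in> S" "h \<in> S" for a h s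
  proof -
    from that(1) obtain A where "a = slice A \<xi>" "A \<in> polyfun_poly {..<n}" "pev_at w z A \<in> J"
      unfolding S_def by blast
    moreover from that(2) obtain H where "h = slice H \<xi>" "H \<in> polyfun_poly {..<n}" "pev_at w z H \<in> J"
      unfolding S_def by blast
    moreover have "pev_at w z (const_poly s) \<in> polyfun V"
      using w z by (intro pev_at_polyfun[OF const_poly(1)[of s "{..<n}"]]) auto
    ultimately show ?thesis using SI[of "A - H * const_poly s"]
      by (simp add: slice_simps slice_mult const_poly pev_at_simps polyfun_poly_intros J_diff J_mult')
  qed
  have "slice P \<xi> \<in> S" "slice P \<xi> \<noteq> 0" using SI[OF P(1,3)] slice_monic(3)[OF P(2)] by auto
  then obtain h where h: "h \<in> S" "h \<noteq> 0" "\<And>r. r \<in> S \<Longrightarrow> r \<noteq> 0 \<Longrightarrow> degree h \<le> degree r"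
    using exists_least_iff[of "\<lambda>k. \<exists>h\<in>S. h \<noteq> 0 \<and> degree h = k"] by (metis leI)
  have "degree h \<noteq> 0"
  proof
    assume "degree h = 0"
    then obtain c where c: "h = [:c:]" "c \<noteq> 0" using h(2) by (metis degree_eq_zeroE pCons_0_0)
    have "0 - h * [:- 1 / c:] \<in> S" by (intro Sdiff h(1)) (use Sdiff[OF h(1) h(1), of 1] in simp)
    then have "1 \<in> S" using c by (simp add: one_pCons)
    then show False using consistent_no_unit[OF w z con P] by (auto simp: S_def)
  qed
  then obtain \<zeta> where \<zeta>: "poly h \<zeta> = 0"
    using Fundamental_Theorem_Algebra.fundamental_theorem_of_algebra[of h] constant_degree[of h] by auto
  have root: "poly a \<zeta> = 0" if "a \<in> S" for a
  proof -
    have "a mod h = a - h * (a div h)" by (simp add: minus_mult_div_eq_mod)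
    then have "a mod h \<in> S" using Sdiff[OF that h(1)] by simp
    then have "a mod h = 0" using h(2,3) degree_mod_less' by (metis not_le)
    then show ?thesis using \<zeta> by (metis dvd_eq_mod_eq_0 dvd_def poly_mult mult_zero_left)
  qed
  have "u (\<xi>(n := \<zeta>)) = 0" if u: "u \<in> polyfun {..<Suc n}" "psubst (w(n := z)) u \<in> J" for u
  proof -
    obtain U where U: "U \<in> polyfun_poly {..<n}" "\<And>x. u x = pev U x (x n)"
      using polyfun_Suc_poly[OF u(1)] by blast
    have "psubst (w(n := z)) u = pev_at w z U"
    proof
      fix x
      have "psubst (w(n := z)) u x = pev U (\<lambda>i. (w(n := z)) i x) (z x)"
        unfolding psubst_def by (subst U(2)) simp
      also have "\<dots> = pev U (\<lambda>i. w i x) (z x)" by (rule pev_cong[OF U(1)]) simp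
      finally show "psubst (w(n := z)) u x = pev_at w z U x" by (simp only: pev_at_def)
    qed
    then have "slice U \<xi> \<in> S" using SI[OF U(1)] u(2) by simp
    then have "pev U \<xi> \<zeta> = 0" using root[of "slice U \<xi>"] by simp
    moreover have "u (\<xi>(n := \<zeta>)) = pev U (\<xi>(n := \<zeta>)) \<zeta>" by (subst U(2)) simp
    moreover have "pev U (\<xi>(n := \<zeta>)) \<zeta> = pev U \<xi> \<zeta>" by (rule pev_cong[OF U(1)]) simp
    ultimately show ?thesis by simp
  qed
  then show ?thesis unfolding consistent_def by blast
qed

lemma extend_points:
  assumes w: "\<And>i. i < n \<Longrightarrow> w i \<in> polyfun V" and z: "\<And>i. i < k \<Longrightarrow> z i \<in> polyfun V"
    and con: "consistent n w \<xi>"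
    and int: "\<And>i. i < k \<Longrightarrow> \<exists>P\<in>polyfun_poly {..<n}. lead_coeff P = 1 \<and> pev_at w (z i) P \<in> J"
  shows "\<exists>\<xi>'. (\<forall>i<n. \<xi>' i = \<xi> i) \<and> consistent (n + k) (\<lambda>i. if i < n then w i else z (i - n)) \<xi>'"
  using z int
proof (induction k)
  case 0
  have "psubst (\<lambda>i. if i < n then w i else z (i - n)) u = psubst w u" if "u \<in> polyfun {..<n}" for u
    unfolding psubst_def by (intro ext polyfun_cong[OF that]) auto
  then show ?case using con by (intro exI[of _ \<xi>]) (auto simp: consistent_def)
next
  case (Suc k)
  let ?W = "\<lambda>i. if i < n then w i else z (i - n)"
  obtain \<xi>' where \<xi>': "\<And>i. i < n \<Longrightarrow> \<xi>' i = \<xi> i" "consistent (n + k) ?W \<xi>'" using Suc by auto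
  obtain P where P: "P \<in> polyfun_poly {..<n}" "lead_coeff P = 1" "pev_at w (z k) P \<in> J"
    using Suc.prems(2)[of k] by auto
  have P': "P \<in> polyfun_poly {..<n + k}"
    using polyfun_mono[of "{..<n}" "{..<n + k}"] polyfun_polyD[OF P(1)] by (auto simp: polyfun_poly_def)
  have WV: "?W i \<in> polyfun V" if "i < n + k" for i using w Suc.prems(1) that by auto
  have "pev_at ?W (z k) P = pev_at w (z k) P"
    unfolding pev_at_def by (intro ext pev_cong[OF P(1)]) auto
  then obtain \<zeta> where "consistent (Suc (n + k)) (?W(n + k := z k)) (\<xi>'(n + k := \<zeta>))"
    using extend_point[of "n + k" ?W "z k" \<xi>' P] WV Suc.prems(1)[of k] \<xi>'(2) P P' by auto
  moreover have "?W(n + k := z k) = ?W" by (auto simp: fun_eq_iff)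
  ultimately have c: "consistent (n + Suc k) ?W (\<xi>'(n + k := \<zeta>))" by (simp only: add_Suc_right)
  show ?case
  proof (intro exI conjI)
    show "\<forall>i<n. (\<xi>'(n + k := \<zeta>)) i = \<xi> i" using \<xi>'(1) by simp
  qed (rule c)
qed

end

lemma polyfun_vars:
  fixes n N :: nat
  shows "p \<in> polyfun {..<N} \<Longrightarrow> (\<lambda>x. p (\<lambda>i. x (n + i))) \<in> polyfun {..<n + N}"
  by (rule polyfun_compose[where y = "\<lambda>i x. x (n + i)"]) (auto intro!: polyfun.var)

text \<open>The coordinate functions are adjoined to \<open>w\<close> one after the other. Consistent values of them are the
  coordinates of a point of the variety.\<close>

lemma lift_point:
  fixes N :: nat
  assumes "poly_ideal {..<N} J" and w: "\<And>i. i < n \<Longrightarrow> w i \<in> polyfun {..<N}"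
    and con: "poly_ideal.consistent J n w \<xi>"
    and int: "\<And>g. g \<in> polyfun {..<N} \<Longrightarrow> \<exists>P\<in>polyfun_poly {..<n}. lead_coeff P = 1 \<and> pev_at w g P \<in> J"
  shows "\<exists>x\<in>zeros J. \<forall>i<n. w i x = \<xi> i"
proof -
  interpret poly_ideal "{..<N}" J by fact
  let ?W = "\<lambda>i. if i < n then w i else (\<lambda>x. x (i - n))"
  obtain \<xi>' where \<xi>': "\<And>i. i < n \<Longrightarrow> \<xi>' i = \<xi> i" "consistent (n + N) ?W \<xi>'"
    using extend_points[of n w N "\<lambda>i x. x i" \<xi>] w con int by (auto intro: polyfun.var)
  define x where "x = (\<lambda>i. \<xi>' (n + i))"
  have "p x = 0" if "p \<in> J" for p
  proof -
    have p: "p \<in> polyfun {..<N}" using that J_sub by auto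
    have "psubst ?W (\<lambda>x. p (\<lambda>i. x (n + i))) = p" by (simp add: psubst_def)
    then show ?thesis using \<xi>'(2) polyfun_vars[OF p, of n] that unfolding consistent_def x_def by auto
  qed
  moreover have "w i x = \<xi> i" if i: "i < n" for i
  proof -
    let ?u = "(\<lambda>x. x i) - (\<lambda>x. w i (\<lambda>j. x (n + j)))"
    have 0: "psubst ?W ?u = 0" using i by (auto simp: psubst_def fun_eq_iff pointwise)
    have u: "?u \<in> polyfun {..<n + N}"
      using i by (intro polyfun_diff polyfun.var polyfun_vars w) auto
    have "?u \<xi>' = 0"
      by (rule \<xi>'(2)[unfolded consistent_def, rule_format, OF u]) (simp only: 0 J_0)
    then show ?thesis using \<xi>'(1)[OF i] by (simp add: pointwise x_def)
  qed
  ultimately show ?thesis by (auto simp: zeros_def intro!: bexI[of _ x])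
qed

text \<open>The functions \<open>y\<close> are independent and the coordinate ring is integral over them, so they define a
  finite surjective map from the zeros of \<open>J\<close> onto affine \<open>d\<close>-space.\<close>

locale noether = poly_ideal V J for V :: "'v set" and J +
  fixes d :: nat and y :: "nat \<Rightarrow> ('v \<Rightarrow> complex) \<Rightarrow> complex"
  assumes y_V: "i < d \<Longrightarrow> y i \<in> polyfun V"
    and y_indep: "p \<in> polyfun {..<d} \<Longrightarrow> psubst y p \<in> J \<Longrightarrow> p = 0"
    and y_integral: "g \<in> polyfun V \<Longrightarrow> \<exists>P\<in>polyfun_poly {..<d}. lead_coeff P = 1 \<and> pev_at y g P \<in> J"

lemma noether_normalization:
  fixes N :: nat
  assumes "poly_ideal {..<N} J"
  shows "\<exists>d y. noether {..<N} J d y"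
proof -
  interpret poly_ideal "{..<N}" J by fact
  have "\<exists>d y E. (\<forall>i<d. y i \<in> polyfun {..<N}) \<and> (\<forall>p\<in>polyfun {..<d}. psubst y p \<in> J \<longrightarrow> p = 0) \<and>
    finite E \<and> E \<subseteq> polyfun {..<N} \<and> alg N (\<lambda>i x. x i) \<subseteq> span_mod (alg d y) E"
    by (rule noether_normalization_aux) (simp add: polyfun.var)
  then obtain d y E where *: "\<forall>i<d. y i \<in> polyfun {..<N}" "\<forall>p\<in>polyfun {..<d}. psubst y p \<in> J \<longrightarrow> p = 0"
    "finite E" "E \<subseteq> polyfun {..<N}" "alg N (\<lambda>i x. x i) \<subseteq> span_mod (alg d y) E"
    by - ((erule exE conjE)+, rule that)
  have all: "p \<in> span_mod (alg d y) (insert 1 E)" if "p \<in> polyfun {..<N}" for p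
  proof -
    have "psubst (\<lambda>i x. x i) p \<in> alg N (\<lambda>i x. x i)" unfolding alg_def using that by (rule imageI)
    then have "p \<in> alg N (\<lambda>i x. x i)" by (simp add: psubst_def)
    then have "p \<in> span_mod (alg d y) E" using *(5) by (rule set_mp[rotated])
    then show ?thesis by (rule span_mod_mono) auto
  qed
  have int: "\<exists>P\<in>polyfun_poly {..<d}. lead_coeff P = 1 \<and> pev_at y g P \<in> J" if g: "g \<in> polyfun {..<N}" for g
  proof (rule integral_relation[of _ _ _ "insert 1 E", OF g])
    show "g * e \<in> span_mod (alg d y) (insert 1 E)" if "e \<in> insert 1 E" for e
      using that *(4) polyfun_1 by (intro all polyfun.mult g) blast
  qed (use *(1,3,4) polyfun_1 in blast)+
  have "noether {..<N} J d y"
  proof unfold_locales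
    show "y i \<in> polyfun {..<N}" if "i < d" for i using that *(1) by simp
    show "p = 0" if "p \<in> polyfun {..<d}" "psubst y p \<in> J" for p using that *(2) by simp
  qed (rule int)
  then show ?thesis by (intro exI)
qed

text \<open>Every point of the affine space in a Noether normalization is consistent, as the \<open>y i\<close> satisfy no
  relation. So it lifts to a zero of the ideal.\<close>

theorem nullstellensatz:
  fixes N :: nat
  assumes "poly_ideal {..<N} J"
  shows "zeros J \<noteq> {}"
proof -
  interpret poly_ideal "{..<N}" J by fact
  obtain d y where "noether {..<N} J d y" using noether_normalization[OF assms] by blast
  then interpret noether "{..<N}" J d y .
  have "consistent d y 0" unfolding consistent_def using y_indep by (metis zero_fun_apply)
  from lift_point[OF assms y_V this y_integral] show ?thesis by blast
qed

section \<open>Minimal polynomials\<close>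

lemma monic_factor_root:
  fixes p :: "complex poly"
  assumes "lead_coeff p = 1" "degree p = Suc n"
  obtains t p' where "p = [:- t, 1:] * p'" "lead_coeff p' = 1" "degree p' = n"
proof -
  obtain t where t: "poly p t = 0"
    using Fundamental_Theorem_Algebra.fundamental_theorem_of_algebra[of p] constant_degree[of p] assms(2) by auto
  obtain p' where p': "p = [:- t, 1:] * p'" using t by (auto simp: poly_eq_0_iff_dvd)
  have "p' \<noteq> 0" using assms p' by auto
  then have "degree p = Suc (degree p')" unfolding p' by (subst degree_mult_eq) auto
  moreover have "lead_coeff p' = 1" using assms(1) unfolding p' by (subst (asm) lead_coeff_mult) simp
  ultimately show ?thesis using that p' assms(2) by simp
qed

lemma monic_coeff_bound:
  fixes p :: "complex poly"
  assumes "lead_coeff p = 1" "\<And>t. poly p t = 0 \<Longrightarrow> cmod t \<le> \<rho>" "\<rho> \<ge> 0"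
  shows "cmod (poly.coeff p i) \<le> (1 + \<rho>) ^ degree p"
  using assms(1,2)
proof (induction "degree p" arbitrary: p i)
  case 0
  then have "p = 1" by (metis degree_eq_zeroE lead_coeff_pCons(2) one_pCons pCons_eq_iff coeff_pCons_0)
  then show ?case by (simp add: coeff_1)
next
  case (Suc n)
  obtain t p' where p': "p = [:- t, 1:] * p'" "lead_coeff p' = 1" "degree p' = n"
    using monic_factor_root[OF Suc.prems(1) Suc.hyps(2)[symmetric]] by blast
  have IH: "cmod (poly.coeff p' j) \<le> (1 + \<rho>) ^ n" for j
    using Suc.hyps(1)[of p'] p' Suc.prems(2) by simp
  have t: "cmod t \<le> \<rho>" using Suc.prems(2)[of t] p'(1) by simp
  have "poly.coeff p i = - (t * poly.coeff p' i) + (if i = 0 then 0 else poly.coeff p' (i - 1))"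
    unfolding p'(1) by (cases i) auto
  also have "cmod \<dots> \<le> cmod t * cmod (poly.coeff p' i) + cmod (if i = 0 then 0 else poly.coeff p' (i - 1))"
    by (rule order.trans[OF norm_triangle_ineq]) (simp add: norm_mult)
  also have "\<dots> \<le> \<rho> * (1 + \<rho>) ^ n + (1 + \<rho>) ^ n"
    using t IH assms(3) by (intro add_mono mult_mono) auto
  also have "\<dots> = (1 + \<rho>) ^ degree p" using Suc.hyps(2)[symmetric] by (simp add: algebra_simps)
  finally show ?case .
qed

lemma monic_root_bound:
  fixes p :: "complex poly"
  assumes "lead_coeff p = 1" "poly p t = 0"
  shows "cmod t \<le> 1 + (\<Sum>i<degree p. cmod (poly.coeff p i))"
proof (cases "cmod t \<le> 1")
  case True
  then show ?thesis by (intro add_increasing2 sum_nonneg) auto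
next
  case False
  then have t: "cmod t > 1" by simp
  let ?n = "degree p"
  have "poly p t = (\<Sum>i<?n. poly.coeff p i * t ^ i) + t ^ ?n"
    using assms(1) by (simp add: poly_altdef flip: lessThan_Suc_atMost)
  then have e: "t ^ ?n = - (\<Sum>i<?n. poly.coeff p i * t ^ i)" using assms(2)
    by (simp add: eq_neg_iff_add_eq_0 add.commute)
  have n: "?n \<noteq> 0" using e by (intro notI) simp
  have "cmod t ^ ?n = cmod (\<Sum>i<?n. poly.coeff p i * t ^ i)"
    by (metis e norm_minus_cancel norm_power)
  also have "\<dots> \<le> (\<Sum>i<?n. cmod (poly.coeff p i) * cmod t ^ i)"
    by (rule order.trans[OF norm_sum]) (simp add: norm_mult norm_power)
  also have "\<dots> \<le> (\<Sum>i<?n. cmod (poly.coeff p i) * cmod t ^ (?n - 1))"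
    using t by (intro sum_mono mult_left_mono power_increasing) auto
  also have "\<dots> = (\<Sum>i<?n. cmod (poly.coeff p i)) * cmod t ^ (?n - 1)" by (simp add: sum_distrib_right)
  finally have "cmod t * cmod t ^ (?n - 1) \<le> (\<Sum>i<?n. cmod (poly.coeff p i)) * cmod t ^ (?n - 1)"
    using n by (metis power_eq_if)
  moreover have "cmod t ^ (?n - 1) > 0" using t by (intro zero_less_power) linarith
  ultimately show ?thesis by (simp add: mult_le_cancel_right)
qed

text \<open>The modulus of a monic polynomial at \<open>a\<close> is the product of the distances of \<open>a\<close> from the roots.\<close>

lemma near_root:
  fixes p :: "complex poly"
  assumes "lead_coeff p = 1" "degree p \<noteq> 0"
  shows "\<exists>t. poly p t = 0 \<and> cmod (a - t) ^ degree p \<le> cmod (poly p a)"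
  using assms
proof (induction "degree p" arbitrary: p)
  case (Suc n)
  obtain t p' where p': "p = [:- t, 1:] * p'" "lead_coeff p' = 1" "degree p' = n"
    using monic_factor_root[OF Suc.prems(1) Suc.hyps(2)[symmetric]] by blast
  have pa: "cmod (poly p a) = cmod (a - t) * cmod (poly p' a)"
  proof -
    have "poly p a = (a - t) * poly p' a" unfolding p'(1) by (simp add: algebra_simps)
    then show ?thesis by (simp add: norm_mult)
  qed
  have deg: "degree p = Suc n" using Suc.hyps(2) by simp
  show ?case
  proof (cases "cmod (a - t) ^ n \<le> cmod (poly p' a)")
    case True
    then show ?thesis unfolding deg pa using p'(1) by (intro exI[of _ t]) (simp add: mult_left_mono)
  next
    case False
    have "n \<noteq> 0"
    proof
      assume "n = 0"
      then have "p' = 1" using p' by (metis degree_eq_zeroE lead_coeff_pCons(2) one_pCons pCons_eq_iff coeff_pCons_0)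
      then show False using False \<open>n = 0\<close> by simp
    qed
    then obtain s where s: "poly p' s = 0" "cmod (a - s) ^ n \<le> cmod (poly p' a)"
      using Suc.hyps(1)[of p'] p' by auto
    have "cmod (a - s) ^ n < cmod (a - t) ^ n" using False s(2) by simp
    then have "cmod (a - s) \<le> cmod (a - t)" by (rule power_less_imp_less_base[THEN less_imp_le]) simp
    then have "cmod (a - s) ^ Suc n \<le> cmod (a - t) * cmod (poly p' a)"
      using s(2) by (simp add: mult_mono)
    then show ?thesis unfolding deg pa using s(1) p'(1) by (intro exI[of _ s]) simp
  qed
qed simp

locale noether_prime = noether V J d y for V :: "'v set" and J d y +
  assumes J_prime: "p \<in> polyfun V \<Longrightarrow> q \<in> polyfun V \<Longrightarrow> p * q \<in> J \<Longrightarrow> p \<in> J \<or> q \<in> J"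
begin

text \<open>The degree is minimal among all annihilating polynomials, monic or not. For this a monic one has to be
  found, which is the content of \<open>min_poly_exists\<close>.\<close>

definition is_min_poly :: "(('v \<Rightarrow> complex) \<Rightarrow> complex) \<Rightarrow> ((nat \<Rightarrow> complex) \<Rightarrow> complex) poly \<Rightarrow> bool" where
  "is_min_poly g \<mu> \<longleftrightarrow> \<mu> \<in> polyfun_poly {..<d} \<and> lead_coeff \<mu> = 1 \<and> degree \<mu> \<noteq> 0 \<and> pev_at y g \<mu> \<in> J \<and>
    (\<forall>P\<in>polyfun_poly {..<d}. pev_at y g P \<in> J \<longrightarrow> P \<noteq> 0 \<longrightarrow> degree \<mu> \<le> degree P)"

text \<open>Let \<open>q\<close> be an annihilating polynomial of least degree with leading coefficient \<open>b\<close>, and \<open>p\<close> a monic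
  annihilating polynomial. Then \<open>q\<close> divides \<open>b ^ k p\<close>. Where \<open>b\<close> does not vanish, the roots of \<open>q / b\<close>
  are thus roots of \<open>p\<close> and locally bounded, hence so are its coefficients, the elementary symmetric
  functions of the roots. By \<open>polyfun_dvd_of_bounded_quotient\<close> they are polynomials. As \<open>J\<close> is prime
  and does not contain \<open>b\<close>, the factor \<open>b\<close> can be cancelled.\<close>

lemma min_poly_exists:
  assumes g: "g \<in> polyfun V"
  shows "\<exists>\<mu>. is_min_poly g \<mu>"
proof -
  define K where "K = {P \<in> polyfun_poly {..<d}. pev_at y g P \<in> J}"
  obtain p where p: "p \<in> K" "lead_coeff p = 1" using y_integral[OF g] unfolding K_def by blast
  have "p \<noteq> 0" using p(2) by force
  then obtain q where q: "q \<in> K" "q \<noteq> 0" "\<And>P. P \<in> K \<Longrightarrow> P \<noteq> 0 \<Longrightarrow> degree q \<le> degree P"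
    using p(1) exists_least_iff[of "\<lambda>k. \<exists>h\<in>K. h \<noteq> 0 \<and> degree h = k"] by (metis leI)
  define b where "b = lead_coeff q"
  define D where "D = degree q"
  have qp: "q \<in> polyfun_poly {..<d}" "pev_at y g q \<in> J" and pp: "p \<in> polyfun_poly {..<d}" "pev_at y g p \<in> J"
    using q(1) p(1) unfolding K_def by auto
  have b: "b \<in> polyfun {..<d}" "b \<noteq> 0" using q(2) polyfun_polyD[OF qp(1)] unfolding b_def by auto
  obtain k s r where ksr: "s \<in> polyfun_poly {..<d}" "r \<in> polyfun_poly {..<d}"
    "smult (b ^ k) p = q * s + r" "r = 0 \<or> degree r < D"
    using pseudo_division[OF qp(1) q(2) pp(1)] unfolding b_def D_def by blast
  have yb: "psubst y c \<in> polyfun V" if "c \<in> polyfun {..<d}" for c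
    by (rule psubst_polyfun[OF that]) (simp add: y_V)
  have "pev_at y g r \<in> J"
  proof -
    have "pev_at y g r = psubst y (b ^ k) * pev_at y g p - pev_at y g s * pev_at y g q"
      using arg_cong[OF ksr(3), of "pev_at y g"] by (simp add: pev_at_simps mult.commute)
    also have "\<dots> \<in> J"
      by (intro J_diff J_mult yb polyfun_power b pp qp pev_at_polyfun[OF ksr(1)]) (use y_V g in auto)
    finally show ?thesis .
  qed
  then have "r \<in> K" using ksr(2) by (simp add: K_def)
  then have r0: "r = 0" using q(3)[of r] ksr(4) unfolding D_def by (meson not_le)
  have bound: "\<exists>C. \<forall>\<eta>. (\<forall>i<d. cmod (\<eta> i) \<le> B) \<longrightarrow> b \<eta> \<noteq> 0 \<longrightarrow> cmod (poly.coeff q j \<eta>) \<le> C * cmod (b \<eta>)" for B j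
  proof -
    have "\<forall>i. \<exists>C>0. \<forall>\<eta>. (\<forall>i\<in>{..<d}. cmod (\<eta> i) \<le> B) \<longrightarrow> cmod (poly.coeff p i \<eta>) \<le> C"
      using polyfun_bounded polyfun_polyD[OF pp(1)] by blast
    then obtain C where C: "\<And>i. C i > 0" "\<And>i \<eta>. (\<forall>i<d. cmod (\<eta> i) \<le> B) \<Longrightarrow> cmod (poly.coeff p i \<eta>) \<le> C i"
      by (metis lessThan_iff)
    define \<rho> where "\<rho> = 1 + (\<Sum>i<degree p. C i)"
    have "cmod (poly.coeff q j \<eta>) \<le> (1 + \<rho>) ^ D * cmod (b \<eta>)" if \<eta>: "\<forall>i<d. cmod (\<eta> i) \<le> B" "b \<eta> \<noteq> 0" for \<eta>
    proof -
      define q' where "q' = smult (1 / b \<eta>) (slice q \<eta>)"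
      have dq: "degree (slice q \<eta>) = D"
      proof (rule antisym)
        show "degree (slice q \<eta>) \<le> D" unfolding D_def by (rule degree_slice_le)
        show "D \<le> degree (slice q \<eta>)" by (rule le_degree) (use \<eta>(2) in \<open>simp add: D_def b_def\<close>)
      qed
      have q': "degree q' = D" "lead_coeff q' = 1"
        using \<eta>(2) dq by (auto simp: q'_def D_def b_def)
      have "cmod t \<le> \<rho>" if "poly q' t = 0" for t
      proof -
        have "pev q \<eta> t = 0" using that \<eta>(2) by (simp add: q'_def)
        then have "(b \<eta>) ^ k * pev p \<eta> t = 0"
          using arg_cong[OF ksr(3), of "\<lambda>P. pev P \<eta> t"] r0 by (simp add: power_fun_apply)
        then have "poly (slice p \<eta>) t = 0" using \<eta>(2) by simp
        from monic_root_bound[OF slice_monic(2)[OF p(2)] this]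
        have "cmod t \<le> 1 + (\<Sum>i<degree p. cmod (poly.coeff p i \<eta>))"
          using slice_monic(1)[OF p(2), of \<eta>] by simp
        also have "\<dots> \<le> \<rho>" unfolding \<rho>_def using C(2)[OF \<eta>(1)] by (intro add_mono sum_mono) auto
        finally show ?thesis .
      qed
      moreover have "\<rho> \<ge> 0" unfolding \<rho>_def using C(1) by (intro add_nonneg_nonneg sum_nonneg) (auto intro: less_imp_le)
      ultimately have "cmod (poly.coeff q' j) \<le> (1 + \<rho>) ^ D" using monic_coeff_bound[OF q'(2)] q'(1) by metis
      moreover have "cmod (poly.coeff q j \<eta>) = cmod (poly.coeff q' j) * cmod (b \<eta>)"
        using \<eta>(2) by (simp add: q'_def norm_divide)
      ultimately show ?thesis by (simp add: mult_right_mono)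
    qed
    then show ?thesis by blast
  qed
  have "\<exists>c\<in>polyfun {..<d}. poly.coeff q j = b * c" for j
    using polyfun_dvd_of_bounded_quotient[OF b polyfun_polyD[OF qp(1)] bound] .
  then obtain c where c: "\<And>j. c j \<in> polyfun {..<d}" "\<And>j. poly.coeff q j = b * c j" by metis
  define \<mu> where "\<mu> = (\<Sum>j<D. Polynomial.monom (c j) j) + Polynomial.monom 1 D"
  have co: "poly.coeff \<mu> j = (if j < D then c j else if j = D then 1 else 0)" for j
  proof -
    have "poly.coeff \<mu> j = (\<Sum>i<D. if i = j then c i else 0) + (if j = D then 1 else 0)"
      unfolding \<mu>_def by (simp add: coeff_sum coeff_monom eq_commute[of D j] cong: if_cong)
    then show ?thesis by simp
  qed
  have deg: "degree \<mu> = D"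
  proof (rule antisym)
    show "degree \<mu> \<le> D" by (rule degree_le) (simp add: co)
    show "D \<le> degree \<mu>" by (rule le_degree) (simp add: co)
  qed
  have \<mu>p: "\<mu> \<in> polyfun_poly {..<d}" using c(1) by (intro polyfun_polyI) (simp add: co)
  have "smult b \<mu> = q"
  proof (rule poly_eqI)
    fix j
    consider "j < D" | "j = D" | "j > D" by linarith
    then show "poly.coeff (smult b \<mu>) j = poly.coeff q j"
    proof cases
      case 1
      then show ?thesis by (simp add: co c(2))
    next
      case 2
      then show ?thesis by (simp add: co b_def D_def)
    next
      case 3
      then show ?thesis by (simp add: co D_def coeff_eq_0)
    qed
  qed
  then have "psubst y b * pev_at y g \<mu> \<in> J" using qp(2) by (metis pev_at_simps(6))
  moreover have "psubst y b \<notin> J" using y_indep[OF b(1)] b(2) by blast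
  moreover have "pev_at y g \<mu> \<in> polyfun V" by (rule pev_at_polyfun[OF \<mu>p _ g]) (simp add: y_V)
  ultimately have \<mu>J: "pev_at y g \<mu> \<in> J" using J_prime[OF yb[OF b(1)]] by blast
  have lead: "lead_coeff \<mu> = 1" by (simp add: deg co)
  have "D \<noteq> 0"
  proof
    assume "D = 0"
    then have "\<mu> = 1" using degree_0_monic[OF lead] deg by simp
    then show False using \<mu>J J_proper by (simp add: pev_at_simps)
  qed
  moreover have "degree \<mu> \<le> degree P" if "P \<in> polyfun_poly {..<d}" "pev_at y g P \<in> J" "P \<noteq> 0" for P
    using q(3)[of P] that unfolding deg D_def K_def by blast
  ultimately show ?thesis using \<mu>p lead deg \<mu>J unfolding is_min_poly_def by blast
qed

lemma min_poly_dvd: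
  assumes "is_min_poly g \<mu>" "g \<in> polyfun V" "P \<in> polyfun_poly {..<d}" "pev_at y g P \<in> J"
  shows "\<exists>s. P = \<mu> * s"
proof -
  have \<mu>: "\<mu> \<in> polyfun_poly {..<d}" "lead_coeff \<mu> = 1" "pev_at y g \<mu> \<in> J"
    "\<And>P. P \<in> polyfun_poly {..<d} \<Longrightarrow> pev_at y g P \<in> J \<Longrightarrow> P \<noteq> 0 \<Longrightarrow> degree \<mu> \<le> degree P"
    using assms(1) unfolding is_min_poly_def by blast+
  obtain s r where sr: "s \<in> polyfun_poly {..<d}" "r \<in> polyfun_poly {..<d}"
    "P = \<mu> * s + r" "r = 0 \<or> degree r < degree \<mu>" using monic_division[OF \<mu>(1,2) assms(3)] by blast
  have "pev_at y g r = pev_at y g P - pev_at y g s * pev_at y g \<mu>"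
    using arg_cong[OF sr(3), of "pev_at y g"] by (simp add: pev_at_simps mult.commute)
  also have "\<dots> \<in> J"
    by (intro J_diff J_mult assms(4) \<mu>(3) pev_at_polyfun[OF sr(1)]) (use y_V assms(2) in auto)
  finally have "r = 0" using sr(2,4) \<mu>(4)[of r] by (meson not_le)
  then show ?thesis using sr(3) by auto
qed

end

section \<open>Moving points of a variety\<close>

lemma zeros_restrict:
  assumes "J \<subseteq> polyfun V" "x \<in> zeros J"
  shows "restrict x V \<in> zeros J"
proof -
  have "p (restrict x V) = 0" if "p \<in> J" for p
  proof -
    have "p (restrict x V) = p x" using that assms(1) by (intro polyfun_cong[of p V]) auto
    then show ?thesis using that assms(2) by (simp add: zeros_def)
  qed
  then show ?thesis by (simp add: zeros_def)
qed

text \<open>Newton interpolation at distinct natural numbers: these are at distance at least \<open>1\<close> from each other,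
  so passing to a divided difference at most doubles a bound on the values.\<close>

lemma interpolation_bound:
  fixes w :: "complex poly"
  assumes "\<And>i. i \<ge> n \<Longrightarrow> poly.coeff w i = 0" "T \<subseteq> {..Q}" "card T = n"
    "\<And>q. q \<in> T \<Longrightarrow> cmod (poly w (of_nat q)) \<le> \<epsilon>" "\<epsilon> \<ge> 0"
  shows "cmod (poly.coeff w i) \<le> (2 * real Q + 4) ^ n * \<epsilon>"
  using assms
proof (induction n arbitrary: w T \<epsilon> i)
  case 0
  then show ?case by simp
next
  case (Suc n)
  have "finite T" using Suc.prems(2) finite_subset by blast
  obtain t where t: "t \<in> T" using Suc.prems(3) by (metis card.empty ex_in_conv nat.distinct(1))
  define w' where "w' = synthetic_div w (of_nat t)"
  have w: "w = [:- of_nat t, 1:] * w' + [:poly w (of_nat t):]"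
    unfolding w'_def by (rule synthetic_div_correct'[symmetric])
  have deg: "poly.coeff w' i = 0" if "i \<ge> n" for i
  proof (cases "degree w = 0")
    case True
    then have "w' = 0" unfolding w'_def by (simp add: synthetic_div_eq_0_iff)
    then show ?thesis by simp
  next
    case False
    have "degree w \<le> n" using Suc.prems(1) by (intro degree_le) auto
    then have "degree w' < n" using False unfolding w'_def degree_synthetic_div by linarith
    then show ?thesis using that by (intro coeff_eq_0) simp
  qed
  have val: "cmod (poly w' (of_nat q)) \<le> 2 * \<epsilon>" if q: "q \<in> T - {t}" for q
  proof -
    have "poly w (of_nat q) = (of_nat q - of_nat t) * poly w' (of_nat q) + poly w (of_nat t)"
      by (subst w) (simp add: algebra_simps)
    then have "cmod (of_nat q - of_nat t) * cmod (poly w' (of_nat q)) = cmod (poly w (of_nat q) - poly w (of_nat t))"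
      by (simp add: norm_mult)
    also have "\<dots> \<le> \<epsilon> + \<epsilon>" using q t Suc.prems(4) by (intro order.trans[OF norm_triangle_ineq4] add_mono) auto
    finally have *: "cmod (of_nat q - of_nat t) * cmod (poly w' (of_nat q)) \<le> 2 * \<epsilon>" by simp
    have "(of_nat q - of_nat t :: complex) = of_int (int q - int t)" by simp
    then have "cmod (of_nat q - of_nat t) = of_int \<bar>int q - int t\<bar>" by (metis norm_of_int of_int_abs)
    moreover have "\<bar>int q - int t\<bar> \<ge> 1" using q by auto
    ultimately have "cmod (of_nat q - of_nat t) \<ge> 1" by simp
    then have "1 * cmod (poly w' (of_nat q)) \<le> cmod (of_nat q - of_nat t) * cmod (poly w' (of_nat q))"
      by (intro mult_right_mono) auto
    then show ?thesis using * by simp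
  qed
  have IH: "cmod (poly.coeff w' i) \<le> (2 * real Q + 4) ^ n * (2 * \<epsilon>)" for i
    using Suc.IH[OF deg, of "T - {t}" "2 * \<epsilon>"] Suc.prems(2,3,5) val t \<open>finite T\<close> by auto
  have tQ: "real t \<le> real Q" using t Suc.prems(2) by auto
  have X: "(2 * real Q + 4) ^ n \<ge> 1" by (intro one_le_power) simp
  have "poly.coeff w i = (- of_nat t * poly.coeff w' i) + ((if i = 0 then 0 else poly.coeff w' (i - 1)) + (if i = 0 then poly w (of_nat t) else 0))"
    by (subst w) (cases i; simp)
  also have "cmod \<dots> \<le> cmod (- of_nat t * poly.coeff w' i) + (cmod (if i = 0 then 0 else poly.coeff w' (i - 1)) + cmod (if i = 0 then poly w (of_nat t) else 0))"
    by (intro order.trans[OF norm_triangle_ineq] add_left_mono norm_triangle_ineq)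
  also have "\<dots> \<le> real Q * ((2 * real Q + 4) ^ n * (2 * \<epsilon>)) + ((2 * real Q + 4) ^ n * (2 * \<epsilon>) + \<epsilon>)"
    using IH tQ Suc.prems(4)[OF t] Suc.prems(5)
    by (intro add_mono) (auto simp: norm_mult intro!: mult_mono)
  also have "\<dots> \<le> real Q * ((2 * real Q + 4) ^ n * (2 * \<epsilon>)) + ((2 * real Q + 4) ^ n * (2 * \<epsilon>) + 2 * (2 * real Q + 4) ^ n * \<epsilon>)"
    using mult_right_mono[OF X Suc.prems(5)] Suc.prems(5) by (intro add_left_mono) simp
  also have "\<dots> = (2 * real Q + 4) ^ Suc n * \<epsilon>" by (simp add: algebra_simps)
  finally show ?case .
qed

lemma pigeonhole_fibre:
  assumes "finite A" "finite B" "f ` A \<subseteq> B" "card B * M < card A"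
  shows "\<exists>b\<in>B. M < card {a \<in> A. f a = b}"
proof (rule ccontr)
  assume *: "\<not> ?thesis"
  have "card A = (\<Sum>b\<in>B. card {a \<in> A. f a = b})"
    using sum.group[OF assms(1,2,3), of "\<lambda>_. 1::nat"] by (simp only: card_eq_sum)
  also have "\<dots> \<le> (\<Sum>b\<in>B. M)" using * by (intro sum_mono) (meson not_le)
  also have "\<dots> = card B * M" by simp
  finally show False using assms(4) by linarith
qed

text \<open>On a line through \<open>\<eta>\<close> in a direction where the top forms \<open>h p\<close> of all \<open>p \<in> Q\<close> are nonzero, every \<open>p\<close> is
  a polynomial in one variable whose degree and leading coefficient do not depend on \<open>\<eta>\<close>. A point of the
  line whose distance from all the roots is comparable to \<open>r\<close> has the required property. The exponent
  \<open>c p\<close> is the degree of \<open>p\<close> plus one, the additional factor \<open>r\<close> absorbing all constants. That it does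
  not depend on \<open>Q\<close> is essential: it becomes a bound on the values of a valuation.\<close>

lemma polyfun_generic_perturbation:
  fixes d :: nat
  shows "\<exists>c :: ((nat \<Rightarrow> complex) \<Rightarrow> complex) \<Rightarrow> nat. \<forall>Q. finite Q \<longrightarrow> (\<forall>p\<in>Q. p \<in> polyfun {..<d} \<and> p \<noteq> 0) \<longrightarrow>
    (\<exists>r0>0. \<forall>r \<eta>. 0 < r \<longrightarrow> r < r0 \<longrightarrow>
      (\<exists>\<eta>'. (\<forall>i<d. cmod (\<eta>' i - \<eta> i) \<le> r) \<and> (\<forall>p\<in>Q. cmod (p \<eta>') \<ge> r ^ c p)))"
proof -
  define top where "top = (\<lambda>p D h. h \<in> polyfun {..<d} \<and> h \<noteq> 0 \<and>
    (\<forall>a v. \<exists>P. (\<forall>s. p (\<lambda>i. a i + s * v i) = poly P s) \<and> degree P \<le> D \<and> poly.coeff P D = h v))"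
  have "\<exists>D h. top p D h" if "p \<in> polyfun {..<d} - {0}" for p
    using polyfun_top_form[of p "{..<d}"] that unfolding top_def by blast
  then obtain D h where "\<And>p. p \<in> polyfun {..<d} - {0} \<Longrightarrow> top p (D p) (h p)" by metis
  note Dh = this[unfolded top_def]
  have "\<exists>r0>0. \<forall>r \<eta>. 0 < r \<longrightarrow> r < r0 \<longrightarrow>
      (\<exists>\<eta>'. (\<forall>i<d. cmod (\<eta>' i - \<eta> i) \<le> r) \<and> (\<forall>p\<in>Q. cmod (p \<eta>') \<ge> r ^ Suc (D p)))"
    if Q: "finite Q" "\<forall>p\<in>Q. p \<in> polyfun {..<d} \<and> p \<noteq> 0" for Q
  proof -
    have Q': "p \<in> polyfun {..<d} - {0}" if "p \<in> Q" for p using Q(2) that by simp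
    have "\<exists>v. \<forall>g\<in>h ` Q. g v \<noteq> 0"
      by (rule polyfun_common_nonzero) (use Q(1) Dh[OF Q'] in auto)
    then obtain v where v: "\<And>p. p \<in> Q \<Longrightarrow> h p v \<noteq> 0" by auto
    define R where "R = 1 + (\<Sum>i<d. cmod (v i))"
    define n where "n = (\<Sum>p\<in>Q. D p)"
    define \<kappa> where "\<kappa> = 1 / (2 * R * (real n + 1))"
    have R: "R \<ge> 1" by (simp add: R_def sum_nonneg)
    have \<kappa>: "\<kappa> > 0" using R by (simp add: \<kappa>_def)
    define r0 where "r0 = Min (insert 1 ((\<lambda>p. cmod (h p v) * \<kappa> ^ D p) ` Q))"
    have r0: "r0 > 0" "\<And>p. p \<in> Q \<Longrightarrow> r0 \<le> cmod (h p v) * \<kappa> ^ D p"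
      using Q(1) v \<kappa> by (auto simp: r0_def)
    have "\<exists>\<eta>'. (\<forall>i<d. cmod (\<eta>' i - \<eta> i) \<le> r) \<and> (\<forall>p\<in>Q. cmod (p \<eta>') \<ge> r ^ Suc (D p))"
      if r: "0 < r" "r < r0" for r \<eta>
    proof -
      have "\<forall>p\<in>Q. \<exists>P. (\<forall>s. p (\<lambda>i. \<eta> i + s * v i) = poly P s) \<and> degree P \<le> D p \<and> poly.coeff P (D p) = h p v"
        using Dh[OF Q'] by blast
      then obtain P where P: "\<And>p s. p \<in> Q \<Longrightarrow> p (\<lambda>i. \<eta> i + s * v i) = poly (P p) s"
        "\<And>p. p \<in> Q \<Longrightarrow> degree (P p) \<le> D p" "\<And>p. p \<in> Q \<Longrightarrow> poly.coeff (P p) (D p) = h p v" by metis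
      have dP: "degree (P p) = D p" "P p \<noteq> 0" if "p \<in> Q" for p
        using P(2,3)[OF that] v[OF that] le_degree[of "P p" "D p"] by auto
      define Z where "Z = (\<Union>p\<in>Q. {z. poly (P p) z = 0})"
      have finZ: "finite Z" unfolding Z_def using Q(1) dP(2) poly_roots_finite by blast
      have "card Z \<le> (\<Sum>p\<in>Q. card {z. poly (P p) z = 0})" unfolding Z_def by (rule card_UN_le[OF Q(1)])
      also have "\<dots> \<le> n" unfolding n_def
        by (intro sum_mono) (use dP card_poly_roots_bound in metis)
      finally have cardZ: "card Z \<le> n" .
      \<comment> \<open>of \<open>n + 1\<close> points spaced by \<open>H\<close>, one keeps the distance \<open>H / 2\<close> from the at most \<open>n\<close> roots\<close>
      define H where "H = r / (R * (real n + 1))"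
      have H: "H > 0" using r R by (simp add: H_def)
      have "\<exists>j\<le>n. \<forall>z\<in>Z. cmod (of_real (real j * H) - z) \<ge> H / 2"
      proof (rule ccontr)
        assume "\<not> ?thesis"
        then have "\<forall>j\<in>{..n}. \<exists>z\<in>Z. cmod (of_real (real j * H) - z) < H / 2" by (meson atMost_iff not_le)
        then obtain z where z: "\<And>j. j \<in> {..n} \<Longrightarrow> z j \<in> Z \<and> cmod (of_real (real j * H) - z j) < H / 2" by metis
        have "inj_on z {..n}"
        proof (rule inj_onI, rule ccontr)
          fix i j assume ij: "i \<in> {..n}" "j \<in> {..n}" "z i = z j" "i \<noteq> j"
          have "cmod (of_real (real i * H) - of_real (real j * H)) \<le> cmod (of_real (real i * H) - z i) + cmod (of_real (real j * H) - z j)"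
            using norm_triangle_ineq4[of "of_real (real i * H) - z i" "of_real (real j * H) - z j"] ij(3) by simp
          also have "\<dots> < H / 2 + H / 2"
            using conjunct2[OF z[OF ij(1)]] conjunct2[OF z[OF ij(2)]] by (rule add_strict_mono)
          finally have "cmod (of_real (real i * H) - of_real (real j * H)) < H" by simp
          moreover have "cmod (of_real (real i * H) - of_real (real j * H)) = \<bar>real i - real j\<bar> * H"
            using H by (metis abs_mult abs_of_pos left_diff_distrib norm_of_real of_real_diff)
          ultimately have "\<bar>real i - real j\<bar> < 1" using H by simp
          then show False using ij(4) by linarith
        qed
        moreover have "z ` {..n} \<subseteq> Z" using z by blast
        ultimately have "card {..n} \<le> card Z" using finZ by (metis card_inj_on_le)
        then show False using cardZ by simp
      qed
      then obtain j where j: "j \<le> n" "\<And>z. z \<in> Z \<Longrightarrow> cmod (of_real (real j * H) - z) \<ge> H / 2" by blast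
      define s where "s = complex_of_real (real j * H)"
      have s: "cmod s \<le> r / R"
      proof -
        have "cmod s = real j * H" using H by (simp add: s_def norm_mult)
        also have "\<dots> \<le> (real n + 1) * H" using j(1) H by (intro mult_right_mono) auto
        also have "\<dots> = r / R" using R by (simp add: H_def)
        finally show ?thesis .
      qed
      have "cmod (p (\<lambda>i. \<eta> i + s * v i)) \<ge> r ^ Suc (D p)" if p: "p \<in> Q" for p
      proof -
        have "cmod (h p v) * (H / 2) ^ D p \<le> cmod (poly (P p) s)"
        proof (cases "D p = 0")
          case True
          then have "P p = [:h p v:]" using dP(1)[OF p] P(3)[OF p] by (metis degree_eq_zeroE coeff_pCons_0)
          then show ?thesis using True by simp
        next
          case False
          define P' where "P' = smult (1 / h p v) (P p)"
          have "degree P' = D p" "lead_coeff P' = 1" using dP(1)[OF p] P(3)[OF p] v[OF p] by (auto simp: P'_def)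
          then obtain t where t: "poly P' t = 0" "cmod (s - t) ^ D p \<le> cmod (poly P' s)"
            using near_root[of P' s] False by auto
          have "t \<in> Z" using t(1) p v[OF p] by (auto simp: Z_def P'_def)
          then have "(H / 2) ^ D p \<le> cmod (s - t) ^ D p" using j(2) H unfolding s_def by (intro power_mono) auto
          also have "\<dots> \<le> cmod (poly P' s)" by (rule t(2))
          also have "\<dots> = cmod (poly (P p) s) / cmod (h p v)" by (simp add: P'_def norm_divide)
          finally show ?thesis using v[OF p] by (simp add: field_simps)
        qed
        moreover have "H / 2 = \<kappa> * r" by (simp add: H_def \<kappa>_def)
        moreover have "r * r ^ D p \<le> (cmod (h p v) * \<kappa> ^ D p) * r ^ D p"
          using r r0(2)[OF p] by (intro mult_right_mono) auto
        ultimately show ?thesis using P(1)[OF p] by (simp add: power_mult_distrib mult.assoc)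
      qed
      moreover have "cmod ((\<eta> i + s * v i) - \<eta> i) \<le> r" if "i < d" for i
      proof -
        have "cmod (v i) \<le> (\<Sum>i<d. cmod (v i))" using that by (intro member_le_sum) auto
        then have "cmod (v i) \<le> R" by (simp add: R_def)
        then have "cmod s * cmod (v i) \<le> (r / R) * R" using s r R by (intro mult_mono) auto
        then show ?thesis using R by (simp add: norm_mult)
      qed
      ultimately show ?thesis by (intro exI[of _ "\<lambda>i. \<eta> i + s * v i"]) blast
    qed
    then show ?thesis using r0(1) by blast
  qed
  then show ?thesis by (intro exI[of _ "\<lambda>p. Suc (D p)"]) blast
qed

text \<open>All relations between \<open>y\<close> and \<open>g\<close> are multiples of the minimal polynomial, so a root of it yields a
  consistent value of \<open>g\<close>.\<close>

lemma lift_root: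
  fixes N :: nat
  assumes "noether_prime {..<N} J d y" and g: "g \<in> polyfun {..<N}"
    and \<mu>: "noether_prime.is_min_poly J d y g \<mu>" and root: "pev \<mu> \<eta> \<tau> = 0"
  shows "\<exists>x\<in>zeros J. (\<forall>i<d. y i x = \<eta> i) \<and> g x = \<tau>"
proof -
  interpret noether_prime "{..<N}" J d y by fact
  have \<mu>': "\<mu> \<in> polyfun_poly {..<d}" using \<mu> by (simp add: is_min_poly_def)
  let ?w = "y(d := g)" and ?\<xi> = "\<eta>(d := \<tau>)"
  have con: "consistent (Suc d) ?w ?\<xi>"
    unfolding consistent_def
  proof (intro ballI impI)
    fix u assume u: "u \<in> polyfun {..<Suc d}" "psubst ?w u \<in> J"
    obtain U where U: "U \<in> polyfun_poly {..<d}" "\<And>x. u x = pev U x (x d)"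
      using polyfun_Suc_poly[OF u(1)] by blast
    have "psubst ?w u = pev_at y g U"
    proof
      fix x
      have "psubst ?w u x = pev U (\<lambda>i. ?w i x) (g x)"
        unfolding psubst_def by (subst U(2)) simp
      also have "\<dots> = pev U (\<lambda>i. y i x) (g x)" by (rule pev_cong[OF U(1)]) simp
      finally show "psubst ?w u x = pev_at y g U x" by (simp only: pev_at_def)
    qed
    then have "pev_at y g U \<in> J" using u(2) by simp
    then obtain s where s: "U = \<mu> * s" using min_poly_dvd[OF \<mu> g U(1)] by blast
    have "u ?\<xi> = pev U ?\<xi> \<tau>" by (subst U(2)) simp
    also have "\<dots> = pev U \<eta> \<tau>" by (rule pev_cong[OF U(1)]) simp
    also have "\<dots> = 0" by (simp add: s root)
    finally show "u ?\<xi> = 0" .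
  qed
  have int: "\<exists>P\<in>polyfun_poly {..<Suc d}. lead_coeff P = 1 \<and> pev_at ?w h P \<in> J" if h: "h \<in> polyfun {..<N}" for h
  proof -
    obtain P where P: "P \<in> polyfun_poly {..<d}" "lead_coeff P = 1" "pev_at y h P \<in> J"
      using y_integral[OF h] by blast
    have "P \<in> polyfun_poly {..<Suc d}"
      using polyfun_mono[of "{..<d}" "{..<Suc d}"] polyfun_polyD[OF P(1)] by (auto simp: polyfun_poly_def)
    moreover have "pev_at ?w h P = pev_at y h P"
      unfolding pev_at_def by (intro ext pev_cong[OF P(1)]) auto
    ultimately show ?thesis using P(2,3) by metis
  qed
  have w: "?w i \<in> polyfun {..<N}" if "i < Suc d" for i using that g y_V by (cases "i = d") auto
  obtain x where x: "x \<in> zeros J" "\<forall>i<Suc d. ?w i x = ?\<xi> i"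
    using lift_point[OF poly_ideal_axioms w con int] by blast
  have "g x = \<tau>" using x(2)[rule_format, of d] by simp
  moreover have "y i x = \<eta> i" if "i < d" for i using x(2)[rule_format, of i] that by simp
  ultimately show ?thesis using x(1) by blast
qed

text \<open>On a fibre every coordinate is a root of a fixed monic polynomial. Restricting points to their first
  \<open>N\<close> coordinates is needed for finiteness, as polynomial functions do not see the others.\<close>

lemma finite_fibres:
  fixes N :: nat
  assumes "noether {..<N} J d y"
  shows "\<exists>K. \<forall>\<eta>. finite {x \<in> zeros J \<inter> extensional {..<N}. \<forall>i<d. y i x = \<eta> i} \<and>
    card {x \<in> zeros J \<inter> extensional {..<N}. \<forall>i<d. y i x = \<eta> i} \<le> K"
proof -
  interpret noether "{..<N}" J d y by fact
  have "\<forall>i<N. \<exists>P. P \<in> polyfun_poly {..<d} \<and> lead_coeff P = 1 \<and> pev_at y (\<lambda>x. x i) P \<in> J"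
    using y_integral polyfun.var by (metis lessThan_iff)
  then obtain P where P: "\<And>i. i < N \<Longrightarrow> P i \<in> polyfun_poly {..<d}" "\<And>i. i < N \<Longrightarrow> lead_coeff (P i) = 1"
    "\<And>i. i < N \<Longrightarrow> pev_at y (\<lambda>x. x i) (P i) \<in> J" by metis
  have "finite {x \<in> zeros J \<inter> extensional {..<N}. \<forall>i<d. y i x = \<eta> i} \<and>
    card {x \<in> zeros J \<inter> extensional {..<N}. \<forall>i<d. y i x = \<eta> i} \<le> (\<Prod>i<N. degree (P i))" for \<eta>
  proof -
    define F where "F = {x \<in> zeros J \<inter> extensional {..<N}. \<forall>i<d. y i x = \<eta> i}"
    define R where "R = (\<lambda>i. {t. poly (slice (P i) \<eta>) t = 0})"
    have R: "finite (R i)" "card (R i) \<le> degree (P i)" if "i < N" for i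
      using slice_monic[OF P(2)[OF that], of \<eta>] poly_roots_finite[of "slice (P i) \<eta>"]
        card_poly_roots_bound[of "slice (P i) \<eta>"] unfolding R_def by (metis, metis)
    have "F \<subseteq> PiE {..<N} R"
    proof
      fix x assume x: "x \<in> F"
      have "x i \<in> R i" if "i < N" for i
      proof -
        have "pev (P i) (\<lambda>i. y i x) (x i) = 0"
          using P(3)[OF that] x by (auto simp: F_def zeros_def pev_at_def)
        moreover have "pev (P i) (\<lambda>i. y i x) (x i) = pev (P i) \<eta> (x i)"
          by (rule pev_cong[OF P(1)[OF that]]) (use x in \<open>simp add: F_def\<close>)
        ultimately show ?thesis by (simp add: R_def)
      qed
      then show "x \<in> PiE {..<N} R" using x by (simp add: F_def PiE_iff)
    qed
    moreover have "finite (PiE {..<N} R)" using R(1) by (intro finite_PiE) auto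
    moreover have "card (PiE {..<N} R) \<le> (\<Prod>i<N. degree (P i))"
      unfolding card_PiE[OF finite_lessThan] by (intro prod_mono) (simp add: R(2))
    ultimately show ?thesis unfolding F_def[symmetric] by (meson card_mono finite_subset order_trans)
  qed
  then show ?thesis by blast
qed

lemma polyfun_finite_bound:
  assumes "finite S" "\<And>i. i \<in> S \<Longrightarrow> p i \<in> polyfun V"
  shows "\<exists>C>0. \<forall>x. (\<forall>j\<in>V. cmod (x j) \<le> B) \<longrightarrow> (\<forall>i\<in>S. cmod (p i x) \<le> C)"
proof -
  have "\<forall>i\<in>S. \<exists>C>0. \<forall>x. (\<forall>j\<in>V. cmod (x j) \<le> B) \<longrightarrow> cmod (p i x) \<le> C"
    using polyfun_bounded assms(2) by blast
  then obtain C where C: "\<And>i. i \<in> S \<Longrightarrow> C i > 0"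
    "\<And>i x. i \<in> S \<Longrightarrow> (\<forall>j\<in>V. cmod (x j) \<le> B) \<Longrightarrow> cmod (p i x) \<le> C i" by metis
  have "C i \<le> (\<Sum>i\<in>S. C i)" if "i \<in> S" for i
    using that C(1) assms(1) by (intro member_le_sum) (auto intro: less_imp_le)
  then have "cmod (p i x) \<le> 1 + (\<Sum>i\<in>S. C i)" if "\<forall>j\<in>V. cmod (x j) \<le> B" "i \<in> S" for i x
    using C(2)[OF that(2,1)] that(2) by (smt (verit))
  moreover have "1 + (\<Sum>i\<in>S. C i) > 0" using C(1) by (intro add_pos_nonneg sum_nonneg) (auto intro: less_imp_le)
  ultimately show ?thesis by blast
qed

text \<open>Let \<open>x\<close> be given and move its projection to a nearby point \<open>\<eta>\<close>. For any polynomial function \<open>g\<close>, the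
  minimal polynomial of \<open>g\<close> over \<open>\<eta>\<close> is small at \<open>g x\<close>, so it has a root near \<open>g x\<close>, and \<open>g\<close> attains
  this root at a point of the fibre over \<open>\<eta>\<close>. The point found depends on \<open>g\<close> and need not be close to
  \<open>x\<close>. This is done for \<open>K N + 1\<close> linear forms \<open>g q\<close>, where \<open>K\<close> bounds the size of the fibres. Then
  some point \<open>x'\<close> of the fibre is found for more than \<open>N\<close> of them, and the values of \<open>N\<close> of these
  forms control all the coordinates of \<open>x' - x\<close> by \<open>interpolation_bound\<close>.\<close>

lemma open_projection:
  fixes N :: nat
  assumes "noether_prime {..<N} J d y"
  shows "\<exists>C>0. \<exists>D>0. \<forall>x\<in>zeros J. \<forall>\<eta> s. (\<forall>i<N. cmod (x i) \<le> B) \<longrightarrow> 0 < s \<longrightarrow> s \<le> 1 \<longrightarrow>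
    (\<forall>i<d. cmod (\<eta> i - y i x) \<le> s ^ D) \<longrightarrow>
    (\<exists>x'\<in>zeros J. (\<forall>i<d. y i x' = \<eta> i) \<and> (\<forall>i<N. cmod (x' i - x i) \<le> C * s))"
proof -
  interpret noether_prime "{..<N}" J d y by fact
  obtain K where K: "\<And>\<eta>. finite {x \<in> zeros J \<inter> extensional {..<N}. \<forall>i<d. y i x = \<eta> i}"
    "\<And>\<eta>. card {x \<in> zeros J \<inter> extensional {..<N}. \<forall>i<d. y i x = \<eta> i} \<le> K"
    using finite_fibres[OF noether_axioms] by blast
  define Q where "Q = K * N"
  define g :: "nat \<Rightarrow> (nat \<Rightarrow> complex) \<Rightarrow> complex" where "g = (\<lambda>q. \<Sum>i<N. (\<lambda>_. of_nat q ^ i) * (\<lambda>x. x i))"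
  have g_app: "g q x = (\<Sum>i<N. of_nat q ^ i * x i)" for q x
    by (simp add: g_def sum_fun_apply pointwise)
  have g: "g q \<in> polyfun {..<N}" for q
    unfolding g_def by (intro polyfun_sum polyfun.mult polyfun.const polyfun.var) simp
  obtain \<mu> where \<mu>: "\<And>q. is_min_poly (g q) (\<mu> q)" using min_poly_exists[OF g] by metis
  have \<mu>P: "\<mu> q \<in> polyfun_poly {..<d}" "lead_coeff (\<mu> q) = 1" "degree (\<mu> q) \<noteq> 0" "pev_at y (g q) (\<mu> q) \<in> J" for q
    using \<mu>[of q] unfolding is_min_poly_def by auto
  define D where "D = (\<Sum>q\<le>Q. degree (\<mu> q))"
  have D: "degree (\<mu> q) \<le> D" if "q \<le> Q" for q
    unfolding D_def using that by (intro member_le_sum) auto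
  have D0: "D > 0" using D[of 0] \<mu>P(3)[of 0] by simp
  obtain B1 where B1: "B1 > 0" "\<And>x i. (\<forall>j<N. cmod (x j) \<le> B) \<Longrightarrow> i < d \<Longrightarrow> cmod (y i x) \<le> B1"
    using polyfun_finite_bound[of "{..<d}" y "{..<N}" B] y_V by auto
  obtain B2 where B2: "B2 > 0" "\<And>x q. (\<forall>j<N. cmod (x j) \<le> B) \<Longrightarrow> q \<le> Q \<Longrightarrow> cmod (g q x) \<le> B2"
    using polyfun_finite_bound[of "{..Q}" g "{..<N}" B] g by auto
  define B3 where "B3 = B1 + B2 + 1"
  \<comment> \<open>the minimal polynomial as a polynomial function, the variable being the coordinate \<open>d\<close>\<close>
  define u where "u = (\<lambda>q (x::nat \<Rightarrow> complex). pev (\<mu> q) x (x d))"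
  have u: "u q \<in> polyfun {..<Suc d}" for q
    unfolding u_def using pev_polyfun[OF \<mu>P(1)[of q], of "\<lambda>i x. x i" "{..<Suc d}" "\<lambda>x. x d"]
    by (simp add: polyfun.var)
  have "\<forall>q. \<exists>L>0. \<forall>x x' e. e \<ge> 0 \<longrightarrow>
    (\<forall>i\<in>{..<Suc d}. cmod (x i) \<le> B3 \<and> cmod (x' i) \<le> B3 \<and> cmod (x i - x' i) \<le> e) \<longrightarrow> cmod (u q x - u q x') \<le> L * e"
    using polyfun_lipschitz[OF u] by blast
  then obtain L where L: "\<And>q. L q > 0" "\<And>q x x' e. e \<ge> 0 \<Longrightarrow>
    (\<forall>i\<in>{..<Suc d}. cmod (x i) \<le> B3 \<and> cmod (x' i) \<le> B3 \<and> cmod (x i - x' i) \<le> e) \<Longrightarrow> cmod (u q x - u q x') \<le> L q * e"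
    by metis
  define L' where "L' = 1 + (\<Sum>q\<le>Q. L q)"
  have L': "L' \<ge> 1" "\<And>q. q \<le> Q \<Longrightarrow> L q \<le> L'"
  proof -
    show "L' \<ge> 1" unfolding L'_def using L(1) by (simp add: sum_nonneg less_imp_le)
    fix q assume "q \<le> Q"
    then have "L q \<le> (\<Sum>q\<le>Q. L q)" using L(1) by (intro member_le_sum) (auto intro: less_imp_le)
    then show "L q \<le> L'" by (simp add: L'_def)
  qed
  define C where "C = (2 * real Q + 4) ^ N * L'"
  have C: "C > 0" unfolding C_def using L'(1) by (intro mult_pos_pos zero_less_power) auto
  have "\<exists>x'\<in>zeros J. (\<forall>i<d. y i x' = \<eta> i) \<and> (\<forall>i<N. cmod (x' i - x i) \<le> C * s)"
    if x: "x \<in> zeros J" "\<forall>i<N. cmod (x i) \<le> B" and s: "0 < s" "s \<le> 1"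
      and \<eta>: "\<forall>i<d. cmod (\<eta> i - y i x) \<le> s ^ D" for x \<eta> s
  proof -
    define F where "F = {x \<in> zeros J \<inter> extensional {..<N}. \<forall>i<d. y i x = \<eta> i}"
    have "\<exists>z\<in>F. cmod (g q x - g q z) \<le> L' * s" if q: "q \<le> Q" for q
    proof -
      have sD: "s ^ D \<le> 1" "s ^ D \<ge> 0" using s by (auto intro: power_le_one)
      have "cmod (u q (\<eta>(d := g q x)) - u q ((\<lambda>i. y i x)(d := g q x))) \<le> L q * s ^ D"
      proof (rule L(2)[OF sD(2)], rule ballI)
        fix i assume i: "i \<in> {..<Suc d}"
        show "cmod ((\<eta>(d := g q x)) i) \<le> B3 \<and> cmod (((\<lambda>i. y i x)(d := g q x)) i) \<le> B3 \<and>
          cmod ((\<eta>(d := g q x)) i - ((\<lambda>i. y i x)(d := g q x)) i) \<le> s ^ D"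
        proof (cases "i = d")
          case True
          then show ?thesis using B2(2)[OF x(2) q] B1(1) sD by (simp add: B3_def)
        next
          case False
          then have i: "i < d" using i by simp
          have "cmod (\<eta> i) \<le> cmod (y i x) + cmod (\<eta> i - y i x)"
            by (metis add.commute diff_add_cancel norm_triangle_ineq)
          then show ?thesis using False B1(2)[OF x(2) i] \<eta>[rule_format, OF i] B2(1) sD by (simp add: B3_def)
        qed
      qed
      moreover have "u q (\<eta>(d := g q x)) = pev (\<mu> q) \<eta> (g q x)"
        unfolding u_def fun_upd_same by (rule pev_cong[OF \<mu>P(1)]) simp
      moreover have "u q ((\<lambda>i. y i x)(d := g q x)) = 0"
      proof -
        have "u q ((\<lambda>i. y i x)(d := g q x)) = pev (\<mu> q) (\<lambda>i. y i x) (g q x)"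
          unfolding u_def fun_upd_same by (rule pev_cong[OF \<mu>P(1)]) simp
        moreover have "pev_at y (g q) (\<mu> q) x = 0" using \<mu>P(4)[of q] x(1) unfolding zeros_def by blast
        ultimately show ?thesis by (simp add: pev_at_def)
      qed
      ultimately have small: "cmod (poly (slice (\<mu> q) \<eta>) (g q x)) \<le> L q * s ^ D" by simp
      obtain \<tau> where \<tau>: "poly (slice (\<mu> q) \<eta>) \<tau> = 0"
        "cmod (g q x - \<tau>) ^ degree (\<mu> q) \<le> cmod (poly (slice (\<mu> q) \<eta>) (g q x))"
        using near_root[of "slice (\<mu> q) \<eta>" "g q x"] slice_monic[OF \<mu>P(2), of q \<eta>] \<mu>P(3)[of q] by auto
      have close: "cmod (g q x - \<tau>) \<le> L' * s"
      proof (rule ccontr)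
        assume "\<not> ?thesis"
        then have "(L' * s) ^ degree (\<mu> q) < cmod (g q x - \<tau>) ^ degree (\<mu> q)"
          using L'(1) s \<mu>P(3)[of q] by (intro power_strict_mono) auto
        also have "\<dots> \<le> L q * s ^ D" using \<tau>(2) small by simp
        also have "\<dots> \<le> L' * s ^ degree (\<mu> q)"
          using L'(1) L'(2)[OF q] s D[OF q] by (intro mult_mono power_decreasing) auto
        also have "\<dots> \<le> L' ^ degree (\<mu> q) * s ^ degree (\<mu> q)"
          using L'(1) s \<mu>P(3)[of q] by (intro mult_right_mono self_le_power) auto
        finally show False by (simp add: power_mult_distrib)
      qed
      obtain z where z: "z \<in> zeros J" "\<forall>i<d. y i z = \<eta> i" "g q z = \<tau>"
        using lift_root[OF assms g \<mu>[of q], of \<eta> \<tau>] \<tau>(1) by auto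
      have cong: "p (restrict z {..<N}) = p z" if "p \<in> polyfun {..<N}" for p
        by (rule polyfun_cong[OF that]) simp
      have "restrict z {..<N} \<in> F"
        using zeros_restrict[OF J_sub z(1)] z(2) cong[OF y_V] by (simp add: F_def)
      moreover have "g q (restrict z {..<N}) = \<tau>" using cong[OF g] z(3) by simp
      ultimately show ?thesis using close by blast
    qed
    then obtain z where z: "\<And>q. q \<le> Q \<Longrightarrow> z q \<in> F" "\<And>q. q \<le> Q \<Longrightarrow> cmod (g q x - g q (z q)) \<le> L' * s" by metis
    have finF: "finite F" "card F \<le> K" unfolding F_def using K by blast+
    have "card F * N < card {..Q}" using mult_le_mono1[OF finF(2), of N] by (simp add: Q_def less_Suc_eq_le)
    moreover have "z ` {..Q} \<subseteq> F" using z(1) by auto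
    ultimately have "\<exists>b\<in>F. N < card {q \<in> {..Q}. z q = b}"
      by (intro pigeonhole_fibre finF(1) finite_atMost)
    then obtain x' where x': "x' \<in> F" "N < card {q \<in> {..Q}. z q = x'}" ..
    obtain T where T: "T \<subseteq> {q \<in> {..Q}. z q = x'}" "card T = N" "finite T"
      by (rule obtain_subset_with_card_n[OF less_imp_le[OF x'(2)]])
    define w where "w = (\<Sum>i<N. Polynomial.monom (x i - x' i) i)"
    have cw: "poly.coeff w i = (if i < N then x i - x' i else 0)" for i
      unfolding w_def by (simp add: coeff_sum coeff_monom)
    have "cmod (poly.coeff w i) \<le> (2 * real Q + 4) ^ N * (L' * s)" for i
    proof (rule interpolation_bound[where T = T])
      show "T \<subseteq> {..Q}" using T(1) by auto
      fix q assume "q \<in> T"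
      then have q: "q \<le> Q" "z q = x'" using T(1) by auto
      have "poly w (of_nat q) = g q x - g q x'"
        by (simp add: w_def poly_sum poly_monom g_app algebra_simps sum_subtractf)
      then show "cmod (poly w (of_nat q)) \<le> L' * s" using z(2)[OF q(1)] q(2) by simp
    next
      show "poly.coeff w i = 0" if "i \<ge> N" for i using that by (simp add: cw)
      show "card T = N" by (rule T(2))
      show "L' * s \<ge> 0" using L'(1) s by simp
    qed
    then have "cmod (x' i - x i) \<le> C * s" if "i < N" for i
      using cw[of i] that by (metis C_def mult.assoc norm_minus_commute)
    then show ?thesis using x'(1) unfolding F_def by blast
  qed
  then show ?thesis using C D0 by blast
qed

locale poly_prime = poly_ideal +
  assumes prime: "p \<in> polyfun V \<Longrightarrow> q \<in> polyfun V \<Longrightarrow> p * q \<in> J \<Longrightarrow> p \<in> J \<or> q \<in> J"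

text \<open>On a bounded part of the variety, \<open>\<bar>g\<bar>\<close> is bounded below by a multiple of \<open>\<bar>b\<bar>\<close> at the projected
  point, where \<open>b\<close> is the constant term of the minimal polynomial of \<open>g\<close>. It therefore suffices to move
  the projected point in affine space so that the finitely many \<open>b\<close> are not too small there, and to
  lift this motion by \<open>open_projection\<close>.\<close>

theorem move_to_general_position:
  fixes N :: nat
  assumes "poly_prime {..<N} J"
  shows "\<exists>C>0. \<exists>D>0. \<exists>c :: ((nat \<Rightarrow> complex) \<Rightarrow> complex) \<Rightarrow> nat. \<forall>Q. finite Q \<longrightarrow> Q \<subseteq> polyfun {..<N} - J \<longrightarrow>
    (\<exists>s0>0. \<forall>s x. 0 < s \<longrightarrow> s < s0 \<longrightarrow> x \<in> zeros J \<longrightarrow> (\<forall>i<N. cmod (x i) \<le> B) \<longrightarrow>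
      (\<exists>x'\<in>zeros J. (\<forall>i<N. cmod (x' i - x i) \<le> C * s) \<and> (\<forall>g\<in>Q. cmod (g x') \<ge> (s ^ D) ^ c g)))"
proof -
  interpret poly_prime "{..<N}" J by fact
  obtain d y where "noether {..<N} J d y" using noether_normalization[OF poly_ideal_axioms] by blast
  then interpret noether "{..<N}" J d y .
  have np: "noether_prime {..<N} J d y" by unfold_locales (rule prime)
  then interpret noether_prime "{..<N}" J d y .
  obtain C D where CD: "C > 0" "D > 0" "\<And>x \<eta> s. x \<in> zeros J \<Longrightarrow> (\<forall>i<N. cmod (x i) \<le> B) \<Longrightarrow> 0 < s \<Longrightarrow> s \<le> 1 \<Longrightarrow>
    (\<forall>i<d. cmod (\<eta> i - y i x) \<le> s ^ D) \<Longrightarrow>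
    (\<exists>x'\<in>zeros J. (\<forall>i<d. y i x' = \<eta> i) \<and> (\<forall>i<N. cmod (x' i - x i) \<le> C * s))"
    using open_projection[OF np, of B] by metis
  obtain e :: "((nat \<Rightarrow> complex) \<Rightarrow> complex) \<Rightarrow> nat" where
    e: "\<forall>Q. finite Q \<longrightarrow> (\<forall>p\<in>Q. p \<in> polyfun {..<d} \<and> p \<noteq> 0) \<longrightarrow>
    (\<exists>r0>0. \<forall>r \<eta>. 0 < r \<longrightarrow> r < r0 \<longrightarrow>
      (\<exists>\<eta>'. (\<forall>i<d. cmod (\<eta>' i - \<eta> i) \<le> r) \<and> (\<forall>p\<in>Q. cmod (p \<eta>') \<ge> r ^ e p)))"
    using polyfun_generic_perturbation[of d] by - (erule exE, rule that)
  \<comment> \<open>the bound \<open>B + C\<close> holds for the moved points\<close>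
  have "\<exists>b E. b \<in> polyfun {..<d} \<and> b \<noteq> 0 \<and> E > 0 \<and>
      (\<forall>x\<in>zeros J. (\<forall>i<N. cmod (x i) \<le> B + C) \<longrightarrow> cmod (b (\<lambda>i. y i x)) \<le> E * cmod (g x))"
    if g: "g \<in> polyfun {..<N} - J" for g
  proof -
    have gP: "g \<in> polyfun {..<N}" "g \<notin> J" using g by auto
    obtain \<mu> where \<mu>: "is_min_poly g \<mu>" using min_poly_exists[OF gP(1)] by blast
    have \<mu>P: "\<mu> \<in> polyfun_poly {..<d}" "lead_coeff \<mu> = 1" "degree \<mu> \<noteq> 0" "pev_at y g \<mu> \<in> J"
      "\<And>P. P \<in> polyfun_poly {..<d} \<Longrightarrow> pev_at y g P \<in> J \<Longrightarrow> P \<noteq> 0 \<Longrightarrow> degree \<mu> \<le> degree P"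
      using \<mu> unfolding is_min_poly_def by blast+
    obtain b \<mu>' where split: "\<mu> = pCons b \<mu>'" by (metis pCons_cases)
    have \<mu>': "\<mu>' \<in> polyfun_poly {..<d}" "b \<in> polyfun {..<d}"
      using polyfun_polyD[OF \<mu>P(1), of "Suc _"] polyfun_polyD[OF \<mu>P(1), of 0]
      unfolding split by (auto intro!: polyfun_polyI)
    have eq: "pev_at y g \<mu> = psubst y b + g * pev_at y g \<mu>'"
      by (auto simp: split pev_at_def psubst_def fun_eq_iff pointwise)
    have V': "pev_at y g \<mu>' \<in> polyfun {..<N}" by (rule pev_at_polyfun[OF \<mu>'(1) _ gP(1)]) (simp add: y_V)
    have "b \<noteq> 0"
    proof
      assume b: "b = 0"
      then have "g * pev_at y g \<mu>' \<in> J" using \<mu>P(4) eq by (simp add: psubst_simps)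
      then have "pev_at y g \<mu>' \<in> J" using J_prime[OF gP(1) V'] gP(2) by blast
      moreover have "\<mu>' \<noteq> 0" using \<mu>P(3) split by auto
      ultimately show False using \<mu>P(5)[OF \<mu>'(1)] split by simp
    qed
    moreover obtain E where "E > 0" "\<And>x. (\<forall>i\<in>{..<N}. cmod (x i) \<le> B + C) \<Longrightarrow> cmod (pev_at y g \<mu>' x) \<le> E"
      using polyfun_bounded[OF V'] by blast
    moreover have "cmod (b (\<lambda>i. y i x)) = cmod (g x) * cmod (pev_at y g \<mu>' x)" if "x \<in> zeros J" for x
    proof -
      have "pev_at y g \<mu> x = 0" using that \<mu>P(4) by (simp add: zeros_def)
      then have "b (\<lambda>i. y i x) = - (g x * pev_at y g \<mu>' x)"
        by (simp add: eq pointwise psubst_def eq_neg_iff_add_eq_0)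
      then show ?thesis by (simp add: norm_mult)
    qed
    ultimately have "\<forall>x\<in>zeros J. (\<forall>i<N. cmod (x i) \<le> B + C) \<longrightarrow> cmod (b (\<lambda>i. y i x)) \<le> E * cmod (g x)"
      by (auto simp: mult.commute[of E] intro!: mult_left_mono)
    then show ?thesis using \<open>b \<noteq> 0\<close> \<open>E > 0\<close> \<mu>'(2) by blast
  qed
  then obtain b E where bE: "\<And>g. g \<in> polyfun {..<N} - J \<Longrightarrow> b g \<in> polyfun {..<d} \<and> b g \<noteq> 0 \<and> E g > 0 \<and>
      (\<forall>x\<in>zeros J. (\<forall>i<N. cmod (x i) \<le> B + C) \<longrightarrow> cmod (b g (\<lambda>i. y i x)) \<le> E g * cmod (g x))" by metis
  note bE1 = bE[THEN conjunct1] and bE2 = bE[THEN conjunct2, THEN conjunct1]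
    and bE3 = bE[THEN conjunct2, THEN conjunct2, THEN conjunct1]
    and bE4 = bE[THEN conjunct2, THEN conjunct2, THEN conjunct2, THEN bspec, THEN mp]
  have main: "\<exists>s0>0. \<forall>s x. 0 < s \<longrightarrow> s < s0 \<longrightarrow> x \<in> zeros J \<longrightarrow> (\<forall>i<N. cmod (x i) \<le> B) \<longrightarrow>
      (\<exists>x'\<in>zeros J. (\<forall>i<N. cmod (x' i - x i) \<le> C * s) \<and> (\<forall>g\<in>Q. cmod (g x') \<ge> (s ^ D) ^ Suc (e (b g))))"
    if Q: "finite Q" "Q \<subseteq> polyfun {..<N} - J" for Q
  proof -
    have bQ: "\<forall>p\<in>b ` Q. p \<in> polyfun {..<d} \<and> p \<noteq> 0"
    proof
      fix p assume "p \<in> b ` Q"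
      then obtain g where "g \<in> Q" "p = b g" by blast
      then show "p \<in> polyfun {..<d} \<and> p \<noteq> 0" using bE1[of g] bE2[of g] Q(2) by auto
    qed
    from e[THEN spec, THEN mp, THEN mp, OF finite_imageI[OF Q(1)] bQ]
    obtain r0 where r0: "r0 > 0" "\<forall>r \<eta>. 0 < r \<longrightarrow> r < r0 \<longrightarrow>
      (\<exists>\<eta>'. (\<forall>i<d. cmod (\<eta>' i - \<eta> i) \<le> r) \<and> (\<forall>p\<in>b ` Q. cmod (p \<eta>') \<ge> r ^ e p))"
      by - ((erule exE conjE)+, rule that)
    define s0 where "s0 = Min ({1, r0} \<union> (\<lambda>g. 1 / E g) ` Q)"
    have s0: "s0 > 0" "s0 \<le> 1" "s0 \<le> r0" "\<And>g. g \<in> Q \<Longrightarrow> s0 \<le> 1 / E g"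
    proof -
      have fin: "finite ({1, r0} \<union> (\<lambda>g. 1 / E g) ` Q)" using Q(1) by simp
      have "\<forall>t\<in>{1, r0} \<union> (\<lambda>g. 1 / E g) ` Q. t > 0" using r0(1) bE3 Q(2) by auto
      then show "s0 > 0" unfolding s0_def using Min_in[OF fin] by blast
      show "s0 \<le> 1" "s0 \<le> r0" "\<And>g. g \<in> Q \<Longrightarrow> s0 \<le> 1 / E g"
        unfolding s0_def by (rule Min_le[OF fin], simp)+
    qed
    have "\<exists>x'\<in>zeros J. (\<forall>i<N. cmod (x' i - x i) \<le> C * s) \<and> (\<forall>g\<in>Q. cmod (g x') \<ge> (s ^ D) ^ Suc (e (b g)))"
      if s: "0 < s" "s < s0" and x: "x \<in> zeros J" "\<forall>i<N. cmod (x i) \<le> B" for s x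
    proof -
      have sD: "0 < s ^ D" "s ^ D \<le> s" using s s0(2) CD(2) power_decreasing[of 1 D s] by auto
      then have "s ^ D < r0" using s s0(3) by simp
      from r0(2)[rule_format, OF sD(1) this, of "\<lambda>i. y i x"] obtain \<eta> where
        \<eta>: "\<forall>i<d. cmod (\<eta> i - y i x) \<le> s ^ D" "\<And>g. g \<in> Q \<Longrightarrow> cmod (b g \<eta>) \<ge> (s ^ D) ^ e (b g)" by blast
      have "s \<le> 1" using s s0(2) by simp
      from CD(3)[OF x s(1) this \<eta>(1)] obtain x' where
        x': "x' \<in> zeros J" "\<forall>i<d. y i x' = \<eta> i" "\<forall>i<N. cmod (x' i - x i) \<le> C * s" by blast
      have B': "\<forall>i<N. cmod (x' i) \<le> B + C"
      proof (intro allI impI)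
        fix i assume i: "i < N"
        have "cmod (x' i) \<le> cmod (x i) + cmod (x' i - x i)"
          by (metis add.commute diff_add_cancel norm_triangle_ineq)
        also have "\<dots> \<le> B + C * 1"
          using x(2) x'(3) i \<open>s \<le> 1\<close> CD(1) by (intro add_mono order.trans[OF _ mult_left_mono[of s 1 C]]) auto
        finally show "cmod (x' i) \<le> B + C" by simp
      qed
      have "cmod (g x') \<ge> (s ^ D) ^ Suc (e (b g))" if g: "g \<in> Q" for g
      proof -
        have g': "g \<in> polyfun {..<N} - J" using g Q(2) by blast
        have "b g (\<lambda>i. y i x') = b g \<eta>"
          by (rule polyfun_cong[of _ "{..<d}"]) (use bE1[OF g'] x'(2) in auto)
        then have "(s ^ D) ^ e (b g) \<le> E g * cmod (g x')" using \<eta>(2)[OF g] bE4[OF g' x'(1) B'] by simp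
        then have "(s ^ D) * (s ^ D) ^ e (b g) \<le> (1 / E g) * (E g * cmod (g x'))"
          using sD s s0(4)[OF g] bE3[OF g'] by (intro mult_mono) auto
        then show ?thesis using bE3[OF g'] by simp
      qed
      then show ?thesis using x'(1,3) by blast
    qed
    then show ?thesis using s0(1) by blast
  qed
  show ?thesis
    by (rule exI[where x = C], rule conjI, rule CD(1), rule exI[where x = D], rule conjI, rule CD(2),
        rule exI[where x = "\<lambda>g. Suc (e (b g))"], intro allI impI, rule main)
qed

section \<open>Valuations as limits of logarithms\<close>

lemma polyfun_small_near_0:
  assumes "p \<in> polyfun V" "p (\<lambda>_. 0) = 0" "e > 0"
  shows "\<exists>\<rho>>0. \<forall>x. (\<forall>i\<in>V. cmod (x i) \<le> \<rho>) \<longrightarrow> cmod (p x) \<le> e"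
proof -
  obtain L where L: "L > 0" "\<And>x x' \<rho>. \<rho> \<ge> 0 \<Longrightarrow>
    (\<forall>i\<in>V. cmod (x i) \<le> 1 \<and> cmod (x' i) \<le> 1 \<and> cmod (x i - x' i) \<le> \<rho>) \<Longrightarrow> cmod (p x - p x') \<le> L * \<rho>"
    using polyfun_lipschitz[OF assms(1), of 1] by blast
  define \<rho> where "\<rho> = min 1 (e / L)"
  have \<rho>: "\<rho> > 0" "\<rho> \<le> 1" "L * \<rho> \<le> e"
    using L(1) assms(3) by (auto simp: \<rho>_def min_def field_simps)
  have "cmod (p x) \<le> e" if "\<forall>i\<in>V. cmod (x i) \<le> \<rho>" for x
  proof -
    have "cmod (p x - p (\<lambda>_. 0)) \<le> L * \<rho>"
      by (rule L(2)) (use that \<rho> in force)+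
    then show ?thesis using assms(2) \<rho>(3) by simp
  qed
  then show ?thesis using \<rho>(1) by blast
qed

lemma weight_small_near_0:
  fixes a :: "nat \<Rightarrow> real"
  assumes "\<And>j. 1 \<le> j \<Longrightarrow> j \<le> m \<Longrightarrow> f j \<in> polyfun V \<and> f j (\<lambda>_. 0) = 0 \<and> a j > 0" and "\<eta> > 0"
  shows "\<exists>\<rho>>0. \<forall>x. (\<forall>i\<in>V. cmod (x i) \<le> \<rho>) \<longrightarrow> (\<Sum>j=1..m. cmod (f j x) powr (1 / a j)) \<le> \<eta>"
proof -
  have "\<exists>\<rho>>0. \<forall>x. (\<forall>i\<in>V. cmod (x i) \<le> \<rho>) \<longrightarrow> cmod (f j x) powr (1 / a j) \<le> \<eta> / (real m + 1)"
    if j: "j \<in> {1..m}" for j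
  proof -
    have aj: "a j > 0" using assms(1)[of j] j by simp
    have pos: "\<eta> / (real m + 1) > 0" using assms(2) by simp
    obtain \<rho> where \<rho>: "\<rho> > 0" "\<And>x. (\<forall>i\<in>V. cmod (x i) \<le> \<rho>) \<Longrightarrow> cmod (f j x) \<le> (\<eta> / (real m + 1)) powr a j"
      using polyfun_small_near_0[of "f j" V "(\<eta> / (real m + 1)) powr a j"] assms(1)[of j] assms(2) j pos by auto
    have "cmod (f j x) powr (1 / a j) \<le> \<eta> / (real m + 1)" if "\<forall>i\<in>V. cmod (x i) \<le> \<rho>" for x
    proof -
      have "cmod (f j x) powr (1 / a j) \<le> ((\<eta> / (real m + 1)) powr a j) powr (1 / a j)"
        using \<rho>(2)[OF that] aj by (intro powr_mono2) auto
      also have "\<dots> = \<eta> / (real m + 1)" using aj pos assms(2) by (simp only: powr_powr) simp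
      finally show ?thesis .
    qed
    then show ?thesis using \<rho>(1) by blast
  qed
  then obtain \<rho> where \<rho>: "\<And>j. j \<in> {1..m} \<Longrightarrow> \<rho> j > 0" "\<And>j x. j \<in> {1..m} \<Longrightarrow> (\<forall>i\<in>V. cmod (x i) \<le> \<rho> j) \<Longrightarrow>
    cmod (f j x) powr (1 / a j) \<le> \<eta> / (real m + 1)" by metis
  define r where "r = Min (insert 1 (\<rho> ` {1..m}))"
  have fin: "finite (insert 1 (\<rho> ` {1..m}))" by simp
  have "\<forall>t\<in>insert 1 (\<rho> ` {1..m}). t > 0" using \<rho>(1) by auto
  then have r: "r > 0" unfolding r_def using Min_in[OF fin] by blast
  have r': "r \<le> \<rho> j" if "j \<in> {1..m}" for j
    unfolding r_def by (rule Min_le[OF fin]) (use that in simp)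
  have "(\<Sum>j=1..m. cmod (f j x) powr (1 / a j)) \<le> \<eta>" if x: "\<forall>i\<in>V. cmod (x i) \<le> r" for x
  proof -
    have "(\<Sum>j=1..m. cmod (f j x) powr (1 / a j)) \<le> (\<Sum>j=1..m. \<eta> / (real m + 1))"
    proof (intro sum_mono \<rho>(2) ballI)
      fix j i assume "j \<in> {1..m}" "i \<in> V"
      then show "cmod (x i) \<le> \<rho> j" using x r'[of j] by (meson order_trans)
    qed
    also have "\<dots> \<le> \<eta>" using assms(2) by (simp add: field_simps)
    finally show ?thesis .
  qed
  then show ?thesis using r by blast
qed

text \<open>The number \<open>l\<close> is \<open>- ln \<Phi>\<close> at the point given by \<open>pts\<close>, and \<open>x\<close> is this point after a move to general
  position. The bound \<open>c g\<close> depends neither on \<open>Q\<close> nor on \<open>\<delta>\<close>, which is what confines all the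
  approximations to one compact set.\<close>

lemma approximate_valuation:
  fixes N m :: nat and a :: "nat \<Rightarrow> real"
  assumes J: "poly_prime {..<N} J" and f: "\<And>j. j \<le> m \<Longrightarrow> f j \<in> polyfun {..<N}" and m: "m \<ge> 1"
    and a: "a 0 = 0" "\<And>j. 1 \<le> j \<Longrightarrow> j \<le> m \<Longrightarrow> a j > 0"
    and f0: "\<And>j. 1 \<le> j \<Longrightarrow> j \<le> m \<Longrightarrow> f j (\<lambda>_. 0) = 0"
    and pts: "\<And>\<epsilon>. \<epsilon> > 0 \<Longrightarrow> \<exists>x\<in>zeros J. (\<forall>i<N. cmod (x i) \<le> \<epsilon>) \<and> (\<forall>j\<le>m. f j x \<noteq> 0) \<and>
      (\<Sum>j=1..m. cmod (f j x) powr (1 / a j)) powr ((\<Sum>j\<le>m. a j) + \<epsilon>) \<le> (\<Prod>j\<le>m. cmod (f j x))"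
  shows "\<exists>c :: ((nat \<Rightarrow> complex) \<Rightarrow> complex) \<Rightarrow> real. \<forall>Q \<delta>. finite Q \<longrightarrow> Q \<subseteq> polyfun {..<N} - J \<longrightarrow> \<delta> > 0 \<longrightarrow>
    (\<exists>x\<in>zeros J. \<exists>l>0. ln 2 \<le> \<delta> * l \<and>
      (\<forall>g\<in>Q. g x \<noteq> 0 \<and> - \<delta> \<le> - ln (cmod (g x)) / l \<and> - ln (cmod (g x)) / l \<le> c g) \<and>
      (\<forall>j\<le>m. f j x \<noteq> 0 \<and> a j - \<delta> \<le> - ln (cmod (f j x)) / l) \<and>
      (\<Sum>j\<le>m. - ln (cmod (f j x)) / l) \<le> (\<Sum>j\<le>m. a j) + (real m + 2) * \<delta>)"
proof -
  define S where "S = (\<Sum>j\<le>m. a j)"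
  define \<Phi> where "\<Phi> = (\<lambda>x. \<Sum>j=1..m. cmod (f j x) powr (1 / a j))"
  have a_nonneg: "a j \<ge> 0" if "j \<le> m" for j using a that by (cases "j = 0") (auto intro: less_imp_le)
  have S: "S \<ge> 0" unfolding S_def using a_nonneg by (intro sum_nonneg) auto
  obtain C D c where CD: "C > 0" "D > 0" and c: "\<forall>Q. finite Q \<longrightarrow> Q \<subseteq> polyfun {..<N} - J \<longrightarrow>
    (\<exists>s0>0. \<forall>s x. 0 < s \<longrightarrow> s < s0 \<longrightarrow> x \<in> zeros J \<longrightarrow> (\<forall>i<N. cmod (x i) \<le> 1) \<longrightarrow>
      (\<exists>x'\<in>zeros J. (\<forall>i<N. cmod (x' i - x i) \<le> C * s) \<and> (\<forall>g\<in>Q. cmod (g x') \<ge> (s ^ D) ^ c g)))"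
    using move_to_general_position[OF J, of 1] by - ((erule exE conjE)+, rule that)
  \<comment> \<open>the factors of the product are of order at least \<open>\<Phi> powr (S + 1)\<close>; the points are moved by the order of \<open>\<Phi> ^ M\<close>, which is smaller\<close>
  define M where "M = nat \<lceil>S + 2\<rceil>"
  have M: "real M \<ge> S + 2" "M \<ge> 1" using S by (auto simp: M_def le_nat_iff)
  have "\<exists>x\<in>zeros J. \<exists>l>0. ln 2 \<le> \<delta> * l \<and>
      (\<forall>g\<in>Q. g x \<noteq> 0 \<and> - \<delta> \<le> - ln (cmod (g x)) / l \<and> - ln (cmod (g x)) / l \<le> real (M * D * c g)) \<and>
      (\<forall>j\<le>m. f j x \<noteq> 0 \<and> a j - \<delta> \<le> - ln (cmod (f j x)) / l) \<and>
      (\<Sum>j\<le>m. - ln (cmod (f j x)) / l) \<le> S + (real m + 2) * \<delta>"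
    if Q: "finite Q" "Q \<subseteq> polyfun {..<N} - J" and \<delta>: "\<delta> > 0" for Q \<delta>
  proof -
    obtain s0 where s0: "s0 > 0" "\<forall>s x. 0 < s \<longrightarrow> s < s0 \<longrightarrow> x \<in> zeros J \<longrightarrow> (\<forall>i<N. cmod (x i) \<le> 1) \<longrightarrow>
      (\<exists>x'\<in>zeros J. (\<forall>i<N. cmod (x' i - x i) \<le> C * s) \<and> (\<forall>g\<in>Q. cmod (g x') \<ge> (s ^ D) ^ c g))"
      using c[THEN spec, THEN mp, THEN mp, OF Q] by - ((erule exE conjE)+, rule that)
    define B where "B = 1 + C"
    obtain E where E: "E > 0" "\<And>x g. (\<forall>j\<in>{..<N}. cmod (x j) \<le> B) \<Longrightarrow> g \<in> Q \<union> f ` {..m} \<Longrightarrow> cmod (g x) \<le> E"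
      using polyfun_finite_bound[of "Q \<union> f ` {..m}" "\<lambda>g. g" "{..<N}" B] Q f by blast
    have "\<exists>L>0. \<forall>j\<le>m. \<forall>x x' e. e \<ge> 0 \<longrightarrow> (\<forall>i\<in>{..<N}. cmod (x i) \<le> B \<and> cmod (x' i) \<le> B \<and> cmod (x i - x' i) \<le> e) \<longrightarrow>
      cmod (f j x - f j x') \<le> L * e"
    proof -
      have "\<forall>j\<in>{..m}. \<exists>L>0. \<forall>x x' e. e \<ge> 0 \<longrightarrow> (\<forall>i\<in>{..<N}. cmod (x i) \<le> B \<and> cmod (x' i) \<le> B \<and> cmod (x i - x' i) \<le> e) \<longrightarrow>
        cmod (f j x - f j x') \<le> L * e" using polyfun_lipschitz f by (metis atMost_iff)
      then obtain L where L: "\<And>j. j \<in> {..m} \<Longrightarrow> L j > 0"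
        "\<And>j x x' e. j \<in> {..m} \<Longrightarrow> e \<ge> 0 \<Longrightarrow> (\<forall>i\<in>{..<N}. cmod (x i) \<le> B \<and> cmod (x' i) \<le> B \<and> cmod (x i - x' i) \<le> e) \<Longrightarrow>
        cmod (f j x - f j x') \<le> L j * e" by metis
      have Ls: "L j \<le> (\<Sum>j\<le>m. L j)" if "j \<in> {..m}" for j
        using that L(1) by (intro member_le_sum) (auto intro: less_imp_le)
      have "cmod (f j x - f j x') \<le> (\<Sum>j\<le>m. L j) * e" if "j \<le> m" "e \<ge> 0"
        "\<forall>i\<in>{..<N}. cmod (x i) \<le> B \<and> cmod (x' i) \<le> B \<and> cmod (x i - x' i) \<le> e" for j x x' e
        using L(2)[OF _ that(2,3), of j] mult_right_mono[OF Ls[of j] that(2)] that(1) by simp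
      moreover have "(\<Sum>j\<le>m. L j) > 0" using L(1) by (intro sum_pos) auto
      ultimately show ?thesis by blast
    qed
    then obtain L where L: "L > 0" "\<And>j x x' e. j \<le> m \<Longrightarrow> e \<ge> 0 \<Longrightarrow> (\<forall>i\<in>{..<N}. cmod (x i) \<le> B \<and> cmod (x' i) \<le> B \<and> cmod (x i - x' i) \<le> e) \<Longrightarrow>
      cmod (f j x - f j x') \<le> L * e" by blast
    define E' where "E' = max 1 E"
    have E': "E' \<ge> 1" "E' \<ge> E" by (auto simp: E'_def)
    \<comment> \<open>for \<open>l \<ge> l0\<close> the errors \<open>ln 2\<close> and \<open>ln E'\<close> are at most \<open>\<delta>\<close> after division by \<open>l\<close>\<close>
    define l0 where "l0 = (ln 2 + ln E') / \<delta>"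
    have l0: "l0 > 0" using E'(1) \<delta> by (auto simp: l0_def intro!: divide_pos_pos add_pos_nonneg)
    define \<eta> where "\<eta> = min (min (s0 / 2) (1 / 2)) (min (exp (- l0)) (1 / (2 * L * C * E' ^ m)))"
    have \<eta>: "\<eta> > 0" "\<eta> < s0" "\<eta> \<le> 1 / 2" "\<eta> \<le> exp (- l0)" "\<eta> \<le> 1 / (2 * L * C * E' ^ m)"
      using s0(1) L(1) CD(1) E'(1) by (auto simp: \<eta>_def intro!: mult_pos_pos zero_less_power)
    obtain \<rho> where \<rho>: "\<rho> > 0" "\<And>x. (\<forall>i\<in>{..<N}. cmod (x i) \<le> \<rho>) \<Longrightarrow> \<Phi> x \<le> \<eta>"
      using weight_small_near_0[of m f "{..<N}" a \<eta>] f f0 a(2) \<eta>(1) unfolding \<Phi>_def by auto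
    define \<epsilon> where "\<epsilon> = min (min \<rho> \<delta>) 1"
    have \<epsilon>: "\<epsilon> > 0" "\<epsilon> \<le> \<rho>" "\<epsilon> \<le> \<delta>" "\<epsilon> \<le> 1" using \<rho>(1) \<delta> by (auto simp: \<epsilon>_def)
    obtain x where x: "x \<in> zeros J" "\<forall>i<N. cmod (x i) \<le> \<epsilon>" "\<forall>j\<le>m. f j x \<noteq> 0"
      "\<Phi> x powr (S + \<epsilon>) \<le> (\<Prod>j\<le>m. cmod (f j x))"
      using pts[OF \<epsilon>(1)] unfolding \<Phi>_def S_def by blast
    have \<Phi>\<eta>: "\<Phi> x \<le> \<eta>" using x(2) \<epsilon>(2) by (intro \<rho>(2)) force
    have le\<Phi>: "cmod (f j x) powr (1 / a j) \<le> \<Phi> x" if "1 \<le> j" "j \<le> m" for j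
      unfolding \<Phi>_def using that by (intro member_le_sum) auto
    have \<Phi>: "\<Phi> x > 0"
    proof (rule less_le_trans[OF _ le\<Phi>[of 1]])
      show "0 < cmod (f 1 x) powr (1 / a 1)" using x(3)[rule_format, of 1] m by simp
    qed (use m in auto)
    have \<Phi>1: "\<Phi> x < 1" using \<Phi>\<eta> \<eta>(3) by simp
    define l where "l = - ln (\<Phi> x)"
    have "ln (\<Phi> x) \<le> - l0" using \<Phi>\<eta> \<eta>(4) \<Phi> by (metis ln_exp ln_mono order_trans exp_gt_zero)
    then have l: "l \<ge> l0" "l > 0" using l0 by (auto simp: l_def)
    have \<delta>l: "ln 2 + ln E' \<le> \<delta> * l"
    proof -
      have "ln 2 + ln E' = \<delta> * l0" using \<delta> by (simp add: l0_def)
      then show ?thesis using l(1) \<delta> by simp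
    qed
    have lnE': "ln E' \<ge> 0" using E'(1) by simp
    define s where "s = \<Phi> x ^ M"
    have s: "0 < s" "s \<le> \<Phi> x" using \<Phi> \<Phi>1 M(2) power_decreasing[of 1 M "\<Phi> x"] by (auto simp: s_def)
    have "s < s0" "\<forall>i<N. cmod (x i) \<le> 1" using s \<Phi>\<eta> \<eta>(2) x(2) \<epsilon>(4) by force+
    then obtain x' where x': "x' \<in> zeros J" "\<forall>i<N. cmod (x' i - x i) \<le> C * s" "\<forall>g\<in>Q. cmod (g x') \<ge> (s ^ D) ^ c g"
      using s0(2)[rule_format, OF s(1) _ x(1)] by blast
    have bx: "\<forall>i\<in>{..<N}. cmod (x i) \<le> B" using x(2) \<epsilon>(4) CD(1) unfolding B_def by force
    have bx': "\<forall>i\<in>{..<N}. cmod (x' i) \<le> B"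
    proof
      fix i assume i: "i \<in> {..<N}"
      have "cmod (x' i) \<le> cmod (x i) + cmod (x' i - x i)" by (metis add.commute diff_add_cancel norm_triangle_ineq)
      also have "\<dots> \<le> 1 + C * 1"
        using x(2) \<epsilon>(4) x'(2) i s \<Phi>1 CD(1) by (intro add_mono order.trans[OF _ mult_left_mono[of s 1 C]]) force+
      finally show "cmod (x' i) \<le> B" by (simp add: B_def)
    qed
    \<comment> \<open>the other factors being bounded, each factor is at least a multiple of \<open>\<Phi> powr (S + 1)\<close>, and a move of higher order changes it little\<close>
    have near: "cmod (f j x' - f j x) \<le> cmod (f j x) / 2" if j: "j \<le> m" for j
    proof -
      have "\<Phi> x powr (S + 1) \<le> \<Phi> x powr (S + \<epsilon>)" using \<Phi> \<Phi>1 \<epsilon>(4) by (intro powr_mono') auto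
      also have "\<dots> \<le> (\<Prod>j\<le>m. cmod (f j x))" by (rule x(4))
      also have "\<dots> = cmod (f j x) * (\<Prod>i\<in>{..m} - {j}. cmod (f i x))" using j by (subst prod.remove[of _ j]) auto
      also have "\<dots> \<le> cmod (f j x) * (\<Prod>i\<in>{..m} - {j}. E')"
      proof (intro mult_left_mono prod_mono)
        fix i assume "i \<in> {..m} - {j}"
        then have "cmod (f i x) \<le> E" by (intro E(2)[OF bx]) auto
        then show "0 \<le> cmod (f i x) \<and> cmod (f i x) \<le> E'" using E'(2) by simp
      qed auto
      also have "\<dots> = cmod (f j x) * E' ^ m" using j by simp
      finally have lower: "\<Phi> x powr (S + 1) \<le> cmod (f j x) * E' ^ m" .
      have "cmod (f j x' - f j x) \<le> L * (C * s)"
        using L(2)[OF j, of "C * s" x' x] bx bx' x'(2) CD(1) s(1) by auto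
      also have "s = \<Phi> x powr real M" using \<Phi> by (simp add: s_def powr_realpow)
      also have "L * (C * \<Phi> x powr real M) \<le> L * (C * \<Phi> x powr (S + 1 + 1))"
        using \<Phi> \<Phi>1 M(1) L(1) CD(1) by (intro mult_left_mono powr_mono') auto
      also have "\<Phi> x powr (S + 1 + 1) = \<Phi> x powr (S + 1) * \<Phi> x" using \<Phi> by (simp only: powr_add[of _ "S + 1" 1]) simp
      also have "L * (C * (\<Phi> x powr (S + 1) * \<Phi> x)) \<le> L * (C * ((cmod (f j x) * E' ^ m) * (1 / (2 * L * C * E' ^ m))))"
        using lower \<Phi>\<eta> \<eta>(5) L(1) CD(1) \<Phi> E'(1) by (intro mult_left_mono mult_mono) auto
      also have "\<dots> = cmod (f j x) / 2" using L(1) CD(1) E'(1) by (simp add: field_simps)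
      finally show ?thesis .
    qed
    have half: "cmod (f j x) / 2 \<le> cmod (f j x')" "cmod (f j x') \<le> 2 * cmod (f j x)" "f j x' \<noteq> 0" if j: "j \<le> m" for j
    proof -
      have "cmod (f j x) \<le> cmod (f j x') + cmod (f j x' - f j x)"
        by (metis norm_minus_commute norm_triangle_sub)
      then show 1: "cmod (f j x) / 2 \<le> cmod (f j x')" using near[OF j] by simp
      have "cmod (f j x') \<le> cmod (f j x) + cmod (f j x' - f j x)" by (rule norm_triangle_sub)
      then show "cmod (f j x') \<le> 2 * cmod (f j x)" using near[OF j] norm_ge_zero[of "f j x"] by linarith
      show "f j x' \<noteq> 0" using 1 x(3) j by auto
    qed
    have lnf: "ln (cmod (f j x)) - ln 2 \<le> ln (cmod (f j x'))" "ln (cmod (f j x')) \<le> ln (cmod (f j x)) + ln 2" if j: "j \<le> m" for j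
    proof -
      have pos: "cmod (f j x) > 0" "cmod (f j x') > 0" using x(3) half(3)[OF j] j by auto
      have "ln (cmod (f j x) / 2) \<le> ln (cmod (f j x'))" using half(1)[OF j] pos by (subst ln_le_cancel_iff) auto
      then show "ln (cmod (f j x)) - ln 2 \<le> ln (cmod (f j x'))" using pos by (simp add: ln_div)
      have "ln (cmod (f j x')) \<le> ln (2 * cmod (f j x))" using half(2)[OF j] pos by (subst ln_le_cancel_iff) auto
      then show "ln (cmod (f j x')) \<le> ln (cmod (f j x)) + ln 2" using pos by (simp add: ln_mult)
    qed
    have upper: "ln (cmod (g x')) \<le> ln E'" if "g \<in> Q \<union> f ` {..m}" "g x' \<noteq> 0" for g
    proof -
      have "cmod (g x') \<le> E'" using E(2)[OF bx' that(1)] E'(2) by simp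
      then show ?thesis using that(2) E'(1) by (subst ln_le_cancel_iff) auto
    qed
    have 1: "g x' \<noteq> 0 \<and> - \<delta> \<le> - ln (cmod (g x')) / l \<and> - ln (cmod (g x')) / l \<le> real (M * D * c g)" if g: "g \<in> Q" for g
    proof -
      have low: "(s ^ D) ^ c g \<le> cmod (g x')" "(s ^ D) ^ c g > 0" using x'(3) g s(1) by auto
      then have nz: "g x' \<noteq> 0" by auto
      have "ln (cmod (g x')) \<le> \<delta> * l" using upper[of g] g nz \<delta>l ln_ge_zero[of 2] by (smt (verit) UnCI)
      then have A: "- \<delta> \<le> - ln (cmod (g x')) / l" using l(2) by (simp add: field_simps)
      have "ln ((s ^ D) ^ c g) \<le> ln (cmod (g x'))" using low nz by (subst ln_le_cancel_iff) auto
      moreover have "ln ((s ^ D) ^ c g) = - real (M * D * c g) * l"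
        using \<Phi> by (simp add: s_def ln_realpow l_def flip: power_mult)
      ultimately have "- ln (cmod (g x')) / l \<le> real (M * D * c g)" using l(2) by (simp add: field_simps)
      then show ?thesis using A nz by blast
    qed
    have 2: "f j x' \<noteq> 0 \<and> a j - \<delta> \<le> - ln (cmod (f j x')) / l" if j: "j \<le> m" for j
    proof (cases "j = 0")
      case True
      have "ln (cmod (f j x')) \<le> \<delta> * l" using upper[of "f j"] j half(3)[OF j] \<delta>l ln_ge_zero[of 2]
        by (smt (verit) UnCI atMost_iff imageI)
      then show ?thesis using half(3)[OF j] l(2) a(1) True by (simp add: field_simps)
    next
      case False
      then have aj: "a j > 0" using a(2)[of j] j by simp
      have pos: "cmod (f j x) > 0" using x(3) j by auto
      have "ln (cmod (f j x) powr (1 / a j)) \<le> ln (\<Phi> x)"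
        using le\<Phi>[of j] False j pos \<Phi> by (subst ln_le_cancel_iff) auto
      then have "(1 / a j) * ln (cmod (f j x)) \<le> - l" using pos by (simp add: ln_powr l_def)
      then have "ln (cmod (f j x)) \<le> - (a j * l)" using aj by (simp add: field_simps)
      then have "ln (cmod (f j x')) \<le> - (a j * l) + \<delta> * l" using lnf(2)[OF j] \<delta>l lnE' by linarith
      then show ?thesis using half(3)[OF j] l(2) by (simp add: field_simps)
    qed
    have 3: "(\<Sum>j\<le>m. - ln (cmod (f j x')) / l) \<le> S + (real m + 2) * \<delta>"
    proof -
      have "\<Phi> x powr (S + \<delta>) \<le> \<Phi> x powr (S + \<epsilon>)" using \<Phi> \<Phi>1 \<epsilon>(3) by (intro powr_mono') auto
      then have "\<Phi> x powr (S + \<delta>) \<le> (\<Prod>j\<le>m. cmod (f j x))" using x(4) by simp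
      moreover have "(\<Prod>j\<le>m. cmod (f j x)) > 0" using x(3) by (intro prod_pos) auto
      ultimately have "ln (\<Phi> x powr (S + \<delta>)) \<le> ln (\<Prod>j\<le>m. cmod (f j x))" using \<Phi> by (subst ln_le_cancel_iff) auto
      also have "\<dots> = (\<Sum>j\<le>m. ln (cmod (f j x)))" using x(3) by (intro ln_prod) auto
      also have "\<dots> \<le> (\<Sum>j\<le>m. ln (cmod (f j x')) + ln 2)" using lnf(1) by (intro sum_mono) (simp add: algebra_simps)
      finally have "- (S + \<delta>) * l \<le> (\<Sum>j\<le>m. ln (cmod (f j x'))) + (real m + 1) * ln 2"
        using \<Phi> by (simp add: ln_powr l_def sum.distrib algebra_simps)
      moreover have "(real m + 1) * ln 2 \<le> (real m + 1) * (\<delta> * l)" using \<delta>l lnE' by (intro mult_left_mono) auto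
      ultimately have "- (\<Sum>j\<le>m. ln (cmod (f j x'))) \<le> (S + (real m + 2) * \<delta>) * l" by (simp add: algebra_simps)
      then have "- (\<Sum>j\<le>m. ln (cmod (f j x'))) / l \<le> S + (real m + 2) * \<delta>" using l(2) by (simp add: field_simps)
      then show ?thesis by (simp add: sum_negf flip: sum_divide_distrib)
    qed
    have "ln 2 \<le> \<delta> * l" using \<delta>l lnE' by linarith
    then show ?thesis using x'(1) l(2) 1 2 3 by blast
  qed
  then show ?thesis unfolding S_def by (intro exI[of _ "\<lambda>g. real (M * D * c g)"]) blast
qed

lemma closed_Ball_Collect: "(\<And>i. i \<in> I \<Longrightarrow> closed {v. R i v}) \<Longrightarrow> closed {v. \<forall>i\<in>I. R i v}"
proof -
  assume "\<And>i. i \<in> I \<Longrightarrow> closed {v. R i v}"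
  then have "closed (\<Inter>i\<in>I. {v. R i v})" by (intro closed_INT) auto
  moreover have "{v. \<forall>i\<in>I. R i v} = (\<Inter>i\<in>I. {v. R i v})" by auto
  ultimately show ?thesis by simp
qed

lemma compact_box_fun:
  fixes c :: "'i \<Rightarrow> real"
  shows "compact {v. \<forall>i. 0 \<le> v i \<and> v i \<le> c i}"
proof -
  have "compactin (product_topology (\<lambda>i. euclidean) UNIV) (PiE UNIV (\<lambda>i. {0..c i}))"
    by (simp add: compactin_PiE)
  then have "compact (PiE UNIV (\<lambda>i. {0..c i}))"
    by (simp only: euclidean_product_topology compactin_euclidean_iff)
  moreover have "PiE UNIV (\<lambda>i. {0..c i}) = {v. \<forall>i. 0 \<le> v i \<and> v i \<le> c i}"
    by (auto simp: PiE_def Pi_def extensional_def)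
  ultimately show ?thesis by simp
qed

text \<open>By Tychonoff's theorem, the functions with values in the intervals from \<open>0\<close> to \<open>c g\<close> form a compact
  space. The conditions on a valuation, weakened by \<open>\<epsilon>\<close> and restricted to finitely many elements, define
  closed subsets with the finite intersection property. A common point has values at least \<open>a j\<close> at
  \<open>f j\<close>, and these values have sum at most the sum of the \<open>a j\<close>, so they equal the \<open>a j\<close>.\<close>

lemma valuation_limit:
  fixes J P :: "(('v \<Rightarrow> complex) \<Rightarrow> complex) set" and a :: "nat \<Rightarrow> real" and c :: "(('v \<Rightarrow> complex) \<Rightarrow> complex) \<Rightarrow> real"
  assumes P: "\<And>g h. g \<in> P \<Longrightarrow> h \<in> P \<Longrightarrow> g * h \<in> P"
    and J: "\<And>p. p \<in> J \<Longrightarrow> - p \<in> J"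
    and f: "\<And>j. j \<le> m \<Longrightarrow> f j \<in> P"
    and approx: "\<And>Q \<delta>. finite Q \<Longrightarrow> Q \<subseteq> P \<Longrightarrow> \<delta> > 0 \<Longrightarrow>
    (\<exists>x\<in>zeros J. \<exists>l>0. ln 2 \<le> \<delta> * l \<and>
      (\<forall>g\<in>Q. g x \<noteq> 0 \<and> - \<delta> \<le> - ln (cmod (g x)) / l \<and> - ln (cmod (g x)) / l \<le> c g) \<and>
      (\<forall>j\<le>m. f j x \<noteq> 0 \<and> a j - \<delta> \<le> - ln (cmod (f j x)) / l) \<and>
      (\<Sum>j\<le>m. - ln (cmod (f j x)) / l) \<le> (\<Sum>j\<le>m. a j) + (real m + 2) * \<delta>)"
  shows "\<exists>v :: (('v \<Rightarrow> complex) \<Rightarrow> complex) \<Rightarrow> real. (\<forall>g. 0 \<le> v g) \<and>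
    (\<forall>g\<in>P. \<forall>h\<in>P. v (g * h) = v g + v h) \<and>
    (\<forall>g\<in>P. \<forall>h\<in>P. g + h \<in> P \<longrightarrow> min (v g) (v h) \<le> v (g + h)) \<and>
    (\<forall>g\<in>P. \<forall>h\<in>P. g - h \<in> J \<longrightarrow> v g = v h) \<and>
    (\<forall>j\<le>m. v (f j) = a j)"
proof -
  define c' where "c' = (\<lambda>g. max 0 (c g))"
  define K where "K = {v. \<forall>g. 0 \<le> v g \<and> v g \<le> c' g}"
  define T1 where "T1 = (\<lambda>Q \<epsilon>. {v :: (('v \<Rightarrow> complex) \<Rightarrow> complex) \<Rightarrow> real.
    \<forall>(g, h)\<in>{(g, h). g \<in> Q \<and> h \<in> Q}. v (g * h) \<le> v g + v h + \<epsilon> \<and> v g + v h \<le> v (g * h) + \<epsilon>})"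
  define T2 where "T2 = (\<lambda>Q \<epsilon>. {v :: (('v \<Rightarrow> complex) \<Rightarrow> complex) \<Rightarrow> real.
    \<forall>(g, h)\<in>{(g, h). g \<in> Q \<and> h \<in> Q \<and> g + h \<in> P}. min (v g) (v h) \<le> v (g + h) + \<epsilon>})"
  define T3 where "T3 = (\<lambda>Q \<epsilon>. {v :: (('v \<Rightarrow> complex) \<Rightarrow> complex) \<Rightarrow> real.
    \<forall>(g, h)\<in>{(g, h). g \<in> Q \<and> h \<in> Q \<and> g - h \<in> J}. v g \<le> v h + \<epsilon>})"
  define T4 where "T4 = (\<lambda>\<epsilon>. {v :: (('v \<Rightarrow> complex) \<Rightarrow> complex) \<Rightarrow> real.
    (\<forall>j\<in>{..m}. a j \<le> v (f j) + \<epsilon>) \<and> (\<Sum>j\<le>m. v (f j)) \<le> (\<Sum>j\<le>m. a j) + \<epsilon>})"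
  define T where "T = (\<lambda>(Q, \<epsilon>). T1 Q \<epsilon> \<inter> T2 Q \<epsilon> \<inter> T3 Q \<epsilon> \<inter> T4 \<epsilon>)"
  define Idx where "Idx = {(Q, \<epsilon>::real). finite Q \<and> Q \<subseteq> P \<and> \<epsilon> > 0}"
  have cont: "continuous_on UNIV (\<lambda>v :: (('v \<Rightarrow> complex) \<Rightarrow> complex) \<Rightarrow> real. v g)" for g
    by (rule continuous_on_product_coordinates)
  have clos: "closed (T i)" for i
  proof -
    obtain Q \<epsilon> where i: "i = (Q, \<epsilon>)" by (cases i)
    have "closed (T1 Q \<epsilon>)" unfolding T1_def
      by (intro closed_Ball_Collect) (auto intro!: closed_Collect_conj closed_Collect_le continuous_on_add cont continuous_on_const)
    moreover have "closed (T2 Q \<epsilon>)" unfolding T2_def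
      by (intro closed_Ball_Collect) (auto simp del: min_le_iff_disj intro!: closed_Collect_le continuous_on_add continuous_on_min cont continuous_on_const)
    moreover have "closed (T3 Q \<epsilon>)" unfolding T3_def
      by (intro closed_Ball_Collect) (auto intro!: closed_Collect_le continuous_on_add cont continuous_on_const)
    moreover have "closed (T4 \<epsilon>)" unfolding T4_def
      by (intro closed_Collect_conj closed_Ball_Collect closed_Collect_le continuous_on_add continuous_on_sum cont continuous_on_const)
    ultimately show ?thesis by (simp add: i T_def closed_Int)
  qed
  have mono: "T (Q, \<epsilon>) \<subseteq> T (Q', \<epsilon>')" if "Q' \<subseteq> Q" "\<epsilon> \<le> \<epsilon>'" for Q Q' and \<epsilon> \<epsilon>' :: real
  proof
    fix v assume v: "v \<in> T (Q, \<epsilon>)"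
    have v1: "v \<in> T1 Q \<epsilon>" and v2: "v \<in> T2 Q \<epsilon>" and v3: "v \<in> T3 Q \<epsilon>" and v4: "v \<in> T4 \<epsilon>"
      using v by (simp_all add: T_def)
    have "v (g * h) \<le> v g + v h + \<epsilon>' \<and> v g + v h \<le> v (g * h) + \<epsilon>'" if "g \<in> Q'" "h \<in> Q'" for g h
    proof -
      have "(g, h) \<in> {(g, h). g \<in> Q \<and> h \<in> Q}" using that \<open>Q' \<subseteq> Q\<close> by auto
      then show ?thesis using v1 \<open>\<epsilon> \<le> \<epsilon>'\<close> unfolding T1_def by fastforce
    qed
    then have "v \<in> T1 Q' \<epsilon>'" by (auto simp: T1_def)
    moreover have "min (v g) (v h) \<le> v (g + h) + \<epsilon>'" if "g \<in> Q'" "h \<in> Q'" "g + h \<in> P" for g h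
    proof -
      have "(g, h) \<in> {(g, h). g \<in> Q \<and> h \<in> Q \<and> g + h \<in> P}" using that \<open>Q' \<subseteq> Q\<close> by auto
      then have "min (v g) (v h) \<le> v (g + h) + \<epsilon>" using v2 unfolding T2_def by blast
      then show ?thesis using \<open>\<epsilon> \<le> \<epsilon>'\<close> by linarith
    qed
    then have "v \<in> T2 Q' \<epsilon>'" by (auto simp: T2_def simp del: min_le_iff_disj)
    moreover have "v g \<le> v h + \<epsilon>'" if "g \<in> Q'" "h \<in> Q'" "g - h \<in> J" for g h
    proof -
      have "(g, h) \<in> {(g, h). g \<in> Q \<and> h \<in> Q \<and> g - h \<in> J}" using that \<open>Q' \<subseteq> Q\<close> by auto
      then have "v g \<le> v h + \<epsilon>" using v3 unfolding T3_def by blast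
      then show ?thesis using \<open>\<epsilon> \<le> \<epsilon>'\<close> by linarith
    qed
    then have "v \<in> T3 Q' \<epsilon>'" by (auto simp: T3_def)
    moreover have "v \<in> T4 \<epsilon>'"
      using v4 \<open>\<epsilon> \<le> \<epsilon>'\<close> unfolding T4_def by (auto intro: order_trans)
    ultimately show "v \<in> T (Q', \<epsilon>')" by (simp add: T_def)
  qed
  have nonempty: "K \<inter> T (Q, \<epsilon>) \<noteq> {}" if Q: "finite Q" "Q \<subseteq> P" and \<epsilon>: "\<epsilon> > 0" for Q \<epsilon>
  proof -
    define \<delta> where "\<delta> = \<epsilon> / (2 * real m + 4)"
    have \<delta>0: "\<delta> > 0" using \<epsilon> by (simp add: \<delta>_def)
    have e: "\<epsilon> = (2 * real m + 4) * \<delta>" by (simp add: \<delta>_def)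
    have "(real m + 2) * \<delta> + (real m + 1) * \<delta> = (2 * real m + 3) * \<delta>" by (simp add: algebra_simps)
    also have "\<dots> \<le> \<epsilon>" unfolding e using \<delta>0 by (intro mult_right_mono) auto
    finally have e3: "(real m + 2) * \<delta> + (real m + 1) * \<delta> \<le> \<epsilon>" .
    have e2: "2 * \<delta> \<le> \<epsilon>" unfolding e using \<delta>0 by (intro mult_right_mono) auto
    note \<delta> = \<delta>0 e2 e3
    define Q' where "Q' = Q \<union> (\<lambda>(g, h). g * h) ` (Q \<times> Q) \<union> ((\<lambda>(g, h). g + h) ` (Q \<times> Q) \<inter> P) \<union> f ` {..m}"
    have Q'fin: "finite Q'" using Q(1) by (simp add: Q'_def)
    have "g * h \<in> P" if "g \<in> Q" "h \<in> Q" for g h using that Q(2) by (intro P) auto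
    then have Q'P: "Q' \<subseteq> P" using Q(2) f by (auto simp: Q'_def)
    obtain x l where x: "x \<in> zeros J" "l > 0" "ln 2 \<le> \<delta> * l"
      "\<forall>g\<in>Q'. g x \<noteq> 0 \<and> - \<delta> \<le> - ln (cmod (g x)) / l \<and> - ln (cmod (g x)) / l \<le> c g"
      "\<forall>j\<le>m. f j x \<noteq> 0 \<and> a j - \<delta> \<le> - ln (cmod (f j x)) / l"
      "(\<Sum>j\<le>m. - ln (cmod (f j x)) / l) \<le> (\<Sum>j\<le>m. a j) + (real m + 2) * \<delta>"
      using approx[OF Q'fin Q'P \<delta>(1)] by - ((erule bexE exE conjE)+, rule that)
    define t where "t = (\<lambda>g::('v \<Rightarrow> complex) \<Rightarrow> complex. - ln (cmod (g x)) / l)"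
    \<comment> \<open>truncation puts the function into the compact box and changes it by at most \<open>\<delta>\<close> on \<open>Q'\<close>\<close>
    define v where "v = (\<lambda>g. max 0 (min (c' g) (t g)))"
    have nz: "g x \<noteq> 0" if "g \<in> Q'" for g using x(4) that by blast
    have vt: "t g \<le> v g" "v g \<le> t g + \<delta>" if "g \<in> Q'" for g
    proof -
      have "- \<delta> \<le> t g" "t g \<le> c g" using x(4) that by (auto simp: t_def)
      then show "t g \<le> v g" "v g \<le> t g + \<delta>" using \<delta>(1) by (auto simp: v_def c'_def)
    qed
    have "v \<in> K" by (auto simp: K_def v_def c'_def)
    moreover have "v \<in> T1 Q \<epsilon>"
    proof -
      have "v (g * h) \<le> v g + v h + \<epsilon> \<and> v g + v h \<le> v (g * h) + \<epsilon>" if gh: "g \<in> Q" "h \<in> Q" for g h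
      proof -
        have Q3: "g \<in> Q'" "h \<in> Q'" "g * h \<in> Q'" using gh by (auto simp: Q'_def)
        have "t (g * h) = t g + t h"
          using nz[OF Q3(1)] nz[OF Q3(2)] by (simp add: t_def pointwise norm_mult ln_mult add_divide_distrib diff_divide_distrib)
        then show ?thesis using vt[OF Q3(1)] vt[OF Q3(2)] vt[OF Q3(3)] \<delta> by linarith
      qed
      then show ?thesis by (auto simp: T1_def)
    qed
    moreover have "v \<in> T2 Q \<epsilon>"
    proof -
      have "min (v g) (v h) \<le> v (g + h) + \<epsilon>" if gh: "g \<in> Q" "h \<in> Q" "g + h \<in> P" for g h
      proof -
        have Q3: "g \<in> Q'" "h \<in> Q'" "g + h \<in> Q'" using gh by (auto simp: Q'_def)
        define M where "M = max (cmod (g x)) (cmod (h x))"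
        have M: "M > 0" "cmod (g x) \<le> M" "cmod (h x) \<le> M" using nz[OF Q3(1)] by (auto simp: M_def less_max_iff_disj)
        have "cmod ((g + h) x) \<le> 2 * M" using M(2,3) norm_triangle_ineq[of "g x" "h x"] by (simp add: pointwise)
        then have "ln (cmod ((g + h) x)) \<le> ln (2 * M)" using nz[OF Q3(3)] M(1) by (subst ln_le_cancel_iff) auto
        also have "\<dots> = ln 2 + ln M" using M(1) by (simp add: ln_mult)
        finally have "ln (cmod ((g + h) x)) \<le> \<delta> * l + ln M" using x(3) by simp
        then have "- ln M / l - \<delta> \<le> t (g + h)" using x(2) by (simp add: t_def field_simps)
        moreover have "- ln M / l = t g \<or> - ln M / l = t h" by (auto simp: M_def t_def max_def)
        ultimately show ?thesis using vt[OF Q3(1)] vt[OF Q3(2)] vt[OF Q3(3)] \<delta> by linarith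
      qed
      then show ?thesis by (auto simp: T2_def simp del: min_le_iff_disj)
    qed
    moreover have "v \<in> T3 Q \<epsilon>"
    proof -
      have "v g \<le> v h + \<epsilon>" if gh: "g \<in> Q" "h \<in> Q" "g - h \<in> J" for g h
      proof -
        have Q3: "g \<in> Q'" "h \<in> Q'" using gh by (auto simp: Q'_def)
        have "(g - h) x = 0" using x(1) gh(3) unfolding zeros_def by blast
        then have "g x = h x" by (simp add: pointwise)
        then have "t g = t h" by (simp add: t_def)
        then show ?thesis using vt[OF Q3(1)] vt[OF Q3(2)] \<delta> by linarith
      qed
      then show ?thesis by (auto simp: T3_def)
    qed
    moreover have "v \<in> T4 \<epsilon>"
    proof -
      have fQ: "f j \<in> Q'" if "j \<le> m" for j using that by (auto simp: Q'_def)
      have "a j \<le> v (f j) + \<epsilon>" if j: "j \<le> m" for j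
        using x(5)[rule_format, OF j] vt[OF fQ[OF j]] \<delta> by (simp add: t_def)
      moreover have "(\<Sum>j\<le>m. v (f j)) \<le> (\<Sum>j\<le>m. a j) + \<epsilon>"
      proof -
        have "(\<Sum>j\<le>m. v (f j)) \<le> (\<Sum>j\<le>m. t (f j) + \<delta>)" using vt fQ by (intro sum_mono) auto
        also have "\<dots> = (\<Sum>j\<le>m. t (f j)) + (real m + 1) * \<delta>" by (simp add: sum.distrib)
        also have "(\<Sum>j\<le>m. t (f j)) = (\<Sum>j\<le>m. - ln (cmod (f j x)) / l)" by (simp only: t_def)
        also have "(\<Sum>j\<le>m. - ln (cmod (f j x)) / l) + (real m + 1) * \<delta> \<le> (\<Sum>j\<le>m. a j) + \<epsilon>"
          using x(6) \<delta>(3) by linarith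
        finally show ?thesis .
      qed
      ultimately show ?thesis by (auto simp: T4_def)
    qed
    ultimately show ?thesis by (auto simp: T_def)
  qed
  have "K \<inter> \<Inter>(T ` Idx) \<noteq> {}"
  proof (rule compact_imp_fip)
    show "compact K" unfolding K_def by (rule compact_box_fun)
    show "closed S" if "S \<in> T ` Idx" for S using that clos by blast
    fix \<F> assume \<F>: "finite \<F>" "\<F> \<subseteq> T ` Idx"
    then obtain I0 where I0: "finite I0" "I0 \<subseteq> Idx" "\<F> = T ` I0" by (meson finite_subset_image)
    define Q where "Q = (\<Union>(Q, \<epsilon>)\<in>I0. Q)"
    define \<epsilon> where "\<epsilon> = Min (insert 1 (snd ` I0))"
    have "finite Q" "Q \<subseteq> P" using I0 unfolding Q_def Idx_def by auto
    moreover have "\<epsilon> > 0" using I0 unfolding \<epsilon>_def Idx_def by auto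
    ultimately have ne: "K \<inter> T (Q, \<epsilon>) \<noteq> {}" by (rule nonempty)
    have "T (Q, \<epsilon>) \<subseteq> T i" if i: "i \<in> I0" for i
    proof -
      obtain Q' \<epsilon>' where i': "i = (Q', \<epsilon>')" by (cases i)
      have "Q' \<subseteq> Q" using i unfolding Q_def i' by auto
      moreover have "\<epsilon> \<le> \<epsilon>'" unfolding \<epsilon>_def using I0(1) i by (intro Min_le) (auto simp: i' image_iff intro: bexI[of _ i])
      ultimately show ?thesis unfolding i' by (rule mono)
    qed
    then show "K \<inter> \<Inter>\<F> \<noteq> {}" using ne unfolding I0(3) by blast
  qed
  then obtain v where vK: "v \<in> K" and vT: "\<And>i. i \<in> Idx \<Longrightarrow> v \<in> T i" by blast
  have vT': "v \<in> T (Q, \<epsilon>)" if "finite Q" "Q \<subseteq> P" "\<epsilon> > 0" for Q \<epsilon> using vT[of "(Q, \<epsilon>)"] that by (simp add: Idx_def)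
  have le: "(x::real) \<le> y" if "\<And>\<epsilon>. \<epsilon> > 0 \<Longrightarrow> x \<le> y + \<epsilon>" for x y using that by (rule field_le_epsilon)
  have mul: "v (g * h) = v g + v h" if gh: "g \<in> P" "h \<in> P" for g h
  proof (rule antisym; rule le)
    fix \<epsilon> :: real assume "\<epsilon> > 0"
    then have "v \<in> T1 {g, h} \<epsilon>" using vT'[of "{g, h}" \<epsilon>] gh by (simp add: T_def)
    then show "v (g * h) \<le> v g + v h + \<epsilon>" "v g + v h \<le> v (g * h) + \<epsilon>" by (auto simp: T1_def)
  qed
  have add: "min (v g) (v h) \<le> v (g + h)" if gh: "g \<in> P" "h \<in> P" "g + h \<in> P" for g h
  proof (rule le)
    fix \<epsilon> :: real assume "\<epsilon> > 0"
    then have "v \<in> T2 {g, h} \<epsilon>" using vT'[of "{g, h}" \<epsilon>] gh by (simp add: T_def)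
    then show "min (v g) (v h) \<le> v (g + h) + \<epsilon>" using gh(3) by (auto simp: T2_def simp del: min_le_iff_disj)
  qed
  have cong1: "v g \<le> v h" if gh: "g \<in> P" "h \<in> P" "g - h \<in> J" for g h
  proof (rule le)
    fix \<epsilon> :: real assume "\<epsilon> > 0"
    then have "v \<in> T3 {g, h} \<epsilon>" using vT'[of "{g, h}" \<epsilon>] gh by (simp add: T_def)
    then show "v g \<le> v h + \<epsilon>" using gh(3) by (auto simp: T3_def)
  qed
  have cong: "v g = v h" if gh: "g \<in> P" "h \<in> P" "g - h \<in> J" for g h
  proof (rule antisym)
    have "- (g - h) = h - g" by (rule minus_diff_eq)
    then have "h - g \<in> J" using J[OF gh(3)] by (simp only:)
    then show "v h \<le> v g" by (rule cong1[OF gh(2,1)])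
  qed (rule cong1[OF gh])
  have T4: "v \<in> T4 \<epsilon>" if "\<epsilon> > 0" for \<epsilon> using vT'[of "{}" \<epsilon>] that by (simp add: T_def)
  have lower: "a j \<le> v (f j)" if j: "j \<le> m" for j
    by (rule le) (use T4 j in \<open>auto simp: T4_def\<close>)
  have upper: "(\<Sum>j\<le>m. v (f j)) \<le> (\<Sum>j\<le>m. a j)"
    by (rule le) (use T4 in \<open>auto simp: T4_def\<close>)
  have eq: "v (f j) = a j" if j: "j \<le> m" for j
  proof (rule ccontr)
    assume "v (f j) \<noteq> a j"
    then have "a j < v (f j)" using lower[OF j] by simp
    then have "(\<Sum>j\<le>m. a j) < (\<Sum>j\<le>m. v (f j))" using lower j by (intro sum_strict_mono_ex1) auto
    then show False using upper by simp
  qed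
  show ?thesis
  proof (intro exI[of _ v] conjI ballI allI impI)
    show "0 \<le> v g" for g using vK by (simp add: K_def)
  qed (simp_all add: mul add cong eq)
qed

section \<open>Points realizing a valuation\<close>

text \<open>The ring generated over the coordinate ring by the quotients \<open>g i / G\<close> is the coordinate ring of a
  variety in \<open>N + m\<close> variables, with prime ideal \<open>J'\<close>. By \<open>less\<close>, the valuation extends to a nonnegative
  one on this ring, and the elements of positive valuation form a proper ideal \<open>q\<close>. At a zero of \<open>q\<close> the
  quotients vanish, hence so do the \<open>g i\<close>, and by \<open>origin\<close> the zero lies over the origin. A small move
  within the zeros of \<open>J'\<close> makes \<open>G\<close> nonzero and keeps the quotients small.\<close>

lemma points_from_valuation_quotients:
  fixes N m :: nat and v :: "((nat \<Rightarrow> complex) \<Rightarrow> complex) \<Rightarrow> real"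
    and J :: "((nat \<Rightarrow> complex) \<Rightarrow> complex) set"
  defines "P \<equiv> polyfun {..<N} - J"
  assumes J: "poly_prime {..<N} J"
    and v_nonneg: "\<And>u. u \<in> P \<Longrightarrow> v u \<ge> 0"
    and v_mult: "\<And>u w. u \<in> P \<Longrightarrow> w \<in> P \<Longrightarrow> v (u * w) = v u + v w"
    and v_add: "\<And>u w. u \<in> P \<Longrightarrow> w \<in> P \<Longrightarrow> u + w \<in> P \<Longrightarrow> min (v u) (v w) \<le> v (u + w)"
    and v_cong: "\<And>u w. u \<in> P \<Longrightarrow> w \<in> P \<Longrightarrow> u - w \<in> J \<Longrightarrow> v u = v w"
    and v_const: "\<And>c. c \<noteq> 0 \<Longrightarrow> v (\<lambda>_. c) = 0"
    and G: "G \<in> P" and g: "\<And>i. i < m \<Longrightarrow> g i \<in> P" and less: "\<And>i. i < m \<Longrightarrow> v G < v (g i)"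
    and origin: "\<And>x. x \<in> zeros J \<Longrightarrow> (\<forall>i<m. g i x = 0) \<Longrightarrow> (\<forall>i<N. x i = 0)"
    and \<epsilon>: "\<epsilon> > 0"
  shows "\<exists>x\<in>zeros J. (\<forall>i<N. cmod (x i) \<le> \<epsilon>) \<and> G x \<noteq> 0 \<and> (\<forall>i<m. cmod (g i x) \<le> \<epsilon> * cmod (G x))"
proof -
  interpret poly_prime "{..<N}" J by fact
  define ge where "ge = (\<lambda>r u. u \<in> polyfun {..<N} \<and> (u \<in> J \<or> r \<le> v u))"
  define gt where "gt = (\<lambda>r u. u \<in> polyfun {..<N} \<and> (u \<in> J \<or> r < v u))"
  have GP: "G \<in> polyfun {..<N}" "G \<notin> J" using G by (auto simp: P_def)
  have gP: "g i \<in> polyfun {..<N}" "g i \<notin> J" if "i < m" for i using g[OF that] by (auto simp: P_def)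
  have JP: "u \<in> polyfun {..<N}" if "u \<in> J" for u using that J_sub by blast
  have add_cases: "r \<le> v (u + w)" if "u \<in> polyfun {..<N}" "w \<in> polyfun {..<N}" "u + w \<notin> J"
    "u \<in> J \<or> r \<le> v u" "w \<in> J \<or> r \<le> v w" for u w r
  proof -
    have uw: "u + w \<in> P" using that polyfun.add[of u "{..<N}" w] by (simp add: P_def)
    consider "u \<in> J" "w \<notin> J" | "w \<in> J" "u \<notin> J" | "u \<notin> J" "w \<notin> J" | "u \<in> J" "w \<in> J" by blast
    then show ?thesis
    proof cases
      case 1
      then have "w \<in> P" using that(2) by (simp add: P_def)
      then have "v (u + w) = v w" by (rule v_cong[OF uw]) (use 1 in simp)
      then show ?thesis using that(5) 1 by simp
    next
      case 2
      then have "u \<in> P" using that(1) by (simp add: P_def)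
      then have "v (u + w) = v u" by (rule v_cong[OF uw]) (use 2 in simp)
      then show ?thesis using that(4) 2 by simp
    next
      case 3
      then have "u \<in> P" "w \<in> P" using that(1,2) by (simp_all add: P_def)
      then have "min (v u) (v w) \<le> v (u + w)" using uw by (rule v_add)
      then show ?thesis using that(4,5) 3 by linarith
    next
      case 4
      then show ?thesis using J_add that(3) by blast
    qed
  qed
  have ge_add: "ge r (u + w)" if "ge r u" "ge r w" for r u w
    using that add_cases[of u w r] polyfun.add[of u "{..<N}" w] unfolding ge_def by blast
  have gt_add: "gt r (u + w)" if "gt r u" "gt r w" for r u w
  proof (cases "u + w \<in> J")
    case True
    then show ?thesis using JP by (simp add: gt_def)
  next
    case False
    define r' where "r' = (if u \<in> J then v w else if w \<in> J then v u else min (v u) (v w))"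
    have "r' \<le> v (u + w)" using that False by (intro add_cases) (auto simp: gt_def r'_def)
    moreover have "r < r'" using that False J_add[of u w] by (auto simp: gt_def r'_def)
    ultimately show ?thesis using that polyfun.add[of u "{..<N}" w] by (simp add: gt_def)
  qed
  have mult_val: "v (u * w) = v u + v w" if "u \<in> polyfun {..<N}" "w \<in> polyfun {..<N}" "u \<notin> J" "w \<notin> J" for u w
    using that by (intro v_mult) (simp_all add: P_def)
  have ge_mult: "ge (r + s) (u * w)" if "ge r u" "ge s w" for r s u w
    using that mult_val[of u w] J_mult[of u w] J_mult'[of u w] polyfun.mult[of u "{..<N}" w]
    unfolding ge_def by (cases "u \<in> J"; cases "w \<in> J") auto
  have ge_gt_mult: "gt (r + s) (u * w)" if "ge r u" "gt s w" for r s u w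
    using that mult_val[of u w] J_mult[of u w] J_mult'[of u w] polyfun.mult[of u "{..<N}" w]
    unfolding ge_def gt_def by (cases "u \<in> J"; cases "w \<in> J") auto
  have J_gt: "gt r u" if "u \<in> J" for r u using that JP by (simp add: gt_def)
  have Gpow: "G ^ k \<in> polyfun {..<N}" "G ^ k \<notin> J" "v (G ^ k) = real k * v G" for k
  proof -
    show pw: "G ^ k \<in> polyfun {..<N}" for k using GP(1) by (rule polyfun_power)
    have nin: "G ^ k \<notin> J" for k
    proof (induction k)
      case 0
      then show ?case using J_proper by simp
    next
      case (Suc k)
      then show ?case using prime[OF GP(1) pw[of k]] GP(2) by auto
    qed
    then show "G ^ k \<notin> J" .
    have v1: "v 1 = 0" using v_const[of 1] by (simp add: one_fun_def)
    show "v (G ^ k) = real k * v G"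
    proof (induction k)
      case (Suc k)
      then show ?case using mult_val[OF GP(1) pw[of k] GP(2) nin[of k]] by (simp add: algebra_simps)
    qed (simp add: v1)
  qed
  have ge_Gpow: "ge (real k * v G) (G ^ k)" for k using Gpow[of k] by (simp add: ge_def)
  \<comment> \<open>\<open>hom x\<close> is the point over \<open>x\<close>, and \<open>clr p K u\<close> says that \<open>u\<close> is \<open>p\<close> with denominators cleared by \<open>G ^ K\<close>\<close>
  define hom where "hom = (\<lambda>x i. if i < N then x i else g (i - N) x / G x)"
  define clr where "clr = (\<lambda>p K u. u \<in> polyfun {..<N} \<and> (\<forall>x. G x \<noteq> 0 \<longrightarrow> u x = G x ^ K * p (hom x)))"
  have clr_add: "clr (p1 + p2) (K1 + K2) (G ^ K2 * u1 + G ^ K1 * u2)" if "clr p1 K1 u1" "clr p2 K2 u2" for p1 p2 K1 K2 u1 u2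
    using that Gpow(1) unfolding clr_def
    by (intro conjI polyfun.add polyfun.mult) (auto simp: pointwise power_add algebra_simps)
  have clr_mult: "clr (p1 * p2) (K1 + K2) (u1 * u2)" if "clr p1 K1 u1" "clr p2 K2 u2" for p1 p2 K1 K2 u1 u2
    using that unfolding clr_def
    by (intro conjI polyfun.mult) (auto simp: pointwise power_add algebra_simps)
  have clr_base: "clr p 0 p" if "p \<in> polyfun {..<N}" for p
  proof -
    have "p (hom x) = p x" for x by (rule polyfun_cong[OF that]) (simp add: hom_def)
    then show ?thesis using that by (simp add: clr_def)
  qed
  have clr_unique: "G ^ K' * u * G = G ^ K * u' * G" if "clr p K u" "clr p K' u'" for p K K' u u'
  proof
    fix x show "(G ^ K' * u * G) x = (G ^ K * u' * G) x"
      using that unfolding clr_def by (cases "G x = 0") (auto simp: pointwise algebra_simps)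
  qed
  have clr_frac: "clr (\<lambda>x. x (N + i)) 1 (g i)" if "i < m" for i
    using gP(1)[OF that] by (simp add: clr_def hom_def)
  have clr_ex: "\<exists>K u. clr p K u \<and> ge (real K * v G) u" if "p \<in> polyfun {..<N + m}" for p
    using that
  proof induction
    case (const c)
    have "ge 0 (\<lambda>_. c)" using v_const[of c] J_0 polyfun.const[of c "{..<N}"]
      by (cases "c = 0") (auto simp: ge_def zero_fun_def)
    then show ?case using clr_base[OF polyfun.const[of c]] by (intro exI[of _ 0] exI[of _ "\<lambda>_. c"]) simp
  next
    case (var i)
    show ?case
    proof (cases "i < N")
      case True
      then have xi: "(\<lambda>x. x i) \<in> polyfun {..<N}" by (intro polyfun.var) simp
      then have "ge 0 (\<lambda>x. x i)" using v_nonneg[of "\<lambda>x. x i"] by (auto simp: ge_def P_def)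
      then show ?thesis using clr_base[OF xi] by (intro exI[of _ 0] exI[of _ "\<lambda>x. x i"]) simp
    next
      case False
      then have i: "i - N < m" "i = N + (i - N)" using var by auto
      have "ge (real 1 * v G) (g (i - N))" using less[OF i(1)] gP[OF i(1)] by (simp add: ge_def)
      then show ?thesis using clr_frac[OF i(1)] i(2) by (intro exI[of _ 1] exI[of _ "g (i - N)"]) simp
    qed
  next
    case (add p q)
    then obtain K1 u1 K2 u2 where *: "clr p K1 u1" "ge (real K1 * v G) u1" "clr q K2 u2" "ge (real K2 * v G) u2" by blast
    have "ge (real (K1 + K2) * v G) (G ^ K2 * u1 + G ^ K1 * u2)"
      using ge_add[of "real (K1 + K2) * v G" "G ^ K2 * u1" "G ^ K1 * u2"]
        ge_mult[OF ge_Gpow[of K2] *(2)] ge_mult[OF ge_Gpow[of K1] *(4)] by (simp add: algebra_simps)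
    then show ?case using clr_add[OF *(1,3)] by blast
  next
    case (mult p q)
    then obtain K1 u1 K2 u2 where *: "clr p K1 u1" "ge (real K1 * v G) u1" "clr q K2 u2" "ge (real K2 * v G) u2" by blast
    have "ge (real (K1 + K2) * v G) (u1 * u2)" using ge_mult[OF *(2,4)] by (simp add: algebra_simps)
    then show ?case using clr_mult[OF *(1,3)] by blast
  qed
  \<comment> \<open>the ideal of relations, and that of the elements \<open>u / G ^ K\<close> of positive valuation\<close>
  define J' where "J' = {p \<in> polyfun {..<N + m}. \<exists>K u. clr p K u \<and> u \<in> J}"
  define q where "q = {p \<in> polyfun {..<N + m}. \<exists>K u. clr p K u \<and> gt (real K * v G) u}"
  have clr_0: "clr 0 0 0" using clr_base[of 0] by simp
  have clr_1: "clr 1 0 1" using clr_base[of 1] by simp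
  have pw_cancel: "u \<in> J" if "G ^ k * u * G \<in> J" "u \<in> polyfun {..<N}" for k u
  proof -
    have "G ^ k * u \<in> J" using prime[OF polyfun.mult[OF Gpow(1) that(2)] GP(1) that(1)] GP(2) by blast
    then show ?thesis using prime[OF Gpow(1) that(2)] Gpow(2) by blast
  qed
  have J'_prime: "poly_prime {..<N + m} J'"
  proof unfold_locales
    show "J' \<subseteq> polyfun {..<N + m}" by (auto simp: J'_def)
    show "0 \<in> J'" unfolding J'_def using clr_0 J_0 by auto
  next
    fix p r assume "p \<in> J'" "r \<in> J'"
    then obtain K1 u1 K2 u2 where *: "p \<in> polyfun {..<N + m}" "r \<in> polyfun {..<N + m}"
      "clr p K1 u1" "u1 \<in> J" "clr r K2 u2" "u2 \<in> J" unfolding J'_def by blast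
    have "G ^ K2 * u1 + G ^ K1 * u2 \<in> J" using * Gpow(1) by (intro J_add J_mult)
    then show "p + r \<in> J'" unfolding J'_def using clr_add[OF *(3,5)] polyfun.add[OF *(1,2)] by blast
  next
    fix p r assume p: "p \<in> polyfun {..<N + m}" and "r \<in> J'"
    then obtain K2 u2 where *: "r \<in> polyfun {..<N + m}" "clr r K2 u2" "u2 \<in> J" unfolding J'_def by blast
    obtain K1 u1 where **: "clr p K1 u1" using clr_ex[OF p] by blast
    have "u1 * u2 \<in> J" using ** *(3) by (intro J_mult) (auto simp: clr_def)
    then show "p * r \<in> J'" unfolding J'_def using clr_mult[OF ** *(2)] polyfun.mult[OF p *(1)] by blast
  next
    show "1 \<notin> J'"
    proof
      assume "1 \<in> J'"
      then obtain K u where *: "clr 1 K u" "u \<in> J" unfolding J'_def by blast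
      have "G ^ K * 1 * G = G ^ 0 * u * G" by (rule clr_unique[OF clr_1 *(1)])
      moreover have "G ^ 0 * u * G \<in> J" using *(2) GP(1) Gpow(1) by (intro J_mult' J_mult)
      ultimately have "G ^ K * 1 * G \<in> J" by (simp only:)
      then show False using pw_cancel[of K 1] J_proper by simp
    qed
  next
    fix p r assume p: "p \<in> polyfun {..<N + m}" and r: "r \<in> polyfun {..<N + m}" and "p * r \<in> J'"
    then obtain K u where *: "clr (p * r) K u" "u \<in> J" unfolding J'_def by blast
    obtain K1 u1 where 1: "clr p K1 u1" using clr_ex[OF p] by blast
    obtain K2 u2 where 2: "clr r K2 u2" using clr_ex[OF r] by blast
    have u12: "u1 \<in> polyfun {..<N}" "u2 \<in> polyfun {..<N}" using 1 2 by (auto simp: clr_def)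
    have "G ^ K * (u1 * u2) * G = G ^ (K1 + K2) * u * G" by (rule clr_unique[OF clr_mult[OF 1 2] *(1)])
    moreover have "G ^ (K1 + K2) * u * G \<in> J" using *(2) GP(1) Gpow(1) by (intro J_mult' J_mult)
    ultimately have "G ^ K * (u1 * u2) * G \<in> J" by (simp only:)
    then have "u1 * u2 \<in> J" using pw_cancel polyfun.mult[OF u12] by blast
    then have "u1 \<in> J \<or> u2 \<in> J" by (rule prime[OF u12])
    then show "p \<in> J' \<or> r \<in> J'" unfolding J'_def using 1 2 p r by blast
  qed
  have q_ideal: "poly_ideal {..<N + m} q"
  proof unfold_locales
    show "q \<subseteq> polyfun {..<N + m}" by (auto simp: q_def)
    show "0 \<in> q" unfolding q_def using clr_0 J_gt[OF J_0] by auto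
  next
    fix p r assume "p \<in> q" "r \<in> q"
    then obtain K1 u1 K2 u2 where *: "p \<in> polyfun {..<N + m}" "r \<in> polyfun {..<N + m}"
      "clr p K1 u1" "gt (real K1 * v G) u1" "clr r K2 u2" "gt (real K2 * v G) u2" unfolding q_def by blast
    have "gt (real (K1 + K2) * v G) (G ^ K2 * u1 + G ^ K1 * u2)"
      using gt_add[of "real (K1 + K2) * v G" "G ^ K2 * u1" "G ^ K1 * u2"]
        ge_gt_mult[OF ge_Gpow[of K2] *(4)] ge_gt_mult[OF ge_Gpow[of K1] *(6)] by (simp add: algebra_simps)
    then show "p + r \<in> q" unfolding q_def using clr_add[OF *(3,5)] polyfun.add[OF *(1,2)] by blast
  next
    fix p r assume p: "p \<in> polyfun {..<N + m}" and "r \<in> q"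
    then obtain K2 u2 where *: "r \<in> polyfun {..<N + m}" "clr r K2 u2" "gt (real K2 * v G) u2" unfolding q_def by blast
    obtain K1 u1 where **: "clr p K1 u1" "ge (real K1 * v G) u1" using clr_ex[OF p] by blast
    have "gt (real (K1 + K2) * v G) (u1 * u2)" using ge_gt_mult[OF **(2) *(3)] by (simp add: algebra_simps)
    then show "p * r \<in> q" unfolding q_def using clr_mult[OF **(1) *(2)] polyfun.mult[OF p *(1)] by blast
  next
    show "1 \<notin> q"
    proof
      assume "1 \<in> q"
      then obtain K u where *: "clr 1 K u" "gt (real K * v G) u" unfolding q_def by blast
      have uP: "u \<in> polyfun {..<N}" using * by (simp add: clr_def)
      have "G ^ K * 1 * G = G ^ 0 * u * G" by (rule clr_unique[OF clr_1 *(1)])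
      then have eq: "G ^ Suc K = u * G" by (simp add: mult.commute)
      have "u \<notin> J"
      proof
        assume "u \<in> J"
        then have "G ^ Suc K \<in> J" unfolding eq using GP(1) by (rule J_mult')
        then show False using Gpow(2)[of "Suc K"] by blast
      qed
      then have "v (u * G) = v u + v G" using uP GP by (intro mult_val)
      then have "v u = real K * v G" using Gpow(3)[of "Suc K"] unfolding eq by (simp add: algebra_simps)
      then show False using *(2) \<open>u \<notin> J\<close> by (simp add: gt_def)
    qed
  qed
  have mono: "u \<in> polyfun {..<N + m}" if "u \<in> polyfun {..<N}" for u
    by (rule polyfun_mono[OF _ that]) auto
  have J_J': "u \<in> J'" if "u \<in> J" for u
    using clr_base[OF JP[OF that]] mono[OF JP[OF that]] that unfolding J'_def by blast
  have J'_q: "p \<in> q" if "p \<in> J'" for p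
    using that J_gt unfolding J'_def q_def by blast
  have rel: "G * (\<lambda>x. x (N + i)) - g i \<in> J'" if i: "i < m" for i
  proof -
    have "clr (G * (\<lambda>x. x (N + i)) - g i) 0 0"
    proof -
      have "G (hom x) = G x" "g i (hom x) = g i x" for x
        by (rule polyfun_cong[OF GP(1)], simp add: hom_def, rule polyfun_cong[OF gP(1)[OF i]], simp add: hom_def)
      then show ?thesis by (simp add: clr_def pointwise hom_def)
    qed
    moreover have "G * (\<lambda>x. x (N + i)) - g i \<in> polyfun {..<N + m}"
      using i by (intro polyfun_diff polyfun.mult mono GP gP polyfun.var) auto
    ultimately show ?thesis unfolding J'_def using J_0 by blast
  qed
  have rel0: "g i x = G x * x (N + i)" if "i < m" "x \<in> zeros J'" for i x
  proof -
    have "(G * (\<lambda>x. x (N + i)) - g i) x = 0" using rel[OF that(1)] that(2) unfolding zeros_def by blast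
    then show ?thesis by (simp add: pointwise)
  qed
  have zJ: "x \<in> zeros J" if "x \<in> zeros J'" for x using that J_J' unfolding zeros_def by blast
  have GJ': "G \<notin> J'"
  proof
    assume "G \<in> J'"
    then obtain K u where *: "clr G K u" "u \<in> J" unfolding J'_def by blast
    have "G ^ K * G * G = G ^ 0 * u * G" by (rule clr_unique[OF clr_base[OF GP(1)] *(1)])
    moreover have "G ^ 0 * u * G \<in> J" using *(2) GP(1) Gpow(1) by (intro J_mult' J_mult)
    ultimately have "G ^ K * G * G \<in> J" by (simp only:)
    then show False using pw_cancel[OF _ GP(1)] GP(2) by blast
  qed
  obtain x where x: "x \<in> zeros q" using nullstellensatz[OF q_ideal] by blast
  have xJ': "x \<in> zeros J'" using x J'_q unfolding zeros_def by blast
  have frac0: "x (N + i) = 0" if i: "i < m" for i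
  proof -
    have gt: "gt (real 1 * v G) (g i)" using less[OF i] gP[OF i] by (simp add: gt_def)
    have var: "(\<lambda>x. x (N + i)) \<in> polyfun {..<N + m}" using i by (intro polyfun.var) simp
    have "(\<lambda>x. x (N + i)) \<in> q"
      unfolding q_def mem_Collect_eq
      by (rule conjI[OF var], rule exI[of _ 1], rule exI[of _ "g i"], rule conjI[OF clr_frac[OF i] gt])
    moreover have "\<forall>p\<in>q. p x = 0" using x by (simp add: zeros_def)
    ultimately show ?thesis by (rule bspec[rotated])
  qed
  have "\<forall>j<m. g j x = 0"
  proof (intro allI impI)
    fix j assume j: "j < m"
    have "g j x = G x * x (N + j)" by (rule rel0[OF j xJ'])
    then show "g j x = 0" using frac0[OF j] by simp
  qed
  from origin[OF zJ[OF xJ'] this] have x0: "x i = 0" if "i < N" for i using that by simp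
  define B where "B = (\<Sum>i<N + m. cmod (x i))"
  have xB: "\<forall>i<N + m. cmod (x i) \<le> B" unfolding B_def by (auto intro!: member_le_sum)
  obtain C D c where CD: "C > 0" "D > 0" and c: "\<forall>Q. finite Q \<longrightarrow> Q \<subseteq> polyfun {..<N + m} - J' \<longrightarrow>
    (\<exists>s0>0. \<forall>s x. 0 < s \<longrightarrow> s < s0 \<longrightarrow> x \<in> zeros J' \<longrightarrow> (\<forall>i<N + m. cmod (x i) \<le> B) \<longrightarrow>
      (\<exists>x'\<in>zeros J'. (\<forall>i<N + m. cmod (x' i - x i) \<le> C * s) \<and> (\<forall>g\<in>Q. cmod (g x') \<ge> (s ^ D) ^ c g)))"
    using move_to_general_position[OF J'_prime, of B] by - ((erule exE conjE)+, rule that)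
  have "finite {G}" "{G} \<subseteq> polyfun {..<N + m} - J'" using GJ' mono[OF GP(1)] by auto
  from c[THEN spec, THEN mp, THEN mp, OF this]
  obtain s0 where s0: "s0 > 0" "\<forall>s x. 0 < s \<longrightarrow> s < s0 \<longrightarrow> x \<in> zeros J' \<longrightarrow> (\<forall>i<N + m. cmod (x i) \<le> B) \<longrightarrow>
      (\<exists>x'\<in>zeros J'. (\<forall>i<N + m. cmod (x' i - x i) \<le> C * s) \<and> (\<forall>g\<in>{G}. cmod (g x') \<ge> (s ^ D) ^ c g))"
    by - ((erule exE conjE)+, rule that)
  define s where "s = min (s0 / 2) (\<epsilon> / C)"
  have s: "0 < s" "s < s0" "C * s \<le> \<epsilon>"
    using s0(1) \<epsilon> CD(1) by (auto simp: s_def min_def field_simps)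
  obtain x' where x': "x' \<in> zeros J'" "\<forall>i<N + m. cmod (x' i - x i) \<le> C * s" "cmod (G x') \<ge> (s ^ D) ^ c G"
    using s0(2)[rule_format, OF s(1,2) xJ' xB[rule_format]] by blast
  have "(s ^ D) ^ c G > 0" using s(1) by simp
  then have "G x' \<noteq> 0" using x'(3) by auto
  moreover have "cmod (x' i) \<le> \<epsilon>" if "i < N" for i using x'(2)[rule_format, of i] x0[OF that] that s(3) by simp
  moreover have "cmod (g i x') \<le> \<epsilon> * cmod (G x')" if "i < m" for i
  proof -
    have "cmod (x' (N + i)) \<le> \<epsilon>" using x'(2)[rule_format, of "N + i"] frac0[OF that] that s(3) by simp
    then have "cmod (G x') * cmod (x' (N + i)) \<le> cmod (G x') * \<epsilon>" by (rule mult_left_mono) simp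
    then show ?thesis unfolding rel0[OF that x'(1)] by (simp add: norm_mult mult.commute)
  qed
  ultimately show ?thesis using zJ[OF x'(1)] by blast
qed

text \<open>If the inequality failed at the points with \<open>\<bar>f j ^ p j\<bar> \<le> \<epsilon>' \<bar>F ^ N0\<bar>\<close>, then \<open>\<bar>F ^ N0\<bar>\<close> would be at most a
  constant times \<open>\<bar>f j ^ p j\<bar>\<close> for the index \<open>j\<close> of the largest summand of \<open>\<Phi>\<close>, which is impossible for
  small \<open>\<epsilon>'\<close>.\<close>

lemma points_from_valuation:
  fixes N m :: nat and v :: "((nat \<Rightarrow> complex) \<Rightarrow> complex) \<Rightarrow> real" and a :: "nat \<Rightarrow> real"
    and J :: "((nat \<Rightarrow> complex) \<Rightarrow> complex) set"
  defines "P \<equiv> polyfun {..<N} - J"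
  assumes Jprime: "poly_prime {..<N} J"
    and v_nonneg: "\<And>u. u \<in> P \<Longrightarrow> v u \<ge> 0"
    and v_mult: "\<And>u w. u \<in> P \<Longrightarrow> w \<in> P \<Longrightarrow> v (u * w) = v u + v w"
    and v_add: "\<And>u w. u \<in> P \<Longrightarrow> w \<in> P \<Longrightarrow> u + w \<in> P \<Longrightarrow> min (v u) (v w) \<le> v (u + w)"
    and v_cong: "\<And>u w. u \<in> P \<Longrightarrow> w \<in> P \<Longrightarrow> u - w \<in> J \<Longrightarrow> v u = v w"
    and v_const: "\<And>c. c \<noteq> 0 \<Longrightarrow> v (\<lambda>_. c) = 0"
    and f: "\<And>j. j \<le> m \<Longrightarrow> f j \<in> P \<and> v (f j) = a j"
    and a: "\<And>j. 1 \<le> j \<Longrightarrow> j \<le> m \<Longrightarrow> a j > 0" and a0: "a 0 = 0"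
    and f0: "\<And>j. 1 \<le> j \<Longrightarrow> j \<le> m \<Longrightarrow> f j (\<lambda>_. 0) = 0"
    and origin: "\<And>x. x \<in> zeros J \<Longrightarrow> (\<forall>j\<in>{1..m}. f j x = 0) \<Longrightarrow> (\<forall>i<N. x i = 0)"
    and \<epsilon>: "\<epsilon> > 0" and c: "c > (\<Sum>j\<le>m. a j)" and m: "m \<ge> 1" and C: "C > 0"
  shows "\<exists>x\<in>zeros J. (\<forall>i<N. cmod (x i) \<le> \<epsilon>) \<and>
    cmod (\<Prod>j\<le>m. f j x) > C * (\<Sum>j=1..m. cmod (f j x) powr (1 / a j)) powr c"
proof -
  interpret poly_prime "{..<N}" J by fact
  define S where "S = (\<Sum>j\<le>m. a j)"
  have a_nonneg: "a j \<ge> 0" if "j \<le> m" for j using a a0 that by (cases "j = 0") (auto intro: less_imp_le)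
  have aS: "a j \<le> S" if "j \<le> m" for j unfolding S_def using a_nonneg that by (intro member_le_sum) auto
  have S: "S > 0" using aS[of 1] a[of 1] m by simp
  have cS: "c > S" using c by (simp add: S_def)
  have P_mult: "u * w \<in> P" if "u \<in> P" "w \<in> P" for u w
    using that prime[of u w] polyfun.mult[of u "{..<N}" w] by (auto simp: P_def)
  have one: "1 \<in> P" "v 1 = 0" using J_proper v_const[of 1] by (auto simp: P_def one_fun_def[symmetric])
  have pw: "u ^ k \<in> P \<and> v (u ^ k) = real k * v u" if "u \<in> P" for u k
    by (induction k) (use that one P_mult v_mult in \<open>auto simp: algebra_simps\<close>)
  have pr: "(\<Prod>j\<in>A. f j) \<in> P \<and> v (\<Prod>j\<in>A. f j) = (\<Sum>j\<in>A. a j)" if "finite A" "A \<subseteq> {..m}" for A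
    using that
  proof (induction A rule: finite_induct)
    case (insert j A)
    then show ?case using P_mult[of "f j" "prod f A"] v_mult[of "f j" "prod f A"] f[of j] by simp
  qed (use one in simp)
  define F where "F = (\<Prod>j\<le>m. f j)"
  have F: "F \<in> P" "v F = S" using pr[of "{..m}"] by (auto simp: F_def S_def)
  have F_app: "F x = (\<Prod>j\<le>m. f j x)" for x by (simp add: F_def prod_fun_apply)
  \<comment> \<open>large enough for an integer \<open>p j\<close> to exist with \<open>N0 S < p j a j \<le> N0 c\<close>: this interval is longer than \<open>S\<close>, hence than \<open>a j\<close>\<close>
  define N0 where "N0 = nat \<lceil>S / (c - S)\<rceil> + 1"
  have N0: "N0 > 0" "real N0 * (c - S) > S"
  proof -
    have "S / (c - S) < real N0" unfolding N0_def by linarith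
    then show "real N0 * (c - S) > S" using cS by (simp add: field_simps)
  qed (simp add: N0_def)
  define p where "p = (\<lambda>j. nat \<lfloor>real N0 * c / a j\<rfloor>)"
  have p: "real (p j) \<le> real N0 * c / a j" "real (p j) * a j > real N0 * S" "p j > 0" if j: "1 \<le> j" "j \<le> m" for j
  proof -
    have aj: "a j > 0" "a j \<le> S" using a aS j by auto
    have pos: "real N0 * c / a j \<ge> 0" using aj cS S by simp
    show "real (p j) \<le> real N0 * c / a j" using pos unfolding p_def by simp
    have "real (p j) > real N0 * c / a j - 1" using pos unfolding p_def by linarith
    then have 1: "real (p j) * a j > (real N0 * c / a j - 1) * a j" using aj by (intro mult_strict_right_mono) auto
    have 2: "(real N0 * c / a j - 1) * a j = real N0 * c - a j" using aj by (simp add: field_simps)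
    have "real N0 * c - real N0 * S > a j" using N0(2) aj by (simp add: algebra_simps)
    then show *: "real (p j) * a j > real N0 * S" using 1 2 by linarith
    have "real N0 * S \<ge> 0" using S by simp
    then show "p j > 0" using * by (cases "p j = 0") auto
  qed
  define g where "g = (\<lambda>i. f (Suc i) ^ p (Suc i))"
  define W0 where "W0 = C ^ N0 * real m powr (c * real N0)"
  have W0: "W0 > 0" using C m by (simp add: W0_def)
  obtain \<rho> where \<rho>: "\<rho> > 0" "\<And>x. (\<forall>i\<in>{..<N}. cmod (x i) \<le> \<rho>) \<Longrightarrow> (\<Sum>j=1..m. cmod (f j x) powr (1 / a j)) \<le> 1"
  proof -
    have "\<exists>\<rho>>0. \<forall>x. (\<forall>i\<in>{..<N}. cmod (x i) \<le> \<rho>) \<longrightarrow> (\<Sum>j=1..m. cmod (f j x) powr (1 / a j)) \<le> 1"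
      by (rule weight_small_near_0) (use f f0 a in \<open>auto simp: P_def\<close>)
    then show ?thesis using that by blast
  qed
  define \<epsilon>' where "\<epsilon>' = Min {\<epsilon>, \<rho>, 1 / (2 * W0)}"
  have \<epsilon>': "\<epsilon>' > 0" "\<epsilon>' \<le> \<epsilon>" "\<epsilon>' \<le> \<rho>" "\<epsilon>' \<le> 1 / (2 * W0)" using \<epsilon> \<rho>(1) W0 by (auto simp: \<epsilon>'_def)
  have "\<exists>x\<in>zeros J. (\<forall>i<N. cmod (x i) \<le> \<epsilon>') \<and> (F ^ N0) x \<noteq> 0 \<and> (\<forall>i<m. cmod (g i x) \<le> \<epsilon>' * cmod ((F ^ N0) x))"
  proof (rule points_from_valuation_quotients[OF Jprime, of v])
    show "F ^ N0 \<in> polyfun {..<N} - J" using pw[OF F(1)] by (simp add: P_def)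
    show "g i \<in> polyfun {..<N} - J" if "i < m" for i using pw[of "f (Suc i)"] f[of "Suc i"] that by (simp add: g_def P_def)
    show "v (F ^ N0) < v (g i)" if "i < m" for i
      using pw[OF F(1), of N0] pw[of "f (Suc i)" "p (Suc i)"] f[of "Suc i"] p(2)[of "Suc i"] that F(2) by (simp add: g_def)
    show "\<forall>i<N. x i = 0" if "x \<in> zeros J" "\<forall>i<m. g i x = 0" for x
    proof (rule origin[OF that(1)], rule ballI)
      fix j assume "j \<in> {1..m}"
      then obtain i where "j = Suc i" "i < m" by (cases j) auto
      then show "f j x = 0" using that(2)[rule_format, of i] by (simp add: g_def power_fun_apply)
    qed
  qed (use v_nonneg v_mult v_add v_cong v_const \<epsilon>'(1) in \<open>auto simp: P_def\<close>)
  then obtain x where x: "x \<in> zeros J" "\<forall>i<N. cmod (x i) \<le> \<epsilon>'" "(F ^ N0) x \<noteq> 0"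
    "\<forall>i<m. cmod (g i x) \<le> \<epsilon>' * cmod ((F ^ N0) x)" by blast
  define \<Phi> where "\<Phi> = (\<Sum>j=1..m. cmod (f j x) powr (1 / a j))"
  have \<Phi>1: "\<Phi> \<le> 1" unfolding \<Phi>_def using x(2) \<epsilon>'(3) by (intro \<rho>(2)) force
  have \<Phi>0: "\<Phi> \<ge> 0" unfolding \<Phi>_def by (intro sum_nonneg) simp
  have "cmod (F x) > C * \<Phi> powr c"
  proof (rule ccontr)
    assume "\<not> ?thesis"
    then have le: "cmod (F x) \<le> C * \<Phi> powr c" by simp
    define M where "M = Max ((\<lambda>j. cmod (f j x) powr (1 / a j)) ` {1..m})"
    have fin: "finite ((\<lambda>j. cmod (f j x) powr (1 / a j)) ` {1..m})" "(\<lambda>j. cmod (f j x) powr (1 / a j)) ` {1..m} \<noteq> {}"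
      using m by auto
    obtain j where j: "j \<in> {1..m}" "M = cmod (f j x) powr (1 / a j)" using Max_in[OF fin] unfolding M_def by blast
    have aj: "a j > 0" using a j by auto
    have "\<Phi> \<le> (\<Sum>j=1..m. M)" unfolding \<Phi>_def M_def by (intro sum_mono Max_ge[OF fin(1)]) auto
    then have \<Phi>M: "\<Phi> \<le> real m * M" by simp
    have M1: "M \<le> 1"
    proof -
      have "M \<le> \<Phi>" unfolding \<Phi>_def j(2) using j(1) by (intro member_le_sum) auto
      then show ?thesis using \<Phi>1 by simp
    qed
    have fj1: "cmod (f j x) \<le> 1"
    proof (rule ccontr)
      assume "\<not> ?thesis"
      then have "1 < cmod (f j x) powr (1 / a j)" using aj by (intro gr_one_powr) auto
      then show False using M1 j(2) by simp
    qed
    have M0: "M \<ge> 0" using j(2) by simp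
    have "cmod ((F ^ N0) x) = cmod (F x) ^ N0" by (simp add: power_fun_apply norm_power)
    also have "\<dots> \<le> (C * \<Phi> powr c) ^ N0" using le by (intro power_mono) auto
    also have "\<dots> = C ^ N0 * (\<Phi> powr c) powr real N0"
      using N0(1) by (simp add: power_mult_distrib powr_realpow')
    also have "\<dots> = C ^ N0 * \<Phi> powr (c * real N0)" by (simp add: powr_powr)
    also have "\<dots> \<le> C ^ N0 * (real m * M) powr (c * real N0)"
      using \<Phi>M \<Phi>0 C cS S by (intro mult_left_mono powr_mono2) auto
    also have "\<dots> = W0 * M powr (c * real N0)" using M0 by (simp add: W0_def powr_mult)
    also have "M powr (c * real N0) = cmod (f j x) powr (real N0 * c / a j)"
      unfolding j(2) by (simp add: powr_powr mult.commute)
    also have "W0 * cmod (f j x) powr (real N0 * c / a j) \<le> W0 * cmod (f j x) ^ p j"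
    proof (cases "f j x = 0")
      case True
      then show ?thesis using W0 by simp
    next
      case False
      then have "cmod (f j x) powr (real N0 * c / a j) \<le> cmod (f j x) powr real (p j)"
        using fj1 p(1)[of j] j(1) by (intro powr_mono') auto
      also have "\<dots> = cmod (f j x) ^ p j" using False by (simp add: powr_realpow)
      finally show ?thesis using W0 by (intro mult_left_mono) auto
    qed
    also have "\<dots> = W0 * cmod (g (j - 1) x)" using j(1) by (simp add: g_def power_fun_apply norm_power)
    also have "\<dots> \<le> W0 * (\<epsilon>' * cmod ((F ^ N0) x))" using x(4) j(1) W0 by (intro mult_left_mono) auto
    also have "\<dots> \<le> W0 * (1 / (2 * W0) * cmod ((F ^ N0) x))" using \<epsilon>'(4) W0 by (intro mult_left_mono mult_right_mono) auto
    also have "\<dots> = cmod ((F ^ N0) x) / 2" using W0 by simp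
    finally show False using x(3) by simp
  qed
  then show ?thesis using x(1,2) \<epsilon>'(2) unfolding \<Phi>_def F_app by force
qed

section \<open>Density of the regular points\<close>

lemma polyfun_gradient_exists:
  fixes p :: "('n::finite \<Rightarrow> complex) \<Rightarrow> complex"
  assumes "p \<in> polyfun UNIV"
  shows "\<exists>d. (\<forall>i. d i \<in> polyfun UNIV) \<and>
    (\<forall>x :: complex ^ 'n. ((\<lambda>x. p (($) x)) has_derivative (\<lambda>h. \<Sum>i\<in>UNIV. d i (($) x) * h $ i)) (at x))"
  using assms
proof induction
  case (const c)
  show ?case by (intro exI[of _ "\<lambda>_ _. 0"]) (auto intro: polyfun.const)
next
  case (var k)
  have "(\<Sum>i\<in>UNIV. (if i = k then 1 else 0) * h $ i) = h $ k" for h :: "complex ^ 'n"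
    by (simp add: if_distrib[of "\<lambda>c. c * _"] cong: if_cong)
  then have "((\<lambda>x. x $ k) has_derivative (\<lambda>h. \<Sum>i\<in>UNIV. (\<lambda>_. if i = k then 1 else 0) (($) x) * h $ i)) (at x)" for x :: "complex ^ 'n"
    using bounded_linear_imp_has_derivative[OF bounded_linear_vec_nth, of k "at x"] by simp
  then show ?case
    by (intro exI[of _ "\<lambda>i _. if i = k then 1 else 0"]) (auto intro: polyfun.const)
next
  case (add p q)
  then obtain d e where d: "\<And>i. d i \<in> polyfun UNIV" "\<And>x :: complex ^ 'n. ((\<lambda>x. p (($) x)) has_derivative (\<lambda>h. \<Sum>i\<in>UNIV. d i (($) x) * h $ i)) (at x)"
    and e: "\<And>i. e i \<in> polyfun UNIV" "\<And>x :: complex ^ 'n. ((\<lambda>x. q (($) x)) has_derivative (\<lambda>h. \<Sum>i\<in>UNIV. e i (($) x) * h $ i)) (at x)" by blast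
  have "((\<lambda>x. (p + q) (($) x)) has_derivative (\<lambda>h. \<Sum>i\<in>UNIV. (d i + e i) (($) x) * h $ i)) (at x)" for x :: "complex ^ 'n"
    using has_derivative_add[OF d(2) e(2), of x] by (simp add: pointwise sum.distrib distrib_right)
  then show ?case using polyfun.add[OF d(1) e(1)] by (intro exI[of _ "\<lambda>i. d i + e i"]) blast
next
  case (mult p q)
  then obtain d e where d: "\<And>i. d i \<in> polyfun UNIV" "\<And>x :: complex ^ 'n. ((\<lambda>x. p (($) x)) has_derivative (\<lambda>h. \<Sum>i\<in>UNIV. d i (($) x) * h $ i)) (at x)"
    and e: "\<And>i. e i \<in> polyfun UNIV" "\<And>x :: complex ^ 'n. ((\<lambda>x. q (($) x)) has_derivative (\<lambda>h. \<Sum>i\<in>UNIV. e i (($) x) * h $ i)) (at x)" by blast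
  have "((\<lambda>x. (p * q) (($) x)) has_derivative (\<lambda>h. \<Sum>i\<in>UNIV. (p * e i + d i * q) (($) x) * h $ i)) (at x)" for x :: "complex ^ 'n"
  proof -
    have "p (($) x) * (\<Sum>i\<in>UNIV. e i (($) x) * h $ i) + (\<Sum>i\<in>UNIV. d i (($) x) * h $ i) * q (($) x)
        = (\<Sum>i\<in>UNIV. (p * e i + d i * q) (($) x) * h $ i)" for h
      by (simp add: pointwise sum_distrib_left sum_distrib_right sum.distrib[symmetric] algebra_simps)
    then show ?thesis
      using has_derivative_mult[OF d(2) e(2), of x] by (simp add: pointwise)
  qed
  then show ?case using d(1) e(1) mult.hyps
    by (intro exI[of _ "\<lambda>i. p * e i + d i * q"]) (auto intro!: polyfun.add polyfun.mult)
qed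

text \<open>A polynomial function may be built up in several ways, so its partial derivatives are chosen with the
  property that matters instead of being defined by recursion.\<close>

definition partial :: "(('n::finite \<Rightarrow> complex) \<Rightarrow> complex) \<Rightarrow> 'n \<Rightarrow> ('n \<Rightarrow> complex) \<Rightarrow> complex" where
  "partial p = (SOME d. (\<forall>i. d i \<in> polyfun UNIV) \<and>
    (\<forall>x :: complex ^ 'n. ((\<lambda>x. p (($) x)) has_derivative (\<lambda>h. \<Sum>i\<in>UNIV. d i (($) x) * h $ i)) (at x)))"

lemma partial:
  assumes "p \<in> polyfun UNIV"
  shows "partial p i \<in> polyfun UNIV"
    "((\<lambda>x. p (($) x)) has_derivative (\<lambda>h. \<Sum>i\<in>UNIV. partial p i (($) x) * h $ i)) (at x)"
  using someI_ex[OF polyfun_gradient_exists[OF assms]] unfolding partial_def[symmetric] by blast+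

definition gradient :: "(('n::finite \<Rightarrow> complex) \<Rightarrow> complex) \<Rightarrow> complex ^ 'n \<Rightarrow> complex ^ 'n" where
  "gradient p x = (\<chi> i. partial p i (($) x))"

lemma polyfun_det:
  fixes A :: "'n::finite \<Rightarrow> 'n \<Rightarrow> ('v \<Rightarrow> complex) \<Rightarrow> complex"
  assumes "\<And>i j. A i j \<in> polyfun V"
  shows "(\<lambda>x. det ((\<chi> i j. A i j x) :: complex ^ 'n ^ 'n)) \<in> polyfun V"
proof -
  have "(\<lambda>x. det ((\<chi> i j. A i j x) :: complex ^ 'n ^ 'n))
    = (\<Sum>p\<in>{p. p permutes (UNIV::'n set)}. (\<lambda>_. of_int (sign p)) * (\<Prod>i\<in>UNIV. A i (p i)))"
    by (auto simp: fun_eq_iff det_def sum_fun_apply prod_fun_apply pointwise)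
  also have "\<dots> \<in> polyfun V"
    by (intro polyfun_sum polyfun.mult polyfun.const polyfun_prod assms)
  finally show ?thesis .
qed

lemma polyfun_continuous_on:
  fixes p :: "('n::finite \<Rightarrow> complex) \<Rightarrow> complex"
  assumes "p \<in> polyfun UNIV"
  shows "continuous_on A (\<lambda>x :: complex ^ 'n. p (($) x))"
  using assms by induction (auto simp: pointwise intro!: continuous_intros)

lemma holomorphic_polyfun_map:
  assumes "\<And>i. p i \<in> polyfun UNIV"
  shows "holomorphic_map (\<lambda>x :: complex ^ 'n. \<chi> i. p i (($) x)) U"
proof -
  have "(\<Sum>i\<in>UNIV. partial (p k) i (($) x) * (c *s v) $ i) = c * (\<Sum>i\<in>UNIV. partial (p k) i (($) x) * v $ i)" for k c v x
    by (simp add: sum_distrib_left algebra_simps)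
  then show ?thesis
    unfolding holomorphic_map_def holomorphic_fun_def using partial(2)[OF assms] by fastforce
qed

lemma linear_form_polyfun:
  fixes b :: "complex ^ 'n::finite"
  shows "\<exists>p\<in>polyfun UNIV. \<forall>x. gradient p x = b"
proof -
  define p where "p = (\<Sum>i\<in>UNIV. (\<lambda>_. b $ i) * (\<lambda>x :: 'n \<Rightarrow> complex. x i))"
  have p: "p \<in> polyfun UNIV" unfolding p_def by (intro polyfun_sum polyfun.mult polyfun.const polyfun.var) auto
  have p_app: "p z = (\<Sum>i\<in>UNIV. b $ i * z i)" for z by (simp add: p_def sum_fun_apply pointwise)
  have "gradient p x = b" for x
  proof -
    have "((\<lambda>x :: complex ^ 'n. p (($) x)) has_derivative (\<lambda>h. \<Sum>i\<in>UNIV. b $ i * h $ i)) (at x)"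
      unfolding p_app by (intro has_derivative_sum has_derivative_mult_right bounded_linear_imp_has_derivative bounded_linear_vec_nth)
    from has_derivative_unique[OF partial(2)[OF p] this]
    have eq: "(\<Sum>i\<in>UNIV. partial p i (($) x) * h $ i) = (\<Sum>i\<in>UNIV. b $ i * h $ i)" for h
      by (simp add: fun_eq_iff)
    have "partial p k (($) x) = b $ k" for k
      using eq[of "axis k 1"] by (simp add: axis_def if_distrib[of "\<lambda>c. _ * c"] cong: if_cong)
    then show ?thesis by (simp add: gradient_def vec_eq_iff)
  qed
  then show ?thesis using p by blast
qed

lemma higher_deriv_product_zero:
  fixes f g :: "complex \<Rightarrow> complex"
  assumes "f holomorphic_on A" "g holomorphic_on A" "open A" "z \<in> A" "\<And>k. k \<le> n \<Longrightarrow> (deriv ^^ k) f z = 0"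
  shows "(deriv ^^ n) (\<lambda>w. f w * g w) z = 0"
  using higher_deriv_mult[OF assms(1-4), of n] assms(5) by simp

lemma matrix_inv_inverse:
  assumes "invertible (A :: complex ^ 'n ^ 'n::finite)"
  shows "A ** matrix_inv A = mat 1" "matrix_inv A ** A = mat 1"
  using someI_ex[OF assms[unfolded invertible_def]] unfolding matrix_inv_def by auto

text \<open>Consider the polynomials that vanish on \<open>S\<close> near a point, and the rank of their differentials there.
  Let \<open>x1\<close> be a point of \<open>S \<inter> W\<close> where this rank is largest. Polynomials whose differentials form a basis
  at \<open>x1\<close>, completed by linear forms, are local coordinates \<open>\<Phi>\<close>, which map \<open>S\<close> into a coordinate
  subspace \<open>H\<close>.

  All of \<open>H\<close> near \<open>\<Phi> x1\<close> is attained. Let \<open>\<gamma>\<close> be the curve that corresponds to a segment in \<open>H\<close>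
  starting at \<open>\<Phi> x1\<close>. By maximality of the rank, the differential of a polynomial \<open>q\<close> that vanishes on
  \<open>S\<close> near \<open>x1\<close> is, along \<open>S\<close>, a combination of those of the coordinates that vanish on \<open>H\<close>. So the
  derivative of \<open>q\<close> in the direction of such segments again vanishes on \<open>S\<close> near \<open>x1\<close>, and up to the
  nonvanishing Jacobian determinant it is a polynomial \<open>E q\<close>. Hence all derivatives of \<open>q \<circ> \<gamma>\<close> vanish
  at \<open>0\<close>, and \<open>q\<close> vanishes on \<open>\<gamma>\<close> by the identity theorem.\<close>

theorem regular_points_dense:
  fixes K :: "(('n::finite \<Rightarrow> complex) \<Rightarrow> complex) set"
  assumes K: "K \<subseteq> polyfun UNIV" and S: "S = {x :: complex ^ 'n. \<forall>p\<in>K. p (($) x) = 0}"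
    and W: "open W" "x0 \<in> W" "x0 \<in> S"
  shows "\<exists>x\<in>S \<inter> W. regular_point S x"
proof -
  define L where "L = (\<lambda>x. {p \<in> polyfun UNIV. \<exists>e>0. \<forall>z\<in>S \<inter> ball x e. p (($) z) = 0})"
  define rk where "rk = (\<lambda>x. vec.dim ((\<lambda>p. gradient p x) ` L x))"
  have "rk x \<le> CARD('n)" for x unfolding rk_def using vec.dim_subset_UNIV by (simp add: vec.dimension_def card_cart_basis)
  then obtain x1 where x1: "x1 \<in> S \<inter> W" "\<And>z. z \<in> S \<inter> W \<Longrightarrow> rk z \<le> rk x1"
    using ex_has_greatest_nat[of "\<lambda>x. x \<in> S \<inter> W" x0 rk "CARD('n) + 1"] W by (metis IntI le_imp_less_Suc Suc_eq_plus1)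
  obtain B where B: "B \<subseteq> (\<lambda>p. gradient p x1) ` L x1" "vec.independent B"
    "(\<lambda>p. gradient p x1) ` L x1 \<subseteq> vec.span B" "card B = rk x1"
    using vec.basis_exists[of "(\<lambda>p. gradient p x1) ` L x1"] unfolding rk_def by metis
  obtain B' where B': "B \<subseteq> B'" "vec.independent B'" "(UNIV :: (complex ^ 'n) set) \<subseteq> vec.span B'"
    using vec.maximal_independent_subset_extend[OF subset_UNIV B(2)] by metis
  have finB': "finite B'" using B'(2) by (rule vec.finiteI_independent)
  have "card B' = vec.dim (UNIV :: (complex ^ 'n) set)"
    using vec.basis_card_eq_dim[OF subset_UNIV B'(3,2)] .
  then have cardB': "card B' = CARD('n)" by (simp add: vec.dim_UNIV vec.dimension_def card_cart_basis)
  then obtain b where b: "bij_betw b (UNIV :: 'n set) B'"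
    using finite_same_card_bij[of "UNIV :: 'n set" B'] finB' by auto
  define I where "I = {i. b i \<in> B}"
  have "\<forall>i. \<exists>p\<in>polyfun UNIV. gradient p x1 = b i \<and> (i \<in> I \<longrightarrow> p \<in> L x1)"
  proof
    fix i
    show "\<exists>p\<in>polyfun UNIV. gradient p x1 = b i \<and> (i \<in> I \<longrightarrow> p \<in> L x1)"
    proof (cases "i \<in> I")
      case True
      then obtain p where "p \<in> L x1" "gradient p x1 = b i" using B(1) unfolding I_def by auto
      then show ?thesis unfolding L_def by blast
    next
      case False
      then show ?thesis using linear_form_polyfun[of "b i"] by blast
    qed
  qed
  then obtain p where p: "\<And>i. p i \<in> polyfun UNIV" "\<And>i. gradient (p i) x1 = b i" "\<And>i. i \<in> I \<Longrightarrow> p i \<in> L x1" by metis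
  define M where "M = (\<lambda>x. \<chi> i j. partial (p i) j (($) x))"
  have rowM: "row i (M x) = gradient (p i) x" for i x by (simp add: M_def row_def gradient_def)
  have injb: "inj b" and rangeb: "range b = B'" using b by (auto simp: bij_betw_def)
  have det1: "det (M x1) \<noteq> 0"
  proof -
    have "c i = 0" if "(\<Sum>i\<in>UNIV. c i *s row i (M x1)) = 0" for c i
    proof -
      have "(\<Sum>v\<in>B'. c (inv_into UNIV b v) *s v) = (\<Sum>i\<in>UNIV. c i *s b i)"
        unfolding rangeb[symmetric] by (subst sum.reindex[OF injb]) (simp add: inv_f_f[OF injb])
      also have "\<dots> = 0" using that by (simp add: rowM p(2))
      finally have "c (inv_into UNIV b (b i)) = 0"
        using vec.independentD[OF B'(2) finB' order_refl, of "\<lambda>v. c (inv_into UNIV b v)"] rangeb by blast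
      then show ?thesis by (simp add: inv_f_f[OF injb])
    qed
    then have "\<exists>B. M x1 ** B = mat 1" unfolding matrix_right_invertible_independent_rows by blast
    then show ?thesis by (simp add: invertible_right_inverse[symmetric] invertible_det_nz)
  qed
  have detpoly: "(\<lambda>z. det (\<chi> i j. partial (p i) j z)) \<in> polyfun UNIV"
    by (intro polyfun_det partial p)
  have detM: "det (M x) = (\<lambda>z. det (\<chi> i j. partial (p i) j z)) (($) x)" for x by (simp add: M_def)
  define \<Phi> where "\<Phi> = (\<lambda>x :: complex ^ 'n. \<chi> i. p i (($) x))"
  have derM: "(\<Phi> has_derivative (\<lambda>h. M x *v h)) (at x)" for x
  proof -
    have bl: "bounded_linear (axis i :: complex \<Rightarrow> complex ^ 'n)" for i
      unfolding linear_conv_bounded_linear[symmetric]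
      by (rule linearI) (auto simp: axis_def vec_eq_iff)
    have ax: "(\<chi> i. q i) = (\<Sum>i\<in>UNIV. axis i (q i))" for q :: "'n \<Rightarrow> complex"
      by (simp add: vec_eq_iff axis_def)
    have "(\<Phi> has_derivative (\<lambda>h. \<Sum>i\<in>UNIV. axis i (\<Sum>j\<in>UNIV. partial (p i) j (($) x) * h $ j))) (at x)"
      unfolding \<Phi>_def ax
      by (intro has_derivative_sum bounded_linear.has_derivative[OF bl] partial(2)[OF p(1)])
    moreover have "(\<lambda>h. \<Sum>i\<in>UNIV. axis i (\<Sum>j\<in>UNIV. partial (p i) j (($) x) * h $ j)) = (\<lambda>h. M x *v h)"
      unfolding ax[symmetric] by (simp add: M_def matrix_vector_mult_def)
    ultimately show ?thesis by simp
  qed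
  have blM: "bounded_linear (\<lambda>h. M x *v h)" for x using has_derivative_bounded_linear[OF derM] .
  define f' where "f' = (\<lambda>x. Blinfun (\<lambda>h. M x *v h))"
  have f'_app: "blinfun_apply (f' x) = (\<lambda>h. M x *v h)" for x
    unfolding f'_def by (rule bounded_linear_Blinfun_apply[OF blM])
  obtain e1 where e1: "e1 > 0" "\<And>i z. i \<in> I \<Longrightarrow> z \<in> S \<inter> ball x1 e1 \<Longrightarrow> p i (($) z) = 0"
  proof -
    have "\<forall>i\<in>I. \<exists>e>0. \<forall>z\<in>S \<inter> ball x1 e. p i (($) z) = 0" using p(3) unfolding L_def by blast
    then obtain e where e: "\<And>i. i \<in> I \<Longrightarrow> e i > 0" "\<And>i z. i \<in> I \<Longrightarrow> z \<in> S \<inter> ball x1 (e i) \<Longrightarrow> p i (($) z) = 0" by metis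
    define e0 where "e0 = Min (insert 1 (e ` I))"
    have fin: "finite (insert 1 (e ` I))" by simp
    have "\<forall>t\<in>insert 1 (e ` I). t > 0" using e(1) by auto
    then have "e0 > 0" unfolding e0_def using Min_in[OF fin] by blast
    moreover have "e0 \<le> e i" if "i \<in> I" for i unfolding e0_def by (rule Min_le[OF fin]) (use that in simp)
    moreover have "z \<in> S \<inter> ball x1 (e i)" if "e0 \<le> e i" "z \<in> S \<inter> ball x1 e0" for i z
      using that by auto
    ultimately show ?thesis using e(2) by (intro that[of e0]) blast+
  qed
  define U0 where "U0 = W \<inter> ball x1 e1 \<inter> {x. det (M x) \<noteq> 0}"
  have "open {x. det (M x) \<noteq> 0}"
    unfolding detM by (intro open_Collect_neq polyfun_continuous_on detpoly continuous_on_const)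
  then have U0: "open U0" "x1 \<in> U0" using W(1) x1(1) e1(1) det1 by (auto simp: U0_def)
  have inv1: "invertible (M x)" if "det (M x) \<noteq> 0" for x using that by (simp add: invertible_det_nz)
  obtain U V \<Psi> g' where UV: "open U" "U \<subseteq> U0" "x1 \<in> U" "open V" "\<Phi> x1 \<in> V" "homeomorphism U V \<Phi> \<Psi>"
    "\<And>y. y \<in> V \<Longrightarrow> (\<Psi> has_derivative (g' y)) (at y)" "\<And>y. y \<in> V \<Longrightarrow> g' y = inv_into UNIV (blinfun_apply (f' (\<Psi> y)))"
  proof (rule inverse_function_theorem[of U0 \<Phi> f' x1 "Blinfun (\<lambda>h. matrix_inv (M x1) *v h)"])
    show "(\<Phi> has_derivative blinfun_apply (f' x)) (at x)" for x unfolding f'_app by (rule derM)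
    have "continuous_on U0 (\<lambda>x. M x *v h)" for h
      unfolding M_def matrix_vector_mult_def
      by (intro continuous_on_vec_lambda continuous_on_sum continuous_on_mult continuous_on_const) (simp add: polyfun_continuous_on[OF partial(1)[OF p(1)]])
    then show "continuous_on U0 f'" by (intro continuous_on_blinfun_componentwise) (simp add: f'_app)
    have bl: "bounded_linear (\<lambda>h. matrix_inv (M x1) *v h)"
      unfolding linear_conv_bounded_linear[symmetric]
      by (rule linearI) (auto simp: matrix_vector_mult_def vec_eq_iff algebra_simps sum.distrib scaleR_sum_right)
    show "Blinfun (\<lambda>h. matrix_inv (M x1) *v h) o\<^sub>L f' x1 = id_blinfun"
      by (rule blinfun_eqI)
         (simp add: bounded_linear_Blinfun_apply[OF bl] f'_app matrix_vector_mul_assoc matrix_inv_inverse(2)[OF inv1[OF det1]])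
  qed (use U0 in auto)
  have \<Psi>: "\<And>y. y \<in> V \<Longrightarrow> \<Psi> y \<in> U" "\<And>y. y \<in> V \<Longrightarrow> \<Phi> (\<Psi> y) = y" "\<And>x. x \<in> U \<Longrightarrow> \<Phi> x \<in> V" "\<And>x. x \<in> U \<Longrightarrow> \<Psi> (\<Phi> x) = x"
    using UV(6) by (auto simp: homeomorphism_def)
  have Udet: "det (M x) \<noteq> 0" "x \<in> W" "x \<in> ball x1 e1" if "x \<in> U" for x using that UV(2) by (auto simp: U0_def)
  have g'_app: "g' y h = matrix_inv (M (\<Psi> y)) *v h" if "y \<in> V" for y h
  proof -
    have inv: "invertible (M (\<Psi> y))" using inv1 Udet(1) \<Psi>(1) that by blast
    have "inv_into UNIV (\<lambda>h. M (\<Psi> y) *v h) = (\<lambda>h. matrix_inv (M (\<Psi> y)) *v h)"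
      by (rule inv_equality) (simp_all add: matrix_vector_mul_assoc matrix_inv_inverse(2)[OF inv] matrix_inv_inverse(1)[OF inv])
    then show ?thesis using UV(8)[OF that] by (simp add: f'_app)
  qed
  obtain r where r: "r > 0" "ball (\<Phi> x1) r \<subseteq> V" using UV(4,5) by (metis open_contains_ball)
  define V' where "V' = ball (\<Phi> x1) r"
  define U' where "U' = \<Psi> ` V'"
  have V'V: "V' \<subseteq> V" using r(2) by (simp add: V'_def)
  have U'U: "U' \<subseteq> U" using V'V \<Psi>(1) by (auto simp: U'_def)
  have U'_eq: "U' = U \<inter> \<Phi> -` V'"
    using V'V \<Psi> unfolding U'_def by (auto simp: image_iff) (metis \<Psi>(4))
  have "open U'"
    unfolding U'_eq using UV(1,6) by (intro continuous_open_preimage) (auto simp: homeomorphism_def V'_def)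
  define H where "H = {v :: complex ^ 'n. \<forall>i\<in>I. v $ i = 0}"
  have H: "vec.subspace H" by (auto simp: vec.subspace_def H_def)
  have \<Phi>_in_H: "\<Phi> z \<in> H" if "z \<in> S" "z \<in> U" for z
    using e1(2) that Udet(3) by (simp add: H_def \<Phi>_def)
  \<comment> \<open>otherwise the rank at \<open>z\<close> would exceed the rank at \<open>x1\<close>\<close>
  have span_grad: "gradient q z \<in> vec.span ((\<lambda>i. gradient (p i) z) ` I)" if z: "z \<in> S" "z \<in> U" and q: "q \<in> L z" for z q
  proof (rule ccontr)
    assume notin: "\<not> ?thesis"
    have indep_all: "inj (\<lambda>i. gradient (p i) z) \<and> vec.independent (range (\<lambda>i. gradient (p i) z))"
    proof -
      have "\<exists>B. M z ** B = mat 1" using inv1[OF Udet(1)[OF z(2)]] by (auto simp: invertible_def)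
      then have lin: "\<And>c i. (\<Sum>i\<in>UNIV. c i *s gradient (p i) z) = 0 \<Longrightarrow> c i = 0"
        unfolding matrix_right_invertible_independent_rows rowM by blast
      have inj: "inj (\<lambda>i. gradient (p i) z)"
      proof (rule injI, rule ccontr)
        fix i j assume ij: "gradient (p i) z = gradient (p j) z" "i \<noteq> j"
        have "(\<Sum>k\<in>UNIV. (if k = i then 1 else if k = j then -1 else 0) *s gradient (p k) z)
          = (\<Sum>k\<in>{i, j}. (if k = i then 1 else if k = j then -1 else 0) *s gradient (p k) z)"
          by (rule sum.mono_neutral_right) auto
        also have "\<dots> = 0" using ij by simp
        finally have "(if i = i then 1 else if i = j then -1 else 0 :: complex) = 0" by (rule lin)
        then show False by simp
      qed
      have "vec.independent (range (\<lambda>i. gradient (p i) z))"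
      proof (rule vec.independent_if_scalars_zero)
        fix c v assume *: "(\<Sum>v\<in>range (\<lambda>i. gradient (p i) z). c v *s v) = 0" "v \<in> range (\<lambda>i. gradient (p i) z)"
        then obtain i where i: "v = gradient (p i) z" by blast
        have "(\<Sum>i\<in>UNIV. c (gradient (p i) z) *s gradient (p i) z) = 0"
          using *(1) by (subst (asm) sum.reindex[OF inj]) simp
        from lin[of "\<lambda>i. c (gradient (p i) z)", OF this, of i] show "c v = 0" by (simp add: i)
      qed simp
      then show ?thesis using inj by blast
    qed
    let ?A = "(\<lambda>i. gradient (p i) z) ` I"
    have indA: "vec.independent ?A" using indep_all vec.independent_mono[of _ ?A] by blast
    have cardA: "card ?A = rk x1"
    proof -
      have "card ?A = card I" using indep_all by (intro card_image) (auto intro: inj_on_subset)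
      also have "card I = card (b ` I)" by (rule card_image[symmetric]) (use injb in \<open>auto intro: inj_on_subset\<close>)
      also have "b ` I = B" using B'(1) rangeb by (auto simp: I_def)
      finally show ?thesis using B(4) by simp
    qed
    have "vec.independent (insert (gradient q z) ?A)"
      using vec.independent_insert[of "gradient q z" ?A] notin indA by auto
    moreover have "insert (gradient q z) ?A \<subseteq> (\<lambda>p. gradient p z) ` L z"
    proof -
      have "p i \<in> L z" if "i \<in> I" for i
      proof -
        obtain e where e: "e > 0" "ball z e \<subseteq> ball x1 e1" using Udet(3)[OF z(2)] by (metis open_ball open_contains_ball)
        then show ?thesis unfolding L_def using p(1) e1(2)[OF that] by blast
      qed
      then show ?thesis using q by blast
    qed
    ultimately have le: "card (insert (gradient q z) ?A) \<le> rk z"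
      unfolding rk_def by (intro vec.independent_card_le_dim)
    have "gradient q z \<notin> ?A"
    proof
      assume "gradient q z \<in> ?A"
      then have "gradient q z \<in> vec.span ?A" by (rule vec.span_base)
      with notin show False by (rule notE)
    qed
    moreover have "finite ?A" by (rule finite_imageI) simp
    ultimately have "card (insert (gradient q z) ?A) = Suc (card ?A)" by (rule card_insert_disjoint[rotated])
    then have "Suc (rk x1) \<le> rk z" using le cardA by linarith
    then show False using x1(2)[of z] z(1) Udet(2)[OF z(2)] by simp
  qed
  have sub: "H \<inter> V' \<subseteq> \<Phi> ` (S \<inter> U')"
  proof
    fix v assume v: "v \<in> H \<inter> V'"
    define u where "u = v - \<Phi> x1"
    have x1S: "x1 \<in> S" and x1U: "x1 \<in> U" using x1(1) UV(3) by auto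
    have u: "u $ i = 0" if "i \<in> I" for i
      using v \<Phi>_in_H[OF x1S x1U] that by (simp add: u_def H_def)
    show "v \<in> \<Phi> ` (S \<inter> U')"
    proof (cases "u = 0")
      case True
      have "x1 \<in> U'" using x1U r(1) by (simp add: U'_eq V'_def)
      then show ?thesis using True x1S by (auto simp: u_def)
    next
      case False
      define D where "D = ball (0::complex) (r / norm u)"
      define \<gamma> where "\<gamma> = (\<lambda>s::complex. \<Psi> (\<Phi> x1 + s *s u))"
      have norm_sv: "norm (s *s u) = cmod s * norm u" for s
        by (simp add: norm_vec_def vector_scalar_mult_def norm_mult L2_set_right_distrib)
      have inV: "\<Phi> x1 + s *s u \<in> V'" if "s \<in> D" for s
        using that False by (simp add: V'_def D_def dist_norm norm_sv field_simps)
      have one: "1 \<in> D" and zero: "0 \<in> D" using v False r(1) by (auto simp: D_def V'_def u_def dist_norm norm_minus_commute field_simps)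
      have \<gamma>U: "\<gamma> s \<in> U'" if "s \<in> D" for s using inV[OF that] by (simp add: \<gamma>_def U'_def)
      have \<gamma>0: "\<gamma> 0 = x1" using \<Psi>(4)[OF x1U] by (simp add: \<gamma>_def)
      define Wk where "Wk = (\<lambda>k z. det (\<chi> i j. if j = k then u $ i else partial (p i) j z))"
      have Wk: "Wk k \<in> polyfun UNIV" for k
      proof -
        have "(\<lambda>z. det (\<chi> i j. (if j = k then (\<lambda>_. u $ i) else partial (p i) j) z)) \<in> polyfun UNIV"
          by (intro polyfun_det) (auto intro: polyfun.const partial p)
        moreover have "(\<lambda>z. det (\<chi> i j. (if j = k then (\<lambda>_. u $ i) else partial (p i) j) z)) = Wk k"
          unfolding Wk_def by (intro ext arg_cong[of _ _ det]) (simp add: vec_eq_iff)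
        ultimately show ?thesis by simp
      qed
      define E where "E = (\<lambda>q. \<Sum>k\<in>UNIV. partial q k * Wk k)"
      have E: "E q \<in> polyfun UNIV" if "q \<in> polyfun UNIV" for q
        unfolding E_def using that by (intro polyfun_sum polyfun.mult partial Wk)
      have E_app: "E q z = (\<Sum>k\<in>UNIV. partial q k z * Wk k z)" for q z
        by (simp add: E_def sum_fun_apply pointwise)
      \<comment> \<open>by Cramer's rule, \<open>Wk k\<close> is a component of the velocity of the curve, times the Jacobian determinant\<close>
      have cram: "Wk k (($) x) = det (M x) * (matrix_inv (M x) *v u) $ k" if "det (M x) \<noteq> 0" for x k
      proof -
        have "M x *v (matrix_inv (M x) *v u) = u"
          by (simp add: matrix_vector_mul_assoc matrix_inv_inverse(1)[OF inv1[OF that]])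
        then have "matrix_inv (M x) *v u = (\<chi> k. det (\<chi> i j. if j = k then u $ i else M x $ i $ j) / det (M x))"
          using cramer[OF that] by blast
        then have "(matrix_inv (M x) *v u) $ k = det (\<chi> i j. if j = k then u $ i else M x $ i $ j) / det (M x)" by simp
        moreover have "(\<chi> i j. if j = k then u $ i else M x $ i $ j) = (\<chi> i j. if j = k then u $ i else partial (p i) j (($) x))"
          by (simp add: M_def vec_eq_iff)
        ultimately show ?thesis using that by (simp add: Wk_def)
      qed
      have E_L: "E q \<in> L x1" if q: "q \<in> L x1" for q
      proof -
        have qP: "q \<in> polyfun UNIV" using q by (simp add: L_def)
        obtain e where e: "e > 0" "\<And>z. z \<in> S \<inter> ball x1 e \<Longrightarrow> q (($) z) = 0" using q unfolding L_def by blast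
        obtain e' where e': "e' > 0" "ball x1 e' \<subseteq> U \<inter> ball x1 e"
          using UV(1) x1U e(1) by (metis IntI centre_in_ball open_Int open_ball open_contains_ball)
        have "E q (($) z) = 0" if z: "z \<in> S \<inter> ball x1 e'" for z
        proof -
          have zU: "z \<in> U" "z \<in> ball x1 e" using z e'(2) by auto
          have qL: "q \<in> L z"
          proof -
            obtain e2 where "e2 > 0" "ball z e2 \<subseteq> ball x1 e" using zU(2) by (metis open_ball open_contains_ball)
            then show ?thesis unfolding L_def using qP e(2) by blast
          qed
          let ?w = "matrix_inv (M z) *v u"
          have Mw: "M z *v ?w = u"
            by (simp add: matrix_vector_mul_assoc matrix_inv_inverse(1)[OF inv1[OF Udet(1)[OF zU(1)]]])
          define lf where "lf = (\<lambda>a :: complex ^ 'n. \<Sum>k\<in>UNIV. a $ k * ?w $ k)"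
          have "lf a = 0" if "a \<in> vec.span ((\<lambda>i. gradient (p i) z) ` I)" for a
            using that
          proof (induction rule: vec.span_induct)
            case base
            show ?case by (auto simp: vec.subspace_def lf_def sum.distrib distrib_right mult.assoc sum_distrib_left[symmetric])
          next
            case (step a)
            then obtain i where i: "i \<in> I" "a = gradient (p i) z" by blast
            have "lf a = (M z *v ?w) $ i" by (simp add: lf_def i(2) gradient_def M_def matrix_vector_mult_def)
            then show ?case using Mw u[OF i(1)] by simp
          qed
          then have "lf (gradient q z) = 0" using span_grad[OF _ zU(1) qL] z by blast
          moreover have "E q (($) z) = det (M z) * lf (gradient q z)"
            unfolding E_app lf_def cram[OF Udet(1)[OF zU(1)]] by (simp add: gradient_def sum_distrib_left algebra_simps)
          ultimately show ?thesis by simp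
        qed
        then show ?thesis unfolding L_def using E[OF qP] e'(1) by blast
      qed
      define dm where "dm = (\<lambda>s. det (M (\<gamma> s)))"
      have dm: "dm s \<noteq> 0" if "s \<in> D" for s using Udet(1) U'U \<gamma>U[OF that] by (auto simp: dm_def)
      have der: "((\<lambda>s. q (($) (\<gamma> s))) has_field_derivative E q (($) (\<gamma> s)) / dm s) (at s)"
        if q: "q \<in> polyfun UNIV" and s: "s \<in> D" for q s
      proof -
        let ?y = "\<Phi> x1 + s *s u"
        have yV: "?y \<in> V" using inV[OF s] V'V by blast
        have "linear (\<lambda>h::complex. h *s u)"
          by (rule linearI) (auto simp: vec_eq_iff algebra_simps)
        then have "((\<lambda>h. h *s u) has_derivative (\<lambda>h. h *s u)) (at s)"
          by (intro bounded_linear_imp_has_derivative) (simp add: linear_conv_bounded_linear)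
        then have "((\<lambda>s. \<Phi> x1 + s *s u) has_derivative (\<lambda>h. h *s u)) (at s)"
          using has_derivative_add[OF has_derivative_const[of "\<Phi> x1"]] by fastforce
        from has_derivative_compose[OF this UV(7)[OF yV]]
        have "(\<gamma> has_derivative (\<lambda>h. g' ?y (h *s u))) (at s)" by (simp add: \<gamma>_def)
        from has_derivative_compose[OF this partial(2)[OF q]]
        have "((\<lambda>s. q (($) (\<gamma> s))) has_derivative (\<lambda>h. \<Sum>i\<in>UNIV. partial q i (($) (\<gamma> s)) * g' ?y (h *s u) $ i)) (at s)"
          by simp
        moreover have "(\<Sum>i\<in>UNIV. partial q i (($) (\<gamma> s)) * g' ?y (h *s u) $ i) = E q (($) (\<gamma> s)) / dm s * h" for h
        proof -
          have nz: "det (M (\<gamma> s)) \<noteq> 0" using dm[OF s] by (simp add: dm_def)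
          have "g' ?y (h *s u) = h *s (matrix_inv (M (\<gamma> s)) *v u)"
            using g'_app[OF yV] by (simp add: \<gamma>_def vec.scale)
          then have "g' ?y (h *s u) $ i = h * (Wk i (($) (\<gamma> s)) / dm s)" for i
            using cram[OF nz, of i] nz by (simp add: dm_def)
          then show ?thesis by (simp add: E_app sum_distrib_left sum_divide_distrib sum_distrib_right algebra_simps)
        qed
        ultimately have "((\<lambda>s. q (($) (\<gamma> s))) has_derivative (\<lambda>h. E q (($) (\<gamma> s)) / dm s * h)) (at s)"
          by (simp only:)
        then show ?thesis unfolding has_field_derivative_def .
      qed
      have openD: "open D" by (simp add: D_def)
      have hol: "(\<lambda>s. q (($) (\<gamma> s))) holomorphic_on D" if "q \<in> polyfun UNIV" for q
        using der[OF that] by (meson holomorphic_onI field_differentiable_def field_differentiable_at_within)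
      have holdm: "(\<lambda>s. 1 / dm s) holomorphic_on D"
        using hol[OF detpoly] dm by (intro holomorphic_intros) (auto simp: dm_def detM)
      have allderiv: "(deriv ^^ n) (\<lambda>s. q (($) (\<gamma> s))) 0 = 0" if "q \<in> L x1" for q n
        using that
      proof (induction n arbitrary: q rule: less_induct)
        case (less n)
        have qP: "q \<in> polyfun UNIV" using less.prems by (simp add: L_def)
        show ?case
        proof (cases n)
          case 0
          have "q (($) x1) = 0" using less.prems x1S unfolding L_def by force
          then show ?thesis using 0 \<gamma>0 by simp
        next
          case (Suc k)
          have "(deriv ^^ Suc k) (\<lambda>s. q (($) (\<gamma> s))) 0 = (deriv ^^ k) (deriv (\<lambda>s. q (($) (\<gamma> s)))) 0"
            by (simp add: funpow_swap1)
          also have "\<dots> = (deriv ^^ k) (\<lambda>s. E q (($) (\<gamma> s)) * (1 / dm s)) 0"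
          proof (rule higher_deriv_cong_ev)
            show "\<forall>\<^sub>F s in nhds 0. deriv (\<lambda>s. q (($) (\<gamma> s))) s = E q (($) (\<gamma> s)) * (1 / dm s)"
              using DERIV_imp_deriv[OF der[OF qP]] openD zero unfolding eventually_nhds by (intro exI[of _ D]) auto
          qed simp
          also have "\<dots> = 0"
          proof (rule higher_deriv_product_zero[OF hol[OF E[OF qP]] holdm openD zero])
            fix j assume "j \<le> k"
            then show "(deriv ^^ j) (\<lambda>s. E q (($) (\<gamma> s))) 0 = 0" using less.IH[OF _ E_L[OF less.prems]] Suc by simp
          qed
          finally show ?thesis using Suc by simp
        qed
      qed
      have "q (($) (\<gamma> 1)) = 0" if q: "q \<in> K" for q
      proof -
        have qP: "q \<in> polyfun UNIV" using q K by blast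
        have "q \<in> L x1" unfolding L_def using qP q S by (auto intro: exI[of _ 1])
        have "connected D" by (simp add: D_def)
        from holomorphic_fun_eq_0_on_connected[OF hol[OF qP] openD this allderiv[OF \<open>q \<in> L x1\<close>] zero one]
        show ?thesis .
      qed
      then have "\<gamma> 1 \<in> S" by (simp add: S)
      moreover have "\<gamma> 1 = \<Psi> v" by (simp add: \<gamma>_def u_def)
      moreover have "\<Phi> (\<Psi> v) = v" using v V'V \<Psi>(2) by blast
      ultimately show ?thesis using \<gamma>U[OF one] by (metis IntI image_eqI)
    qed
  qed
  have "holomorphic_map \<Phi> U'" unfolding \<Phi>_def by (rule holomorphic_polyfun_map[OF p(1)])
  moreover have "holomorphic_map \<Psi> V'"
    unfolding holomorphic_map_def holomorphic_fun_def
  proof (intro allI ballI)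
    fix i y assume y: "y \<in> V'"
    then have yV: "y \<in> V" using V'V by blast
    have "((\<lambda>x. \<Psi> x $ i) has_derivative (\<lambda>h. g' y h $ i)) (at y)"
      using bounded_linear.has_derivative[OF bounded_linear_vec_nth UV(7)[OF yV]] .
    moreover have "g' y (c *s w) $ i = c * g' y w $ i" for c w by (simp add: g'_app[OF yV] vec.scale)
    ultimately show "\<exists>D. ((\<lambda>x. \<Psi> x $ i) has_derivative D) (at y) \<and> (\<forall>c v. D (c *s v) = c * D v)" by blast
  qed
  moreover have "\<Phi> ` U' = V'" using V'V \<Psi>(2) by (force simp: U'_def)
  moreover have "\<Phi> ` (S \<inter> U') = H \<inter> V'"
  proof
    show "\<Phi> ` (S \<inter> U') \<subseteq> H \<inter> V'" using \<Phi>_in_H U'U by (auto simp: U'_eq)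
  qed (rule sub)
  moreover have "x1 \<in> U'" using UV(3) r(1) by (simp add: U'_eq V'_def)
  moreover have "\<forall>y\<in>U'. \<Psi> (\<Phi> y) = y" using U'U \<Psi>(4) by blast
  ultimately have "regular_point S x1"
    unfolding regular_point_def using x1(1) \<open>open U'\<close> H
    by (intro conjI exI[of _ U'] exI[of _ V'] exI[of _ \<Phi>] exI[of _ \<Psi>] exI[of _ H]) (auto simp: V'_def U'_def)
  then show ?thesis using x1(1) by blast
qed

section \<open>Coordinate rings as rings of polynomial functions\<close>

lemma cpoly_eval_single: "cpoly_eval (Poly_Mapping.single e c) x = c * (\<Prod>i\<in>UNIV. x $ i ^ Poly_Mapping.lookup e i)"
  by (cases "c = 0") (auto simp: cpoly_eval_def)

lemma cpoly_eval_0 [simp]: "cpoly_eval 0 x = 0"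
  by (simp add: cpoly_eval_def)

lemma cpoly_eval_const [simp]: "cpoly_eval (cpoly_const c) x = c"
  by (simp add: cpoly_const_def cpoly_eval_single)

lemma cpoly_const_1: "cpoly_const 1 = 1"
  by (simp add: cpoly_const_def)

lemma cpoly_eval_1 [simp]: "cpoly_eval 1 x = 1"
  using cpoly_eval_const[of 1 x] by (simp only: cpoly_const_1)

lemma cpoly_eval_uminus: "cpoly_eval (- p) x = - cpoly_eval p x"
  using cpoly_eval_add[of p "- p" x] by (simp add: eq_neg_iff_add_eq_0 add.commute)

lemma cpoly_eval_diff: "cpoly_eval (p - q) x = cpoly_eval p x - cpoly_eval q x"
  using cpoly_eval_add[of p "- q" x] by (simp add: cpoly_eval_uminus)

lemma cpoly_induct [case_names single add]:
  assumes "\<And>e c. Q (Poly_Mapping.single e c)" "\<And>p q. Q p \<Longrightarrow> Q q \<Longrightarrow> Q (p + q)"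
  shows "Q (p :: 'n cpoly)"
proof -
  have "Q (\<Sum>e\<in>S. Poly_Mapping.single e (Poly_Mapping.lookup p e))" if "finite S" for S
    using that
  proof (induction S rule: finite_induct)
    case empty
    then show ?case using assms(1)[of 0 0] by simp
  next
    case (insert e S)
    then show ?case using assms by simp
  qed
  moreover have "(\<Sum>e\<in>Poly_Mapping.keys p. Poly_Mapping.single e (Poly_Mapping.lookup p e)) = p"
  proof (rule poly_mapping_eqI)
    fix k
    show "Poly_Mapping.lookup (\<Sum>e\<in>Poly_Mapping.keys p. Poly_Mapping.single e (Poly_Mapping.lookup p e)) k = Poly_Mapping.lookup p k"
      by (simp add: lookup_sum lookup_single when_def in_keys_iff)
  qed
  ultimately show ?thesis by (metis finite_keys)
qed

lemma cpoly_eval_mult: "cpoly_eval (p * q) x = cpoly_eval p x * cpoly_eval q x"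
proof (induction p rule: cpoly_induct)
  case (single e c)
  show ?case
  proof (induction q rule: cpoly_induct)
    case (single f d)
    show ?case
      by (simp add: mult_single cpoly_eval_single lookup_add power_add prod.distrib algebra_simps)
  next
    case (add q r)
    then show ?case by (simp add: distrib_left cpoly_eval_add)
  qed
next
  case (add p r)
  then show ?case by (simp add: distrib_right cpoly_eval_add)
qed

text \<open>With the weights \<open>B ^ e i\<close>, two exponent vectors receive the same weight only if \<open>B\<close> is a root of a
  nonzero polynomial, which excludes finitely many \<open>B\<close>.\<close>

lemma separating_weights:
  fixes E :: "('n::finite \<Rightarrow>\<^sub>0 nat) set" and e :: "'n \<Rightarrow> nat"
  assumes "finite E" "inj e"
  shows "\<exists>w :: 'n \<Rightarrow> nat. inj_on (\<lambda>a. \<Sum>i\<in>UNIV. w i * Poly_Mapping.lookup a i) E"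
proof -
  define q where "q = (\<lambda>a b. \<Sum>i\<in>UNIV. Polynomial.monom (of_nat (Poly_Mapping.lookup a i) - of_nat (Poly_Mapping.lookup b i) :: complex) (e i))"
  have q0: "q a b \<noteq> 0" if "a \<noteq> b" for a b
  proof
    assume "q a b = 0"
    have "Poly_Mapping.lookup a k = Poly_Mapping.lookup b k" for k
    proof -
      have "poly.coeff (q a b) (e k) = (\<Sum>i\<in>UNIV. if i = k then of_nat (Poly_Mapping.lookup a i) - of_nat (Poly_Mapping.lookup b i) else 0)"
        unfolding q_def coeff_sum coeff_monom using assms(2) by (intro sum.cong refl if_cong) (auto simp: inj_eq)
      then have "(of_nat (Poly_Mapping.lookup a k) - of_nat (Poly_Mapping.lookup b k) :: complex) = 0"
        using \<open>q a b = 0\<close> by simp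
      then show ?thesis by simp
    qed
    then show False using that by (auto intro: poly_mapping_eqI)
  qed
  define Z where "Z = (\<Union>(a, b)\<in>{(a, b). a \<in> E \<and> b \<in> E \<and> a \<noteq> b}. {z. poly (q a b) z = 0})"
  have "finite {(a, b). a \<in> E \<and> b \<in> E \<and> a \<noteq> b}"
    by (rule finite_subset[of _ "E \<times> E"]) (use assms(1) in auto)
  then have "finite Z" unfolding Z_def using q0 poly_roots_finite by (intro finite_UN_I) auto
  then have "finite {n :: nat. of_nat n \<in> Z}" using finite_vimageI[of Z "of_nat :: nat \<Rightarrow> complex"]
    by (simp add: vimage_def inj_of_nat)
  then obtain B :: nat where B: "of_nat B \<notin> Z" by (metis (mono_tags, lifting) Collect_mem_eq UNIV_I ex_new_if_finite infinite_UNIV_nat mem_Collect_eq)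
  have "inj_on (\<lambda>a. \<Sum>i\<in>UNIV. B ^ e i * Poly_Mapping.lookup a i) E"
  proof (rule inj_onI, rule ccontr)
    fix a b assume ab: "a \<in> E" "b \<in> E" "a \<noteq> b"
      "(\<Sum>i\<in>UNIV. B ^ e i * Poly_Mapping.lookup a i) = (\<Sum>i\<in>UNIV. B ^ e i * Poly_Mapping.lookup b i)"
    have "poly (q a b) (of_nat B) = of_nat (\<Sum>i\<in>UNIV. B ^ e i * Poly_Mapping.lookup a i) - of_nat (\<Sum>i\<in>UNIV. B ^ e i * Poly_Mapping.lookup b i)"
      unfolding q_def by (simp add: poly_sum poly_monom sum_subtractf algebra_simps)
    then have "poly (q a b) (of_nat B) = 0" using ab(4) by simp
    then show False using B ab by (auto simp: Z_def)
  qed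
  then show ?thesis by (intro exI[of _ "\<lambda>i. B ^ e i"])
qed

text \<open>By Kronecker's substitution \<open>x i = t ^ w i\<close>, the monomials of \<open>p\<close> become distinct powers of \<open>t\<close>.\<close>

lemma cpoly_eval_inj:
  fixes p :: "'n::finite cpoly"
  assumes "\<And>x. cpoly_eval p x = 0"
  shows "p = 0"
proof (rule ccontr)
  assume "p \<noteq> 0"
  then obtain a where a: "a \<in> Poly_Mapping.keys p" by (metis keys_eq_empty ex_in_conv)
  obtain e :: "'n \<Rightarrow> nat" where "inj e" using finite_imp_inj_to_nat_seg[of "UNIV :: 'n set"] by auto
  then obtain w :: "'n \<Rightarrow> nat" where w: "inj_on (\<lambda>a. \<Sum>i\<in>UNIV. w i * Poly_Mapping.lookup a i) (Poly_Mapping.keys p)"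
    using separating_weights[of "Poly_Mapping.keys p" e] by auto
  define W where "W = (\<lambda>a. \<Sum>i\<in>UNIV. w i * Poly_Mapping.lookup a i)"
  define Q where "Q = (\<Sum>b\<in>Poly_Mapping.keys p. Polynomial.monom (Poly_Mapping.lookup p b) (W b))"
  have "poly Q t = cpoly_eval p (\<chi> i. t ^ w i)" for t
  proof -
    have "(\<Prod>i\<in>UNIV. (t ^ w i) ^ Poly_Mapping.lookup b i) = t ^ W b" for b
      by (simp add: W_def power_sum flip: power_mult)
    then show ?thesis by (simp add: Q_def poly_sum poly_monom cpoly_eval_def)
  qed
  then have "Q = 0" using assms poly_all_0_iff_0 by metis
  moreover have "poly.coeff Q (W a) = (\<Sum>b\<in>Poly_Mapping.keys p. if b = a then Poly_Mapping.lookup p b else 0)"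
    unfolding Q_def coeff_sum coeff_monom
    using w a by (intro sum.cong refl if_cong) (auto simp: W_def[symmetric] inj_on_def)
  ultimately show False using a by (simp add: in_keys_iff)
qed

definition eval_fun :: "'n::finite cpoly \<Rightarrow> ('n \<Rightarrow> complex) \<Rightarrow> complex" where
  "eval_fun p z = cpoly_eval p (\<chi> i. z i)"

lemma eval_fun_polyfun: "eval_fun p \<in> polyfun UNIV"
proof -
  have "eval_fun p = (\<Sum>e\<in>Poly_Mapping.keys p. (\<lambda>_. Poly_Mapping.lookup p e) * (\<Prod>i\<in>UNIV. (\<lambda>z. z i) ^ Poly_Mapping.lookup e i))"
    by (auto simp: fun_eq_iff eval_fun_def cpoly_eval_def sum_fun_apply prod_fun_apply pointwise)
  also have "\<dots> \<in> polyfun UNIV"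
    by (intro polyfun_sum polyfun.mult polyfun.const polyfun_prod polyfun_power polyfun.var) auto
  finally show ?thesis .
qed

lemma eval_fun_nth: "eval_fun p (($) x) = cpoly_eval p x"
  by (simp add: eval_fun_def)

text \<open>The bijection \<open>e\<close> numbers the variables, which turns the coordinate ring into a quotient of the
  polynomial functions in the variables below \<open>CARD('n)\<close>.\<close>

locale affine_coordinates =
  fixes I :: "'n::finite cpoly set" and e :: "'n \<Rightarrow> nat"
  assumes prime_I: "primeideal I cpoly_ring" and e: "bij_betw e UNIV {..<CARD('n)}"
begin

definition pt :: "(nat \<Rightarrow> complex) \<Rightarrow> complex ^ 'n" where
  "pt x = (\<chi> i. x (e i))"

definition coords :: "complex ^ 'n \<Rightarrow> nat \<Rightarrow> complex" where
  "coords z = (\<lambda>k. z $ inv_into UNIV e k)"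

definition ev :: "'n cpoly \<Rightarrow> (nat \<Rightarrow> complex) \<Rightarrow> complex" where
  "ev p = (\<lambda>x. cpoly_eval p (pt x))"

definition coset :: "'n cpoly \<Rightarrow> 'n cpoly set" where
  "coset p = I +>\<^bsub>cpoly_ring\<^esub> p"

lemma inj_e: "inj e" and e_less: "e i < CARD('n)"
  using e by (auto simp: bij_betw_def)

lemma pt_coords [simp]: "pt (coords z) = z"
  by (simp add: pt_def coords_def inv_into_f_f[OF inj_e] vec_eq_iff)

lemma ev_simps:
  "ev (p + q) = ev p + ev q" "ev (p - q) = ev p - ev q" "ev (p * q) = ev p * ev q"
  "ev 0 = 0" "ev 1 = 1" "ev (cpoly_const c) = (\<lambda>_. c)"
  by (auto simp: ev_def fun_eq_iff pointwise cpoly_eval_add cpoly_eval_diff cpoly_eval_mult)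

lemma ev_polyfun: "ev p \<in> polyfun {..<CARD('n)}"
proof -
  have "ev p = psubst (\<lambda>i x. x (e i)) (eval_fun p)"
    by (auto simp: ev_def psubst_def eval_fun_def pt_def)
  also have "\<dots> \<in> polyfun {..<CARD('n)}"
    using e_less by (intro psubst_polyfun[OF eval_fun_polyfun] polyfun.var) auto
  finally show ?thesis .
qed

lemma ev_inj: "ev p = ev q \<Longrightarrow> p = q"
proof -
  assume eq: "ev p = ev q"
  have "cpoly_eval (p - q) z = 0" for z
  proof -
    have "ev p (coords z) = ev q (coords z)" by (simp only: eq)
    then show ?thesis by (simp add: ev_def cpoly_eval_diff)
  qed
  then show ?thesis using cpoly_eval_inj[of "p - q"] by simp
qed

lemma ev_surj: "u \<in> polyfun {..<CARD('n)} \<Longrightarrow> \<exists>p. u = ev p"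
proof (induction rule: polyfun.induct)
  case (const c)
  then show ?case using ev_simps(6) by metis
next
  case (var k)
  then obtain i where i: "k = e i" using e by (auto simp: bij_betw_def)
  have "(\<lambda>x. x k) = ev (Poly_Mapping.single (Poly_Mapping.single i 1) 1)"
  proof
    fix x :: "nat \<Rightarrow> complex"
    have "(\<Prod>j\<in>UNIV. x (e j) ^ Poly_Mapping.lookup (Poly_Mapping.single i 1) j) = (\<Prod>j\<in>UNIV. if j = i then x (e j) else 1)"
      by (intro prod.cong) (auto simp: lookup_single when_def)
    then show "x k = ev (Poly_Mapping.single (Poly_Mapping.single i 1) 1) x"
      by (simp add: ev_def cpoly_eval_single pt_def i)
  qed
  then show ?case by blast
next
  case (add p q)
  then show ?case using ev_simps(1) by metis
next
  case (mult p q)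
  then show ?case using ev_simps(3) by metis
qed

lemma ring_ops: "carrier cpoly_ring = UNIV" "p \<oplus>\<^bsub>cpoly_ring\<^esub> q = p + q" "p \<otimes>\<^bsub>cpoly_ring\<^esub> q = p * q"
  "\<zero>\<^bsub>cpoly_ring\<^esub> = 0" "\<one>\<^bsub>cpoly_ring\<^esub> = 1" for p q :: "'n cpoly"
  by (simp_all add: ring_of_type_algebra_def)

lemma I_0: "0 \<in> I" and I_add: "p \<in> I \<Longrightarrow> q \<in> I \<Longrightarrow> p + q \<in> I"
  and I_mult: "q \<in> I \<Longrightarrow> p * q \<in> I" and I_proper: "1 \<notin> I"
  and I_prime: "p * q \<in> I \<Longrightarrow> p \<in> I \<or> q \<in> I"
proof -
  interpret primeideal I cpoly_ring by (rule prime_I)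
  show "0 \<in> I" using additive_subgroup.zero_closed[OF is_additive_subgroup] by (simp add: ring_ops)
  show "p \<in> I \<Longrightarrow> q \<in> I \<Longrightarrow> p + q \<in> I" using additive_subgroup.a_closed[OF is_additive_subgroup, of p q] by (simp add: ring_ops)
  show "q \<in> I \<Longrightarrow> p * q \<in> I" using I_l_closed[of q p] by (simp add: ring_ops)
  show "1 \<notin> I"
  proof
    assume "1 \<in> I"
    then have "I = carrier cpoly_ring" by (intro one_imp_carrier) (simp only: ring_ops)
    then show False using I_notcarr by blast
  qed
  show "p * q \<in> I \<Longrightarrow> p \<in> I \<or> q \<in> I" using I_prime[of p q] by (simp add: ring_ops)
qed

lemma ev_mem: "ev p \<in> ev ` I \<longleftrightarrow> p \<in> I"
  using ev_inj by blast

lemma poly_prime_ev: "poly_prime {..<CARD('n)} (ev ` I)"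
proof unfold_locales
  show "ev ` I \<subseteq> polyfun {..<CARD('n)}" using ev_polyfun by blast
  show "0 \<in> ev ` I" using ev_mem[of 0] I_0 by (simp add: ev_simps)
  show "1 \<notin> ev ` I" using ev_mem[of 1] I_proper by (simp add: ev_simps)
  fix u w
  show "u + w \<in> ev ` I" if "u \<in> ev ` I" "w \<in> ev ` I"
    using that I_add by (auto simp: ev_simps(1)[symmetric])
  show "u * w \<in> ev ` I" if uw: "u \<in> polyfun {..<CARD('n)}" "w \<in> ev ` I"
  proof -
    obtain p q where "u = ev p" "w = ev q" "q \<in> I" using ev_surj[OF uw(1)] uw(2) by blast
    then show ?thesis using ev_mem[of "p * q"] I_mult by (simp add: ev_simps)
  qed
  show "u \<in> ev ` I \<or> w \<in> ev ` I" if uw: "u \<in> polyfun {..<CARD('n)}" "w \<in> polyfun {..<CARD('n)}" "u * w \<in> ev ` I"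
  proof -
    obtain p q where "u = ev p" "w = ev q" using ev_surj[OF uw(1)] ev_surj[OF uw(2)] by blast
    then show ?thesis using uw(3) ev_mem[of "p * q"] I_prime[of p q] by (auto simp: ev_simps)
  qed
qed

lemma zeros_ev: "x \<in> zeros (ev ` I) \<longleftrightarrow> pt x \<in> affine_variety I"
  by (simp add: zeros_def affine_variety_def ev_def)

lemma coset_mem: "q \<in> coset p \<longleftrightarrow> q - p \<in> I"
proof -
  have "coset p = {h + p | h. h \<in> I}"
    by (auto simp: coset_def a_r_coset_def' ring_of_type_algebra_def)
  then show ?thesis by (auto simp: algebra_simps)
qed

lemma I_diff: "p \<in> I \<Longrightarrow> q \<in> I \<Longrightarrow> p - q \<in> I"
  using I_add[of p "(-1) * q"] I_mult[of q "-1"] by simp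

lemma coset_eq_iff: "coset p = coset q \<longleftrightarrow> p - q \<in> I"
proof
  assume "coset p = coset q"
  then have "p \<in> coset q" using coset_mem[of p p] I_0 by auto
  then show "p - q \<in> I" by (simp add: coset_mem)
next
  assume pq: "p - q \<in> I"
  have "r - p \<in> I \<longleftrightarrow> r - q \<in> I" for r
    using I_add[of "r - p" "p - q"] I_diff[of "r - q" "p - q"] pq by auto
  then show "coset p = coset q" by (auto simp: coset_mem set_eq_iff)
qed

lemma coord_ring_carrier: "f \<in> carrier (coord_ring I) \<longleftrightarrow> (\<exists>p. f = coset p)"
  by (auto simp: FactRing_def A_RCOSETS_def' coset_def ring_ops)

lemma coord_ring_ops:
  "coset p \<otimes>\<^bsub>coord_ring I\<^esub> coset q = coset (p * q)"
  "coset p \<oplus>\<^bsub>coord_ring I\<^esub> coset q = coset (p + q)"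
  "\<one>\<^bsub>coord_ring I\<^esub> = coset 1"
  "\<zero>\<^bsub>coord_ring I\<^esub> = coset 0"
proof -
  interpret primeideal I cpoly_ring by (rule prime_I)
  have h: "coset \<in> ring_hom cpoly_ring (coord_ring I)"
    using rcos_ring_hom unfolding coset_def .
  show "coset p \<otimes>\<^bsub>coord_ring I\<^esub> coset q = coset (p * q)"
    using ring_hom_mult[OF h, of p q] by (simp add: ring_ops)
  show "coset p \<oplus>\<^bsub>coord_ring I\<^esub> coset q = coset (p + q)"
    using ring_hom_add[OF h, of p q] by (simp add: ring_ops)
  show "\<one>\<^bsub>coord_ring I\<^esub> = coset 1"
    using ring_hom_one[OF h] by (simp add: ring_ops)
  have "coset 0 = I" by (auto simp: coset_mem)
  then show "\<zero>\<^bsub>coord_ring I\<^esub> = coset 0" by (simp add: FactRing_def)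
qed

lemma coset_eq_zero: "coset p = \<zero>\<^bsub>coord_ring I\<^esub> \<longleftrightarrow> p \<in> I"
  by (simp add: coord_ring_ops coset_eq_iff)

lemma coset_finprod:
  assumes "finite A"
  shows "(\<Otimes>\<^bsub>coord_ring I\<^esub>j\<in>A. coset (P j)) = coset (\<Prod>j\<in>A. P j)"
proof -
  interpret primeideal I cpoly_ring by (rule prime_I)
  interpret Q: cring "coord_ring I" by (rule quotient_is_cring) (rule is_cring)
  show ?thesis
    using assms
  proof (induction A rule: finite_induct)
    case empty
    then show ?case by (simp add: coord_ring_ops)
  next
    case (insert j A)
    have "(\<lambda>j. coset (P j)) \<in> A \<rightarrow> carrier (coord_ring I)" "coset (P j) \<in> carrier (coord_ring I)"
      using coord_ring_carrier by blast+
    then show ?case using insert by (simp add: Q.finprod_insert coord_ring_ops)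
  qed
qed

lemma coset_eval_coset: "z \<in> affine_variety I \<Longrightarrow> coset_eval (coset p) z = cpoly_eval p z"
  using coset_eval_eq[of "coset p" I p z] coord_ring_carrier coset_mem[of p p] I_0 by auto

lemma coset_const: "I +>\<^bsub>cpoly_ring\<^esub> cpoly_const c = coset (cpoly_const c)"
  by (simp add: coset_def)

lemma is_valuation_iff:
  "is_valuation I \<nu> \<longleftrightarrow>
    (\<forall>p. \<nu> (coset p) = \<infinity> \<longleftrightarrow> p \<in> I) \<and>
    (\<forall>p q. p \<notin> I \<longrightarrow> q \<notin> I \<longrightarrow> \<nu> (coset (p * q)) = \<nu> (coset p) + \<nu> (coset q)) \<and>
    (\<forall>p q. p \<notin> I \<longrightarrow> q \<notin> I \<longrightarrow> p + q \<notin> I \<longrightarrow> min (\<nu> (coset p)) (\<nu> (coset q)) \<le> \<nu> (coset (p + q))) \<and>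
    (\<forall>c. c \<noteq> 0 \<longrightarrow> \<nu> (coset (cpoly_const c)) = 0) \<and>
    (\<exists>p q. p \<notin> I \<and> q \<notin> I \<and> \<nu> (coset p) \<noteq> \<nu> (coset q))"
proof -
  let ?R = "carrier (coord_ring I)" and ?R' = "carrier (coord_ring I) - {\<zero>\<^bsub>coord_ring I\<^esub>}"
  have C: "coset p \<in> ?R" for p unfolding coord_ring_carrier by (rule exI, rule refl)
  have C': "coset p \<in> ?R' \<longleftrightarrow> p \<notin> I" for p using C[of p] coset_eq_zero[of p] by simp
  have car: "(\<forall>f\<in>?R. S f) \<longleftrightarrow> (\<forall>p. S (coset p))" for S
  proof (intro iffI allI ballI)
    fix p assume "\<forall>f\<in>?R. S f"
    then show "S (coset p)" by (rule bspec) (rule C)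
  next
    fix f assume S: "\<forall>p. S (coset p)" and "f \<in> ?R"
    then obtain p where "f = coset p" unfolding coord_ring_carrier by (elim exE)
    then show "S f" using S by simp
  qed
  have nz: "(\<forall>f\<in>?R'. S f) \<longleftrightarrow> (\<forall>p. p \<notin> I \<longrightarrow> S (coset p))" for S
  proof -
    have "(\<forall>f\<in>?R'. S f) \<longleftrightarrow> (\<forall>f\<in>?R. f \<in> ?R' \<longrightarrow> S f)" by (intro iffI ballI impI) simp_all
    then show ?thesis by (simp only: car C')
  qed
  have nz_ex: "(\<exists>f\<in>?R'. S f) \<longleftrightarrow> (\<exists>p. p \<notin> I \<and> S (coset p))" for S
  proof -
    have ex: "(\<exists>f\<in>B. S f) \<longleftrightarrow> \<not> (\<forall>f\<in>B. \<not> S f)" for B by (rule iffI) simp_all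
    show ?thesis unfolding ex nz by simp
  qed
  show ?thesis
    unfolding is_valuation_def Let_def car nz nz_ex coset_const coord_ring_ops(1,2) coset_eq_zero
    by (intro conj_cong refl iffI allI impI; (elim exE conjE)?; (intro exI conjI)?; simp)
qed

end

section \<open>The relative type\<close>

text \<open>The conventions at zero agree: \<open>elog 0 = -\<infinity>\<close> and \<open>0 powr c = 0\<close>.\<close>

lemma elog_le_iff:
  assumes "A \<ge> 0" "\<Phi> \<ge> 0" "c > 0"
  shows "elog A \<le> ereal c * elog \<Phi> + ereal C \<longleftrightarrow> A \<le> exp C * \<Phi> powr c"
proof -
  consider "A = 0" | "A > 0" "\<Phi> = 0" | "A > 0" "\<Phi> > 0" using assms by linarith
  then show ?thesis
  proof cases
    case 1
    then show ?thesis by (simp add: elog_def)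
  next
    case 2
    then show ?thesis using assms(3) by (simp add: elog_def)
  next
    case 3
    have "ln A \<le> c * ln \<Phi> + C \<longleftrightarrow> A \<le> exp (c * ln \<Phi> + C)"
      using 3(1) by (metis exp_le_cancel_iff exp_ln)
    also have "exp (c * ln \<Phi> + C) = exp C * \<Phi> powr c" using 3(2) by (simp add: exp_add powr_def)
    finally show ?thesis using 3 by (simp add: elog_def)
  qed
qed

context affine_coordinates
begin

context
  fixes P :: "nat \<Rightarrow> 'n cpoly" and a :: "nat \<Rightarrow> real" and m :: nat
  assumes m: "m \<ge> 1" and a0: "a 0 = 0" and a_pos: "\<And>j. 1 \<le> j \<Longrightarrow> j \<le> m \<Longrightarrow> a j > 0"
    and common_zero: "{z \<in> affine_variety I. \<forall>j\<in>{1..m}. cpoly_eval (P j) z = 0} = {0}"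
begin

definition weight :: "complex ^ 'n \<Rightarrow> real" where
  "weight z = (\<Sum>j=1..m. cmod (cpoly_eval (P j) z) powr (1 / a j))"

definition prod_norm :: "complex ^ 'n \<Rightarrow> real" where
  "prod_norm z = (\<Prod>j\<le>m. cmod (cpoly_eval (P j) z))"

text \<open>This is the condition on \<open>c\<close> in the definition of the relative type after exponentiation.\<close>

definition admissible :: "real \<Rightarrow> bool" where
  "admissible c \<longleftrightarrow> (\<exists>U C. openin (top_of_set (affine_variety I)) U \<and> 0 \<in> U \<and>
     (\<forall>z\<in>U - sing_locus (affine_variety I). prod_norm z \<le> exp C * weight z powr c))"

lemma zero_mem: "0 \<in> affine_variety I"
  using common_zero by blast

lemma weight_nonneg: "weight z \<ge> 0" and prod_norm_nonneg: "prod_norm z \<ge> 0"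
  by (auto simp: weight_def prod_norm_def intro: sum_nonneg prod_nonneg)

lemma sum_a: "(\<Sum>j\<le>m. a j) = (\<Sum>j=1..m. a j)"
proof -
  have "{..m} = insert 0 {1..m}" by auto
  then show ?thesis using a0 by simp
qed

lemma sum_a_pos: "(\<Sum>j=1..m. a j) > 0"
  using m a_pos by (intro sum_pos) auto

lemma cpoly_eval_continuous: "continuous_on A (cpoly_eval p)"
  using polyfun_continuous_on[OF eval_fun_polyfun, of A p] by (simp add: eval_fun_nth)

text \<open>Near the origin the factor with index \<open>0\<close> is bounded, and the others are at most \<open>weight z powr a j\<close>.\<close>

lemma admissible_sum: "admissible (\<Sum>j=1..m. a j)"
proof -
  let ?S = "\<Sum>j=1..m. a j"
  obtain C0 where C0: "C0 > 0" "\<And>x. (\<forall>i\<in>UNIV. cmod (x i) \<le> 1) \<Longrightarrow> cmod (eval_fun (P 0) x) \<le> C0"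
    using polyfun_bounded[OF eval_fun_polyfun] by blast
  have "prod_norm z \<le> exp (ln C0) * weight z powr ?S" if z: "z \<in> ball 0 1" for z
  proof -
    have "cmod (z $ i) \<le> 1" for i using z Finite_Cartesian_Product.norm_nth_le[of z i] by simp
    then have "cmod (cpoly_eval (P 0) z) \<le> C0" using C0(2)[of "($) z"] by (simp add: eval_fun_nth)
    moreover have "(\<Prod>j=1..m. cmod (cpoly_eval (P j) z)) \<le> (\<Prod>j=1..m. weight z powr a j)"
    proof (intro prod_mono conjI norm_ge_zero)
      fix j assume j: "j \<in> {1..m}"
      have aj: "a j > 0" using a_pos j by simp
      have "cmod (cpoly_eval (P j) z) powr (1 / a j) \<le> weight z"
        unfolding weight_def using j by (intro member_le_sum) auto
      then have "(cmod (cpoly_eval (P j) z) powr (1 / a j)) powr a j \<le> weight z powr a j"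
        using aj by (intro powr_mono2) auto
      then show "cmod (cpoly_eval (P j) z) \<le> weight z powr a j" using aj by (simp add: powr_powr)
    qed
    moreover have "(\<Prod>j=1..m. weight z powr a j) = weight z powr ?S"
    proof (cases "weight z = 0")
      case True
      then show ?thesis using m by (auto intro!: prod_zero)
    next
      case False
      then show ?thesis by (simp add: powr_sum)
    qed
    moreover have "prod_norm z = cmod (cpoly_eval (P 0) z) * (\<Prod>j=1..m. cmod (cpoly_eval (P j) z))"
    proof -
      have "{..m} = insert 0 {1..m}" by auto
      then show ?thesis by (simp add: prod_norm_def)
    qed
    ultimately have "prod_norm z \<le> C0 * weight z powr ?S"
      using C0(1) by (auto intro!: mult_mono prod_nonneg)
    then show ?thesis using C0(1) by simp
  qed
  then show ?thesis unfolding admissible_def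
    by (intro exI[of _ "affine_variety I \<inter> ball 0 1"] exI[of _ "ln C0"]) (auto simp: zero_mem openin_open_Int)
qed

lemma ev_coords: "ev p (coords z) = cpoly_eval p z"
  by (simp add: ev_def)

lemma ev_origin: "ev (P j) (\<lambda>_. 0) = 0" if "1 \<le> j" "j \<le> m"
proof -
  have "pt (\<lambda>_. 0) = 0" by (simp add: pt_def vec_eq_iff)
  moreover have "0 \<in> {z \<in> affine_variety I. \<forall>j\<in>{1..m}. cpoly_eval (P j) z = 0}"
    unfolding common_zero by (rule singletonI)
  then have "cpoly_eval (P j) 0 = 0" using that by simp
  ultimately show ?thesis by (simp add: ev_def)
qed

text \<open>A bound with \<open>c > S\<close> near the origin is violated at the points supplied by \<open>points_from_valuation\<close>.
  These may be singular, so the bound is first extended to all points.\<close>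

lemma not_admissible_if_valuation:
  assumes \<nu>: "is_valuation I \<nu>" "\<And>j. j \<le> m \<Longrightarrow> \<nu> (coset (P j)) = ennreal (a j)"
    and c: "c > (\<Sum>j=1..m. a j)"
  shows "\<not> admissible c"
proof
  assume "admissible c"
  then obtain U C where U: "openin (top_of_set (affine_variety I)) U" "0 \<in> U"
    "\<forall>z\<in>U - sing_locus (affine_variety I). prod_norm z \<le> exp C * weight z powr c"
    unfolding admissible_def by blast
  obtain T where T: "open T" "U = affine_variety I \<inter> T" using U(1) by (auto simp: openin_open)
  have c0: "c > 0" using c sum_a_pos by linarith
  \<comment> \<open>both sides are continuous, and the regular points are dense\<close>
  have all: "prod_norm z \<le> exp C * weight z powr c" if z: "z \<in> affine_variety I" "z \<in> T" for z
  proof (rule ccontr)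
    assume "\<not> ?thesis"
    then have gt: "exp C * weight z powr c < prod_norm z" by simp
    have contw: "continuous_on UNIV (\<lambda>z. exp C * weight z powr c)"
      unfolding weight_def using c0 a_pos
      by (intro continuous_intros continuous_on_powr' cpoly_eval_continuous) (auto intro: sum_nonneg less_imp_le)
    have contp: "continuous_on UNIV prod_norm"
      unfolding prod_norm_def by (intro continuous_intros cpoly_eval_continuous)
    have "open {z. exp C * weight z powr c < prod_norm z}" by (rule open_Collect_less[OF contw contp])
    then have W: "open (T \<inter> {z. exp C * weight z powr c < prod_norm z})" using T(1) by blast
    have X: "affine_variety I = {x. \<forall>p\<in>eval_fun ` I. p (($) x) = 0}"
      by (auto simp: affine_variety_def eval_fun_nth)
    have "\<exists>x\<in>affine_variety I \<inter> (T \<inter> {z. exp C * weight z powr c < prod_norm z}). regular_point (affine_variety I) x"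
      by (rule regular_points_dense[OF _ X W]) (use z gt eval_fun_polyfun in auto)
    then obtain x where x: "x \<in> affine_variety I" "x \<in> T" "exp C * weight x powr c < prod_norm x"
      "regular_point (affine_variety I) x" by blast
    then have "x \<in> U - sing_locus (affine_variety I)" using T(2) by (simp add: sing_locus_def)
    with U(3) have "prod_norm x \<le> exp C * weight x powr c" by (rule bspec)
    then show False using x(3) by simp
  qed
  define v where "v = (\<lambda>u. enn2real (\<nu> (coset (SOME p. ev p = u))))"
  have v_ev: "v (ev p) = enn2real (\<nu> (coset p))" for p
  proof -
    have "(SOME q. ev q = ev p) = p" by (rule some_equality) (auto dest: ev_inj)
    then show ?thesis by (simp add: v_def)
  qed
  note val = \<nu>(1)[unfolded is_valuation_iff]
  have fin: "\<nu> (coset p) = ennreal (v (ev p))" "0 \<le> v (ev p)" if "p \<notin> I" for p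
  proof -
    have "\<nu> (coset p) \<noteq> \<infinity>" using val that by blast
    then show "\<nu> (coset p) = ennreal (v (ev p))" by (simp add: v_ev less_top)
    show "0 \<le> v (ev p)" by (simp add: v_ev)
  qed
  have repr: "\<exists>p. u = ev p \<and> p \<notin> I" if "u \<in> polyfun {..<CARD('n)} - ev ` I" for u
    using that ev_surj[of u] by blast
  have PI: "P j \<notin> I" if "j \<le> m" for j
  proof
    assume "P j \<in> I"
    then have "\<nu> (coset (P j)) = \<infinity>" using val by blast
    then show False using \<nu>(2)[OF that] by simp
  qed
  obtain \<epsilon> where \<epsilon>: "\<epsilon> > 0" "ball 0 \<epsilon> \<subseteq> T" using T U(2) by (metis IntD2 open_contains_ball)
  define \<epsilon>' where "\<epsilon>' = \<epsilon> / (2 * real CARD('n))"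
  have \<epsilon>': "\<epsilon>' > 0" using \<epsilon>(1) by (simp add: \<epsilon>'_def)
  have "\<exists>x\<in>zeros (ev ` I). (\<forall>i<CARD('n). cmod (x i) \<le> \<epsilon>') \<and>
    cmod (\<Prod>j\<le>m. ev (P j) x) > exp C * (\<Sum>j=1..m. cmod (ev (P j) x) powr (1 / a j)) powr c"
  proof (rule points_from_valuation[OF poly_prime_ev, of v])
    fix u assume "u \<in> polyfun {..<CARD('n)} - ev ` I"
    then obtain p where p: "u = ev p" "p \<notin> I" using repr by blast
    then show "0 \<le> v u" using fin by simp
    fix w assume "w \<in> polyfun {..<CARD('n)} - ev ` I"
    then obtain q where q: "w = ev q" "q \<notin> I" using repr by blast
    have pq: "p * q \<notin> I" using I_prime p(2) q(2) by blast
    have "ennreal (v (ev (p * q))) = ennreal (v (ev p) + v (ev q))"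
    proof -
      have "\<nu> (coset (p * q)) = \<nu> (coset p) + \<nu> (coset q)" using val p(2) q(2) by blast
      then show ?thesis using fin[OF p(2)] fin[OF q(2)] fin[OF pq] by simp
    qed
    then have "v (ev (p * q)) = v (ev p) + v (ev q)"
      using fin(2)[OF p(2)] fin(2)[OF q(2)] fin(2)[OF pq] by (subst (asm) ennreal_inj) auto
    then show "v (u * w) = v u + v w" by (simp add: p q ev_simps)
    show "min (v u) (v w) \<le> v (u + w)" if "u + w \<in> polyfun {..<CARD('n)} - ev ` I"
    proof -
      have pq: "p + q \<notin> I" using that ev_mem[of "p + q"] by (simp add: p q ev_simps)
      have "min (\<nu> (coset p)) (\<nu> (coset q)) \<le> \<nu> (coset (p + q))" using val p(2) q(2) pq by blast
      then have "min (ennreal (v (ev p))) (ennreal (v (ev q))) \<le> ennreal (v (ev (p + q)))"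
        using fin[OF p(2)] fin[OF q(2)] fin[OF pq] by simp
      then have "min (v (ev p)) (v (ev q)) \<le> v (ev (p + q))"
        using fin(2)[OF p(2)] fin(2)[OF q(2)] fin(2)[OF pq] by (auto simp: min_def split: if_splits)
      then show ?thesis by (simp add: p q ev_simps)
    qed
    show "v u = v w" if "u - w \<in> ev ` I"
    proof -
      have "p - q \<in> I" using that ev_mem[of "p - q"] by (simp add: p q ev_simps)
      then have "coset p = coset q" by (simp add: coset_eq_iff)
      then show ?thesis by (simp add: p q v_ev)
    qed
  next
    fix c :: complex assume "c \<noteq> 0"
    then have "\<nu> (coset (cpoly_const c)) = 0" using val by blast
    then show "v (\<lambda>_. c) = 0" using v_ev[of "cpoly_const c"] by (simp add: ev_simps)
  next
    fix j assume j: "j \<le> m"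
    have "a j \<ge> 0" using a0 a_pos[of j] j by (cases "j = 0") auto
    then show "ev (P j) \<in> polyfun {..<CARD('n)} - ev ` I \<and> v (ev (P j)) = a j"
      using PI[OF j] ev_polyfun ev_mem[of "P j"] \<nu>(2)[OF j] by (simp add: v_ev)
  next
    fix x assume x: "x \<in> zeros (ev ` I)" "\<forall>j\<in>{1..m}. ev (P j) x = 0"
    then have "pt x = 0" using common_zero zeros_ev[of x] by (auto simp: ev_def)
    then have "x (e i) = 0" for i by (simp add: pt_def vec_eq_iff)
    moreover have "\<exists>i. k = e i" if "k < CARD('n)" for k using e that by (auto simp: bij_betw_def image_iff set_eq_iff)
    ultimately show "\<forall>k<CARD('n). x k = 0" by blast
  qed (use ev_origin a0 a_pos \<epsilon>' m c sum_a in auto)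
  then obtain x where x: "x \<in> zeros (ev ` I)" "\<forall>i<CARD('n). cmod (x i) \<le> \<epsilon>'"
    "cmod (\<Prod>j\<le>m. ev (P j) x) > exp C * (\<Sum>j=1..m. cmod (ev (P j) x) powr (1 / a j)) powr c" by blast
  have "norm (pt x) \<le> (\<Sum>i\<in>UNIV. cmod (pt x $ i))"
    unfolding norm_vec_def by (rule L2_set_le_sum) simp
  also have "\<dots> \<le> (\<Sum>i\<in>(UNIV :: 'n set). \<epsilon>')" using x(2) e_less by (intro sum_mono) (simp add: pt_def)
  also have "\<dots> < \<epsilon>" using \<epsilon>(1) by (simp add: \<epsilon>'_def)
  finally have "pt x \<in> T" using \<epsilon>(2) by auto
  then have "prod_norm (pt x) \<le> exp C * weight (pt x) powr c" using all x(1) zeros_ev by blast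
  then show False using x(3) by (simp add: prod_norm_def weight_def ev_def prod_norm)
qed

text \<open>For every \<open>\<epsilon> > 0\<close>, the bound with exponent \<open>S + \<epsilon>\<close> and constant \<open>1\<close> fails somewhere in the ball of
  radius \<open>\<epsilon>\<close>. These points are the input of \<open>approximate_valuation\<close>.\<close>

lemma valuation_if_not_admissible:
  assumes na: "\<And>c. c > (\<Sum>j=1..m. a j) \<Longrightarrow> \<not> admissible c"
  shows "\<exists>\<nu>. is_valuation I \<nu> \<and> (\<forall>j\<le>m. \<nu> (coset (P j)) = ennreal (a j))"
proof -
  let ?S = "\<Sum>j=1..m. a j"
  let ?J = "ev ` I" and ?V = "{..<CARD('n)}"
  interpret poly_prime ?V ?J by (rule poly_prime_ev)
  have pts: "\<exists>x\<in>zeros ?J. (\<forall>i<CARD('n). cmod (x i) \<le> \<epsilon>) \<and> (\<forall>j\<le>m. ev (P j) x \<noteq> 0) \<and>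
      (\<Sum>j=1..m. cmod (ev (P j) x) powr (1 / a j)) powr ((\<Sum>j\<le>m. a j) + \<epsilon>) \<le> (\<Prod>j\<le>m. cmod (ev (P j) x))"
    if \<epsilon>: "\<epsilon> > 0" for \<epsilon>
  proof -
    have "\<not> admissible (?S + \<epsilon>)" using na \<epsilon> by simp
    moreover have "openin (top_of_set (affine_variety I)) (affine_variety I \<inter> ball 0 \<epsilon>)" by (simp add: openin_open_Int)
    ultimately obtain z where z: "z \<in> affine_variety I" "z \<in> ball 0 \<epsilon>" "\<not> prod_norm z \<le> exp 0 * weight z powr (?S + \<epsilon>)"
      unfolding admissible_def using zero_mem \<epsilon> by (metis (no_types, lifting) DiffD1 IntE IntI centre_in_ball)
    have "coords z \<in> zeros ?J" using z(1) by (simp add: zeros_ev)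
    moreover have "cmod (coords z i) \<le> \<epsilon>" for i
      unfolding coords_def using z(2) Finite_Cartesian_Product.norm_nth_le[of z "inv_into UNIV e i"] by simp
    moreover have "weight z powr (?S + \<epsilon>) \<le> prod_norm z" using z(3) by simp
    moreover have "cpoly_eval (P j) z \<noteq> 0" if "j \<le> m" for j
    proof
      assume "cpoly_eval (P j) z = 0"
      then have "prod_norm z = 0" using that by (auto simp: prod_norm_def intro!: prod_zero)
      then show False using z(3) by simp
    qed
    ultimately show ?thesis unfolding sum_a
      by (intro bexI[of _ "coords z"]) (auto simp: ev_coords weight_def prod_norm_def)
  qed
  have PP: "g * h \<in> polyfun ?V - ?J" if "g \<in> polyfun ?V - ?J" "h \<in> polyfun ?V - ?J" for g h
    using that prime[of g h] polyfun.mult[of g ?V h] by blast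
  obtain x0 where x0: "x0 \<in> zeros ?J" "\<forall>j\<le>m. ev (P j) x0 \<noteq> 0" using pts[of 1] by auto
  have PJ: "ev (P j) \<in> polyfun ?V - ?J" if "j \<le> m" for j
    using x0 that ev_polyfun unfolding zeros_def by blast
  obtain c where c: "\<forall>Q \<delta>. finite Q \<longrightarrow> Q \<subseteq> polyfun ?V - ?J \<longrightarrow> \<delta> > 0 \<longrightarrow>
    (\<exists>x\<in>zeros ?J. \<exists>l>0. ln 2 \<le> \<delta> * l \<and>
      (\<forall>g\<in>Q. g x \<noteq> 0 \<and> - \<delta> \<le> - ln (cmod (g x)) / l \<and> - ln (cmod (g x)) / l \<le> c g) \<and>
      (\<forall>j\<le>m. ev (P j) x \<noteq> 0 \<and> a j - \<delta> \<le> - ln (cmod (ev (P j) x)) / l) \<and>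
      (\<Sum>j\<le>m. - ln (cmod (ev (P j) x)) / l) \<le> (\<Sum>j\<le>m. a j) + (real m + 2) * \<delta>)"
    by (rule exE[OF approximate_valuation[OF poly_prime_ev ev_polyfun m a0 a_pos ev_origin pts]]) (assumption | rule that)+
  obtain v :: "((nat \<Rightarrow> complex) \<Rightarrow> complex) \<Rightarrow> real" where v: "\<forall>g. 0 \<le> v g"
    "\<forall>g\<in>polyfun ?V - ?J. \<forall>h\<in>polyfun ?V - ?J. v (g * h) = v g + v h"
    "\<forall>g\<in>polyfun ?V - ?J. \<forall>h\<in>polyfun ?V - ?J. g + h \<in> polyfun ?V - ?J \<longrightarrow> min (v g) (v h) \<le> v (g + h)"
    "\<forall>g\<in>polyfun ?V - ?J. \<forall>h\<in>polyfun ?V - ?J. g - h \<in> ?J \<longrightarrow> v g = v h"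
    "\<forall>j\<le>m. v (ev (P j)) = a j"
    by (rule exE[OF valuation_limit[OF PP J_uminus PJ c[rule_format]]]) (assumption | (elim conjE, rule that))+
  define \<nu> where "\<nu> = (\<lambda>f. if f = coset 0 then \<infinity> else ennreal (v (ev (SOME p. f = coset p))))"
  have nI: "ev p \<in> polyfun ?V - ?J \<longleftrightarrow> p \<notin> I" for p using ev_polyfun ev_mem by blast
  have \<nu>_coset: "\<nu> (coset p) = ennreal (v (ev p))" if p: "p \<notin> I" for p
  proof -
    define q where "q = (SOME q. coset p = coset q)"
    have "coset p = coset q" unfolding q_def by (rule someI[of _ p]) simp
    then have pq: "p - q \<in> I" by (simp add: coset_eq_iff)
    have q: "q \<notin> I" using I_add[OF pq, of q] p by auto
    have "ev p - ev q \<in> ?J" using pq by (simp add: ev_simps(2)[symmetric])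
    then have "v (ev p) = v (ev q)" using v(4) p q nI by blast
    moreover have "coset p \<noteq> coset 0" using p by (simp add: coset_eq_iff)
    ultimately show ?thesis by (simp add: \<nu>_def q_def)
  qed
  have \<nu>_zero: "\<nu> (coset p) = \<infinity>" if "p \<in> I" for p
  proof -
    have "coset p = coset 0" using that by (simp add: coset_eq_iff)
    then show ?thesis by (simp add: \<nu>_def)
  qed
  have v_one: "v (ev 1) = 0"
    using v(2)[rule_format, of "ev 1" "ev 1"] I_proper nI by (simp add: ev_simps(3)[symmetric])
  have "is_valuation I \<nu>"
    unfolding is_valuation_iff
  proof (intro conjI allI impI)
    show "\<nu> (coset p) = \<infinity> \<longleftrightarrow> p \<in> I" for p
      using \<nu>_zero[of p] \<nu>_coset[of p] by (cases "p \<in> I") auto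
  next
    fix p q assume p: "p \<notin> I" and q: "q \<notin> I"
    have pq: "p * q \<notin> I" using p q I_prime by blast
    have "v (ev (p * q)) = v (ev p) + v (ev q)" using v(2) p q nI unfolding ev_simps(3) by blast
    then show "\<nu> (coset (p * q)) = \<nu> (coset p) + \<nu> (coset q)"
      using v(1) by (simp add: \<nu>_coset p q pq)
  next
    fix p q assume p: "p \<notin> I" and q: "q \<notin> I" and pq: "p + q \<notin> I"
    have "ev p + ev q \<in> polyfun ?V - ?J" using nI[of "p + q"] pq by (simp add: ev_simps)
    then have "min (v (ev p)) (v (ev q)) \<le> v (ev p + ev q)" using v(3) p q nI by blast
    then have "min (v (ev p)) (v (ev q)) \<le> v (ev (p + q))" by (simp add: ev_simps)
    then show "min (\<nu> (coset p)) (\<nu> (coset q)) \<le> \<nu> (coset (p + q))"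
      using v(1) by (auto simp: \<nu>_coset p q pq min_def ennreal_leI split: if_splits)
  next
    fix c :: complex assume c: "c \<noteq> 0"
    have cc: "cpoly_const c * cpoly_const (1 / c) = 1"
      using c by (simp add: cpoly_const_def mult_single flip: single_one)
    have nc: "cpoly_const d \<notin> I" if "d \<noteq> 0" for d
      using const_notin_J[OF that] ev_mem[of "cpoly_const d"] by (simp add: ev_simps)
    have "v (ev (cpoly_const c) * ev (cpoly_const (1 / c))) = v (ev (cpoly_const c)) + v (ev (cpoly_const (1 / c)))"
      using v(2) nI nc[OF c] nc[of "1 / c"] c by simp
    then have "v (ev (cpoly_const c)) + v (ev (cpoly_const (1 / c))) = 0"
      unfolding ev_simps(3)[symmetric] cc v_one by (rule sym)
    then have "v (ev (cpoly_const c)) = 0" using v(1) by (metis add_nonneg_eq_0_iff)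
    then show "\<nu> (coset (cpoly_const c)) = 0" using \<nu>_coset[OF nc[OF c]] by simp
  next
    have "\<nu> (coset (P 1)) = ennreal (a 1)" using \<nu>_coset[of "P 1"] PJ[of 1] nI v(5) m by simp
    moreover have "\<nu> (coset 1) = 0" using \<nu>_coset[OF I_proper] v_one by simp
    moreover have "a 1 > 0" using a_pos m by simp
    ultimately show "\<exists>p q. p \<notin> I \<and> q \<notin> I \<and> \<nu> (coset p) \<noteq> \<nu> (coset q)"
      using I_proper PJ[of 1] nI m by (intro exI[of _ "P 1"] exI[of _ 1]) auto
  qed
  moreover have "\<nu> (coset (P j)) = ennreal (a j)" if "j \<le> m" for j
    using \<nu>_coset[of "P j"] PJ[OF that] nI v(5) that by simp
  ultimately show ?thesis by blast
qed

text \<open>The sum of the \<open>a j\<close> is itself admissible, so the supremum is at least this sum.\<close>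

lemma relative_type_eq_iff:
  assumes \<psi>: "\<And>z. z \<in> affine_variety I \<Longrightarrow> \<psi> z = elog (prod_norm z)"
    and \<phi>: "\<And>z. z \<in> affine_variety I \<Longrightarrow> \<phi> z = elog (weight z)"
  shows "relative_type (affine_variety I) \<psi> \<phi> = ennreal (\<Sum>j=1..m. a j) \<longleftrightarrow>
    (\<forall>c > \<Sum>j=1..m. a j. \<not> admissible c)"
proof -
  let ?X = "affine_variety I" and ?S = "\<Sum>j=1..m. a j"
  have adm: "(\<exists>U C. openin (top_of_set ?X) U \<and> 0 \<in> U \<and> (\<forall>x\<in>U - sing_locus ?X. \<psi> x \<le> ereal c * \<phi> x + ereal C)) \<longleftrightarrow> admissible c"
    if "c > 0" for c
  proof -
    have "(\<forall>x\<in>U - sing_locus ?X. \<psi> x \<le> ereal c * \<phi> x + ereal C) \<longleftrightarrow>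
      (\<forall>x\<in>U - sing_locus ?X. prod_norm x \<le> exp C * weight x powr c)" if "openin (top_of_set ?X) U" for U C
    proof (intro ball_cong refl)
      fix x assume "x \<in> U - sing_locus ?X"
      then have "x \<in> ?X" using that openin_imp_subset by blast
      then show "\<psi> x \<le> ereal c * \<phi> x + ereal C \<longleftrightarrow> prod_norm x \<le> exp C * weight x powr c"
        using \<psi> \<phi> elog_le_iff[OF prod_norm_nonneg weight_nonneg \<open>c > 0\<close>] by simp
    qed
    then show ?thesis unfolding admissible_def by blast
  qed
  define A where "A = {ennreal c | c. c \<ge> 0 \<and>
     (\<exists>U C. openin (top_of_set ?X) U \<and> 0 \<in> U \<and> (\<forall>x\<in>U - sing_locus ?X. \<psi> x \<le> ereal c * \<phi> x + ereal C))}"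
  have mem: "ennreal c \<in> A" if "admissible c" "c > 0" for c
    unfolding A_def using that adm[OF that(2)] by (auto intro: less_imp_le)
  have le: "ennreal ?S \<le> Sup A" using mem[OF admissible_sum sum_a_pos] by (rule Sup_upper)
  show ?thesis
    unfolding relative_type_def A_def[symmetric]
  proof
    assume eq: "Sup A = ennreal ?S"
    show "\<forall>c>?S. \<not> admissible c"
    proof (intro allI impI notI)
      fix c assume c: "c > ?S" "admissible c"
      then have "c > 0" using sum_a_pos by linarith
      then have "ennreal c \<le> ennreal ?S" using mem c(2) Sup_upper[of "ennreal c" A] eq by simp
      then show False using c(1) sum_a_pos by simp
    qed
  next
    assume na: "\<forall>c>?S. \<not> admissible c"
    have "Sup A \<le> ennreal ?S"
    proof (rule Sup_least)
      fix t assume "t \<in> A"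
      then obtain c where c: "t = ennreal c" "c \<ge> 0"
        "\<exists>U C. openin (top_of_set ?X) U \<and> 0 \<in> U \<and> (\<forall>x\<in>U - sing_locus ?X. \<psi> x \<le> ereal c * \<phi> x + ereal C)"
        unfolding A_def by blast
      have "c \<le> ?S"
      proof (rule ccontr)
        assume "\<not> c \<le> ?S"
        then have cS: "c > ?S" "c > 0" using sum_a_pos by linarith+
        then show False using na adm[OF cS(2)] c(3) by blast
      qed
      then show "t \<le> ennreal ?S" using c(1) by (simp add: ennreal_leI)
    qed
    then show "Sup A = ennreal ?S" using le by simp
  qed
qed

end

end

theorem corollary1p13:
  fixes I :: "'n::finite cpoly set"
    and f :: "nat \<Rightarrow> 'n cpoly set"
    and a :: "nat \<Rightarrow> real"
    and m :: nat
  assumes "primeideal I cpoly_ring"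
    and "0 \<in> affine_variety I"
    and "irreducible_germ_at (affine_variety I) 0"
    and "m \<ge> 1"
    and "\<forall>j\<in>{0..m}. f j \<in> carrier (coord_ring I)"
    and "a 0 = 0"
    and "\<forall>j\<in>{1..m}. a j > 0"
    and "{x \<in> affine_variety I. \<forall>j\<in>{1..m}. coset_eval (f j) x = 0} = {0}"
  shows "(\<exists>\<nu>. is_valuation I \<nu> \<and> (\<forall>j\<in>{0..m}. \<nu> (f j) = ennreal (a j))) \<longleftrightarrow>
    (let F = (\<Otimes>\<^bsub>coord_ring I\<^esub>j\<in>{0..m}. f j);
         \<phi> = (\<lambda>x. elog (\<Sum>j=1..m. cmod (coset_eval (f j) x) powr (1 / a j)))
     in relative_type (affine_variety I) (\<lambda>x. elog (cmod (coset_eval F x))) \<phi>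
          = ennreal (\<Sum>j=1..m. a j))"
proof -
  obtain e :: "'n \<Rightarrow> nat" where "bij_betw e UNIV {..<CARD('n)}"
    using ex_bij_betw_finite_nat[of "UNIV :: 'n set"] by (auto simp: atLeast0LessThan)
  then interpret affine_coordinates I e by (intro affine_coordinates.intro assms(1))
  have "\<forall>j\<in>{0..m}. \<exists>p. f j = coset p" using assms(5) coord_ring_carrier by blast
  then obtain P where P: "\<And>j. j \<in> {0..m} \<Longrightarrow> f j = coset (P j)" by metis
  have ev_f: "coset_eval (f j) z = cpoly_eval (P j) z" if "j \<le> m" "z \<in> affine_variety I" for j z
    using P[of j] coset_eval_coset[OF that(2)] that(1) by simp
  have zero: "{z \<in> affine_variety I. \<forall>j\<in>{1..m}. cpoly_eval (P j) z = 0} = {0}"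
  proof -
    have "{z \<in> affine_variety I. \<forall>j\<in>{1..m}. cpoly_eval (P j) z = 0}
      = {z \<in> affine_variety I. \<forall>j\<in>{1..m}. coset_eval (f j) z = 0}" using ev_f by auto
    then show ?thesis using assms(8) by (simp only:)
  qed
  have a_pos: "a j > 0" if "1 \<le> j" "j \<le> m" for j using assms(7) that by simp
  note ctx = assms(4,6) a_pos zero
  define F where "F = (\<Otimes>\<^bsub>coord_ring I\<^esub>j\<in>{0..m}. f j)"
  have "F = (\<Otimes>\<^bsub>coord_ring I\<^esub>j\<in>{0..m}. coset (P j))"
  proof -
    interpret primeideal I cpoly_ring by (rule prime_I)
    interpret Q: cring "coord_ring I" by (rule quotient_is_cring) (rule is_cring)
    show ?thesis unfolding F_def
      by (rule Q.finprod_cong') (use P coord_ring_carrier in auto)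
  qed
  then have F: "F = coset (\<Prod>j\<in>{0..m}. P j)" by (simp only: coset_finprod finite_atLeastAtMost)
  have prod_eval: "cpoly_eval (\<Prod>j\<in>A. P j) z = (\<Prod>j\<in>A. cpoly_eval (P j) z)" for A z
    by (induction A rule: infinite_finite_induct) (auto simp: cpoly_eval_mult)
  have \<psi>: "elog (cmod (coset_eval F z)) = elog (prod_norm P m z)" if "z \<in> affine_variety I" for z
    using coset_eval_coset[OF that] by (simp add: F prod_eval prod_norm_def[where P=P and a=a and m=m, OF ctx] prod_norm atLeast0AtMost)
  have \<phi>: "elog (\<Sum>j=1..m. cmod (coset_eval (f j) z) powr (1 / a j)) = elog (weight P a m z)" if "z \<in> affine_variety I" for z
    using ev_f[OF _ that] by (simp add: weight_def[where P=P and a=a and m=m, OF ctx])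
  have "(\<exists>\<nu>. is_valuation I \<nu> \<and> (\<forall>j\<in>{0..m}. \<nu> (f j) = ennreal (a j))) \<longleftrightarrow>
    (\<exists>\<nu>. is_valuation I \<nu> \<and> (\<forall>j\<le>m. \<nu> (coset (P j)) = ennreal (a j)))" using P by auto
  also have "\<dots> \<longleftrightarrow> (\<forall>c > \<Sum>j=1..m. a j. \<not> admissible P a m c)"
    using not_admissible_if_valuation[where P=P and a=a and m=m, OF ctx] valuation_if_not_admissible[where P=P and a=a and m=m, OF ctx] by blast
  also have "\<dots> \<longleftrightarrow> relative_type (affine_variety I) (\<lambda>x. elog (cmod (coset_eval F x)))
      (\<lambda>x. elog (\<Sum>j=1..m. cmod (coset_eval (f j) x) powr (1 / a j))) = ennreal (\<Sum>j=1..m. a j)"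
    by (rule relative_type_eq_iff[where P=P and a=a and m=m, OF ctx \<psi> \<phi>, symmetric])
  finally show ?thesis unfolding Let_def F_def .
qed

end
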